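(* Assume that $(\omega_x)_{x\in\mathbb Z}$ is i.i.d. under $\mathrm P$, that there exists $\varepsilon_0\in(0,1/2)$ with $\mathrm P[\varepsilon_0\le \omega_0\le 1-\varepsilon_0]=1$, that $\mathrm E[\log\rho_0]=0$ and that $\sigma:=(\mathrm E[(\log\rho_0)^2])^{1/2}>0$. Then, as $h\to+\infty$, $$\sup_{x\in\mathbb Z}\left|\mathrm P(b_h=x)-\frac{\sigma^2}{h^2}\varphi_\infty\left(\frac{\sigma^2x}{h^2}\right)\right|=o\left(\frac1{h^2}\right).$$
   Context: $\omega=(\omega_x)_{x\in\mathbb Z}$ is a family of i.i.d. random variables with values in $(0,1)$, with joint law $\mathrm P$ and expectation $\mathrm E$; $\rho_x:=\frac{1-\omega_x}{\omega_x}$. The potential $V:\mathbb Z\to\mathbb R$ is $V(x):=\sum_{i=1}^x\log\rho_i$ if $x>0$, $V(0):=0$, $V(x):=-\sum_{i=x+1}^0\log\rho_i$ if $x<0$. Left $h$-extrema. Let $h>0$ and $v:\mathbb Z\to\mathbb R$ (intervals below are intervals of integers). A point $y\in\mathbb Z$ is a left $h$-minimum for $v$ if there exist integers $\alpha<y<\beta$ with $\min_{[\alpha,y-1]}v>v(y)$, $\min_{[y+1,\beta]}v\ge v(y)$, $v(\alpha)\ge v(y)+h$ and $v(\beta)\ge v(y)+h$; $y$ is a left $h$-maximum for $v$ if it is a left $h$-minimum for $-v$; $y$ is a left $h$-extremum if it is one or the other. Let $\mathcal V$ be the set of $v:\mathbb Z\to\mathbb R$ with $\liminf_{\pm\infty}v=-\infty$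 and $\limsup_{\pm\infty}v=+\infty$; under the assumptions of the claim, $V\in\mathcal V$ almost surely. For $v\in\mathcal V$ the left $h$-extrema of $v$ alternate between minima and maxima and can be written $\{x_k(v,h):k\in\mathbb Z\}$ with $k\mapsto x_k(v,h)$ strictly increasing and $x_0(v,h)\le 0<x_1(v,h)$. Define $b_h:=x_0(V,h)$ if $x_0(V,h)$ is a left $h$-minimum for $V$, and $b_h:=x_1(V,h)$ otherwise. The function $\varphi_\infty$ is $\varphi_\infty(x):=\frac2\pi\sum_{k=0}^\infty\frac{(-1)^k}{2k+1}\exp\left(-\frac{(2k+1)^2\pi^2}{8}|x|\right)$, $x\in\mathbb R$. *)

theory Defs
  imports "HOL-Probability.Probability" "HOL-Library.Landau_Symbols"
begin

definition rho :: "real \<Rightarrow> real" where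
  "rho w = (1 - w) / w"

text \<open>The potential associated with an environment \<open>w\<close>, i.e. one realisation of
  \<open>(\<omega>\<^sub>x)\<close>, \<open>x \<in> \<int>\<close>.\<close>

definition potential :: "(int \<Rightarrow> real) \<Rightarrow> int \<Rightarrow> real" where
  "potential w x =
     (if x > 0 then (\<Sum>i\<in>{1..x}. ln (rho (w i)))
      else if x = 0 then 0
      else - (\<Sum>i\<in>{x+1..0}. ln (rho (w i))))"

definition left_h_minimum :: "real \<Rightarrow> (int \<Rightarrow> real) \<Rightarrow> int \<Rightarrow> bool" where
  "left_h_minimum h v y \<longleftrightarrow>
     (\<exists>\<alpha> \<beta>. \<alpha> < y \<and> y < \<beta> \<and>
        Min (v ` {\<alpha>..y - 1}) > v y \<and> Min (v ` {y + 1..\<beta>}) \<ge> v y \<and>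
        v \<alpha> \<ge> v y + h \<and> v \<beta> \<ge> v y + h)"

definition left_h_maximum :: "real \<Rightarrow> (int \<Rightarrow> real) \<Rightarrow> int \<Rightarrow> bool" where
  "left_h_maximum h v y \<longleftrightarrow> left_h_minimum h (\<lambda>z. - v z) y"

definition left_h_extremum :: "real \<Rightarrow> (int \<Rightarrow> real) \<Rightarrow> int \<Rightarrow> bool" where
  "left_h_extremum h v y \<longleftrightarrow> left_h_minimum h v y \<or> left_h_maximum h v y"

text \<open>The enumeration \<open>k \<mapsto> x\<^sub>k(v,h)\<close>. At most one function satisfies the description
  (two increasing enumerations of the same set by \<open>\<int>\<close> differ by a shift, and the
  condition at \<open>0\<close> fixes the shift). One exists if \<open>h > 0\<close>, the lower limits of \<open>v\<close> at
  \<open>\<plusminus>\<infinity>\<close> are \<open>-\<infinity>\<close> and the upper limits are \<open>+\<infinity>\<close>. If none exists, the value is a fixed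
  unspecified function, the same for all such \<open>v\<close> and \<open>h\<close>.\<close>

definition h_extrema_enum :: "(int \<Rightarrow> real) \<Rightarrow> real \<Rightarrow> int \<Rightarrow> int" where
  "h_extrema_enum v h =
     (THE x :: int \<Rightarrow> int. strict_mono x \<and> range x = {y. left_h_extremum h v y} \<and>
        x 0 \<le> 0 \<and> 0 < x 1)"

definition b_bottom :: "real \<Rightarrow> (int \<Rightarrow> real) \<Rightarrow> int" where
  "b_bottom h v = (if left_h_minimum h v (h_extrema_enum v h 0)
                     then h_extrema_enum v h 0 else h_extrema_enum v h 1)"

text \<open>At \<open>x = 0\<close> the series converges only conditionally; \<open>suminf\<close> is the limit of the
  partial sums, as intended.\<close>

definition phi_infty :: "real \<Rightarrow> real" where
  "phi_infty x = 2 / pi *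
     (\<Sum>k. (- 1) ^ k / (2 * real k + 1) * exp (- ((2 * real k + 1)\<^sup>2 * pi\<^sup>2 / 8) * \<bar>x\<bar>))"

end

theory Submission
  imports Defs "HOL-Real_Asymp.Real_Asymp"
begin

text \<open>Cut the potential at \<open>x\<close>. For \<open>x \<le> 0\<close> the event \<open>b_h = x\<close> says that the walk to the left of \<open>x\<close>
  rises by \<open>h\<close> before it returns below, and that the walk to the right of \<open>x\<close> does the same and then reaches
  the last maximum before its first drawdown of size \<open>h\<close> only after the origin; for \<open>x > 0\<close> the sides are
  exchanged. Hence \<open>P(b_h = x)\<close> is an exit probability times the tail of a one-sided peak time.
  Splitting the path at its records expresses the generating function of the peak time through
  the exit from an interval. Exponential martingales give the Laplace limit
  \<open>1 / cosh c\<close> on the scale \<open>h\<^sup>2\<close>, and its partial fractions are the Laplace transform of the law with tail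
  \<open>2 \<phi>\<^sub>\<infinity>\<close>. In the variable \<open>exp (- t)\<close> Laplace transforms are moments on \<open>[0, 1]\<close>; they determine the
  limit, and monotonicity with a continuous limit makes the convergence uniform. The remaining
  constant follows from the fact that the probabilities \<open>P(b_h = x)\<close> sum to one.\<close>

section \<open>Partial fractions of the hyperbolic secant\<close>

text \<open>Each side of a site contributes an exit probability of order 1/h whose constant depends
  on the overshoots of the step law; it is never evaluated. Renewal at ladder epochs writes the
  transform of the peak time as a quotient, and after division by the climb probability every such
  constant occurs once above and once below. So the normalised transform has a universal limit
  although its ingredients have none. What survives is the product of the exit probabilities of the
  two sides. Total mass 1 can determine it only if no mass escapes beyond the scale h^2, uniformly
  in h. The first drawdown time supplies this: its transform is a quotient of the same kind with the
  same limit, and it dominates the distance to the bottom. Ties are the second obstacle. Steps may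
  be of lattice type, left extrema break ties asymmetrically, and mirroring the path turns strict
  comparisons into weak ones. Every path lemma therefore carries a flag and is used once per
  side.\<close>

lemma Digamma_reflection_complex:
  fixes z :: complex
  assumes "z \<notin> \<int>"
  shows "Digamma (1 - z) - Digamma z = of_real pi * cos (of_real pi * z) / sin (of_real pi * z)"
proof -
  have z1: "1 - z \<notin> \<int>"
    using assms by (metis Ints_1 Ints_diff add_diff_cancel_left' diff_add_cancel)
  have z: "z \<notin> \<int>\<^sub>\<le>\<^sub>0" "1 - z \<notin> \<int>\<^sub>\<le>\<^sub>0"
    using assms z1 nonpos_Ints_Int by blast+
  have s: "sin (of_real pi * z) \<noteq> 0"
    using assms sin_eq_0[of "of_real pi * z"] by (auto simp: Ints_def)
  \<comment> \<open>Both sides of Euler's reflection formula are differentiated; dividing by the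
    formula itself then leaves the logarithmic derivative.\<close>
  have "((\<lambda>z. Gamma z * Gamma (1 - z)) has_field_derivative
          Gamma z * Gamma (1 - z) * (Digamma z - Digamma (1 - z))) (at z)"
    using z by (auto intro!: derivative_eq_intros simp: algebra_simps)
  moreover have "((\<lambda>z. of_real pi / sin (of_real pi * z)) has_field_derivative
          - (of_real pi * (cos (of_real pi * z) * of_real pi)) / (sin (of_real pi * z))\<^sup>2) (at z)"
    using s by (auto intro!: derivative_eq_intros simp: power2_eq_square)
  ultimately have "Gamma z * Gamma (1 - z) * (Digamma z - Digamma (1 - z)) =
      - (of_real pi * (cos (of_real pi * z) * of_real pi)) / (sin (of_real pi * z))\<^sup>2"
    unfolding Gamma_reflection_complex[symmetric] by (simp add: Gamma_reflection_complex DERIV_unique)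
  then show ?thesis
  proof -
    let ?p = "complex_of_real pi" and ?s = "sin (of_real pi * z)" and ?c = "cos (of_real pi * z)"
    assume "Gamma z * Gamma (1 - z) * (Digamma z - Digamma (1 - z)) = - (?p * (?c * ?p)) / ?s\<^sup>2"
    then have "?p / ?s * (Digamma z - Digamma (1 - z)) = ?p / ?s * (- (?p * ?c / ?s))"
      unfolding Gamma_reflection_complex by (simp add: power2_eq_square)
    moreover have "?p / ?s \<noteq> 0" using s by simp
    ultimately have "Digamma z - Digamma (1 - z) = - (?p * ?c / ?s)"
      by (metis mult_left_cancel)
    then show ?thesis
      by (simp add: algebra_simps eq_neg_iff_add_eq_0)
  qed
qed

lemma Digamma_sums:
  fixes z :: complex
  assumes "z \<noteq> 0"
  shows "(\<lambda>k. inverse (of_nat (Suc k)) - inverse (z + of_nat k)) sums (Digamma z + euler_mascheroni)"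
  using summable_Digamma[OF assms] by (simp add: Digamma_def summable_sums)

text \<open>With 2 t = pi/2 + i s one has pi (cot t + tan t) = 2 pi / sin (2 t) = 2 pi / cosh s, and
  by reflection both terms on the left are differences of digamma values. The four arguments are
  \<open>u\<close>, \<open>w\<close> and their conjugates, so the digamma series add up to twice
  real parts. Terms come in pairs because each series is a difference.\<close>

lemma sech_paired_sums:
  fixes s :: real
  shows "(\<lambda>k. 4 * pi * (4 * real k + 1) / ((4 * real k + 1)\<^sup>2 * pi\<^sup>2 + 4 * s\<^sup>2)
            - 4 * pi * (4 * real k + 3) / ((4 * real k + 3)\<^sup>2 * pi\<^sup>2 + 4 * s\<^sup>2)) sums (1 / cosh s)"
proof -
  \<comment> \<open>pi * u is half of pi/2 + i s; the shift by 1/2 to \<open>w\<close> produces the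
    terms with 4k + 3.\<close>
  define u where "u = Complex (1/4) (s / (2 * pi))"
  define w where "w = Complex (3/4) (s / (2 * pi))"
  have nint: "u \<notin> \<int>" "1/2 - u \<notin> \<int>"
  proof -
    have "Re u \<notin> \<int>" "Re (1/2 - u) \<notin> \<int>"
      using fraction_not_in_Ints[where 'a = real, of 4 1] by (auto simp: u_def)
    then show "u \<notin> \<int>" "1/2 - u \<notin> \<int>"
      by (metis Ints_cases Ints_of_int Re_complex_of_real of_real_of_int_eq)+
  qed
  have wu: "1/2 + u = w" "1 - u = cnj w" "1/2 - u = cnj u"
    by (auto simp: u_def w_def complex_eq_iff)
  define t where "t = of_real pi * u"
  have d1: "Digamma (cnj w) - Digamma u = of_real pi * cos t / sin t"
    using Digamma_reflection_complex[OF nint(1)] wu by (simp add: t_def)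
  have d2: "Digamma w - Digamma (cnj u) = of_real pi * sin t / cos t"
  proof -
    have "of_real pi * (1/2 - u) = of_real (pi / 2) - t"
      by (simp add: t_def algebra_simps)
    moreover have "1 - (1/2 - u) = w" using wu by (simp add: algebra_simps)
    ultimately show ?thesis
      using Digamma_reflection_complex[OF nint(2)] wu
      by (simp add: cos_diff sin_diff sin_of_real cos_of_real flip: of_real_divide)
  qed
  have c2t: "sin (2 * t) = of_real (cosh s)"
  proof -
    have "2 * t = of_real (pi/2) + \<i> * of_real s"
      by (simp add: t_def u_def complex_eq_iff)
    moreover have "sin (complex_of_real (pi/2)) = 1" "cos (complex_of_real (pi/2)) = 0"
      by (simp_all only: sin_of_real cos_of_real sin_pi_half cos_pi_half of_real_1 of_real_0)
    moreover have "cos (\<i> * of_real s) = of_real (cosh s)"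
      by (simp add: cosh_field_def cos_exp_eq exp_of_real flip: of_real_minus)
    ultimately show ?thesis
      by (simp add: sin_add del: of_real_divide)
  qed
  have nz: "sin t \<noteq> 0" "cos t \<noteq> 0"
    using c2t by (auto simp: sin_double)
  have sum: "(Digamma (cnj w) - Digamma u) + (Digamma w - Digamma (cnj u)) = 2 * of_real pi / of_real (cosh s)"
  proof -
    have "of_real pi * cos t / sin t + of_real pi * sin t / cos t = of_real pi * (cos t ^2 + sin t ^2) / (sin t * cos t)"
      using add_frac_eq[OF nz, of "of_real pi * cos t" "of_real pi * sin t"]
      by (simp only: power2_eq_square distrib_left mult.assoc)
    also have "\<dots> = 2 * of_real pi / sin (2 * t)"
      using nz by (simp add: sin_double)
    finally show ?thesis using d1 d2 c2t by simp
  qed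
  have nz0: "u \<noteq> 0" "w \<noteq> 0" "cnj u \<noteq> 0" "cnj w \<noteq> 0"
    by (auto simp: u_def w_def complex_eq_iff)
  have "(\<lambda>k. ((inverse (of_nat (Suc k)) - inverse (cnj w + of_nat k)) - (inverse (of_nat (Suc k)) - inverse (u + of_nat k)))
           + ((inverse (of_nat (Suc k)) - inverse (w + of_nat k)) - (inverse (of_nat (Suc k)) - inverse (cnj u + of_nat k))))
        sums (((Digamma (cnj w) + euler_mascheroni) - (Digamma u + euler_mascheroni))
            + ((Digamma w + euler_mascheroni) - (Digamma (cnj u) + euler_mascheroni)))"
    by (intro sums_add sums_diff Digamma_sums nz0)
  also have "(((Digamma (cnj w) + euler_mascheroni) - (Digamma u + euler_mascheroni))
            + ((Digamma w + euler_mascheroni) - (Digamma (cnj u) + euler_mascheroni))) = 2 * of_real pi / of_real (cosh s)"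
    using sum by (simp add: algebra_simps)
  finally have "(\<lambda>k. Re (((inverse (of_nat (Suc k)) - inverse (cnj w + of_nat k)) - (inverse (of_nat (Suc k)) - inverse (u + of_nat k)))
           + ((inverse (of_nat (Suc k)) - inverse (w + of_nat k)) - (inverse (of_nat (Suc k)) - inverse (cnj u + of_nat k)))))
           sums Re (2 * of_real pi / of_real (cosh s))"
    by (rule sums_Re)
  then have "(\<lambda>k. (1 / (2 * pi)) * Re (((inverse (of_nat (Suc k)) - inverse (cnj w + of_nat k)) - (inverse (of_nat (Suc k)) - inverse (u + of_nat k)))
           + ((inverse (of_nat (Suc k)) - inverse (w + of_nat k)) - (inverse (of_nat (Suc k)) - inverse (cnj u + of_nat k)))))
           sums ((1 / (2 * pi)) * Re (2 * of_real pi / of_real (cosh s)))"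
    by (rule sums_mult)
  moreover have "(1 / (2 * pi)) * Re (2 * of_real pi / of_real (cosh s)) = 1 / cosh s"
  proof -
    have "2 * of_real pi / of_real (cosh s) = complex_of_real (2 * pi / cosh s)" by simp
    then show ?thesis by (simp only: Re_complex_of_real) simp
  qed
  moreover have "(1 / (2 * pi)) * Re (((inverse (of_nat (Suc k)) - inverse (cnj w + of_nat k)) - (inverse (of_nat (Suc k)) - inverse (u + of_nat k)))
           + ((inverse (of_nat (Suc k)) - inverse (w + of_nat k)) - (inverse (of_nat (Suc k)) - inverse (cnj u + of_nat k))))
       = 4 * pi * (4 * real k + 1) / ((4 * real k + 1)\<^sup>2 * pi\<^sup>2 + 4 * s\<^sup>2)
            - 4 * pi * (4 * real k + 3) / ((4 * real k + 3)\<^sup>2 * pi\<^sup>2 + 4 * s\<^sup>2)" for k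
  proof -
    have R: "Re (inverse (Complex a b + of_nat k)) = (a + k) / ((a + k)\<^sup>2 + b\<^sup>2)" for a b
      by (simp add: power2_eq_square)
    have C: "cnj u = Complex (1/4) (- (s / (2 * pi)))" "cnj w = Complex (3/4) (- (s / (2 * pi)))"
      by (auto simp: u_def w_def complex_eq_iff)
    have F: "(a/4 + k) / ((a/4 + k)\<^sup>2 + (s / (2 * pi))\<^sup>2) = 4 * pi\<^sup>2 * (4 * real k + a) / ((4 * real k + a)\<^sup>2 * pi\<^sup>2 + 4 * s\<^sup>2)"
      if "a > 0" for a :: real
    proof -
      have p: "(4 * real k + a)\<^sup>2 * pi\<^sup>2 + 4 * s\<^sup>2 > 0"
        using that by (intro add_pos_nonneg mult_pos_pos) (auto intro!: zero_less_power add_nonneg_pos)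
      have "(a/4 + k)\<^sup>2 + (s / (2 * pi))\<^sup>2 = ((4 * real k + a)\<^sup>2 * pi\<^sup>2 + 4 * s\<^sup>2) / (16 * pi\<^sup>2)"
        by (simp add: field_simps power2_eq_square)
      moreover have "a/4 + k = (4 * real k + a) / 4" by simp
      ultimately show ?thesis using p by (simp add: field_simps)
    qed
    have p1: "inverse (2 * pi) * 2 * (4 * pi\<^sup>2 * x / y) = 4 * pi * x / y" for x y
      by (simp add: field_simps power2_eq_square)
    have "(1 / (2 * pi)) * Re (((inverse (of_nat (Suc k)) - inverse (cnj w + of_nat k)) - (inverse (of_nat (Suc k)) - inverse (u + of_nat k)))
           + ((inverse (of_nat (Suc k)) - inverse (w + of_nat k)) - (inverse (of_nat (Suc k)) - inverse (cnj u + of_nat k))))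
       = inverse (2 * pi) * 2 * ((1/4 + k) / ((1/4 + k)\<^sup>2 + (s / (2 * pi))\<^sup>2))
          - inverse (2 * pi) * 2 * ((3/4 + k) / ((3/4 + k)\<^sup>2 + (s / (2 * pi))\<^sup>2))"
    proof -
      have gen: "1 / (2 * pi) * (I - W - (I - U) + (I - W - (I - U))) = inverse (2 * pi) * 2 * U - inverse (2 * pi) * 2 * W"
        for I U W :: real by (simp add: field_simps)
      have "(- (s / (2 * pi)))\<^sup>2 = (s / (2 * pi))\<^sup>2" by (rule power2_minus)
      then show ?thesis
        unfolding C unfolding u_def w_def
        by (simp only: minus_complex.sel plus_complex.sel R gen)
    qed
    then show ?thesis
      unfolding F[of 1, simplified] F[of 3, simplified] p1 by simp
  qed
  ultimately show ?thesis by simp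
qed

lemma summable_inverse_odd_squares: "summable (\<lambda>j. 1 / (2 * real j + 1)\<^sup>2)"
proof (rule summable_comparison_test')
  show "summable (\<lambda>n. inverse (real (Suc n) ^ 2))"
    using inverse_squares_sums sums_summable by (auto simp: inverse_eq_divide)
  show "norm (1 / (2 * real n + 1)\<^sup>2) \<le> inverse (real (Suc n) ^ 2)" for n
    by (auto simp: inverse_eq_divide intro!: divide_left_mono power_mono)
qed

text \<open>The ungrouped alternating expansion of 1 / cosh converges only conditionally. Subtracted
  from the Leibniz series for pi/4 it leaves terms of order 1/j^3, so the complement converges
  absolutely; grouping in pairs identifies its sum.\<close>

lemma one_minus_sech_sums:
  fixes s :: real
  shows "(\<lambda>j. 4 / pi * ((-1)^j / (2 * real j + 1) * (4 * s\<^sup>2 / (4 * s\<^sup>2 + (2 * real j + 1)\<^sup>2 * pi\<^sup>2))))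
           sums (1 - 1 / cosh s)"
proof -
  define a where "a = (\<lambda>j. (-1)^j / (2 * real j + 1))"
  define D where "D = (\<lambda>j::nat. 4 * s\<^sup>2 + (2 * real j + 1)\<^sup>2 * pi\<^sup>2)"
  have D: "D j > 0" for j
    unfolding D_def by (intro add_nonneg_pos mult_pos_pos zero_less_power) auto
  have "summable a"
  proof -
    have "(\<lambda>j. 1 / (2 * real j + 1)) \<longlonglongrightarrow> 0" by real_asymp
    then show ?thesis
      using summable_Leibniz'(1)[of "\<lambda>j. 1 / (2 * real j + 1)"] by (simp add: a_def divide_simps)
  qed
  then have a: "a sums (pi / 4)"
  proof -
    have "suminf a = pi / 4"
      unfolding pi_series a_def by (simp add: ac_simps)
    then show ?thesis
      using summable_sums[OF \<open>summable a\<close>] by (simp only:)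
  qed
  have "summable (\<lambda>j. a j * (4 * s\<^sup>2 / D j))"
  proof (rule summable_comparison_test')
    show "summable (\<lambda>j. 4 * s\<^sup>2 / pi\<^sup>2 * (1 / (2 * real j + 1)\<^sup>2))"
      by (intro summable_mult summable_inverse_odd_squares)
    fix j :: nat
    have "norm (a j * (4 * s\<^sup>2 / D j)) = 4 * s\<^sup>2 / ((2 * real j + 1) * D j)"
      using D[of j] by (simp add: a_def abs_mult power_abs abs_divide)
    also have "\<dots> \<le> 4 * s\<^sup>2 / (1 * ((2 * real j + 1)\<^sup>2 * pi\<^sup>2))"
      using D[of j] by (intro divide_left_mono mult_mono mult_pos_pos) (auto simp: D_def)
    finally show "norm (a j * (4 * s\<^sup>2 / D j)) \<le> 4 * s\<^sup>2 / pi\<^sup>2 * (1 / (2 * real j + 1)\<^sup>2)"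
      by (simp add: mult.commute)
  qed
  then obtain S where S: "(\<lambda>j. a j * (4 * s\<^sup>2 / D j)) sums S"
    by (auto simp: summable_def)
  have "(\<lambda>j. 4 / pi * a j - 4 / pi * (a j * (4 * s\<^sup>2 / D j))) sums (4 / pi * (pi / 4) - 4 / pi * S)"
    by (intro sums_diff sums_mult a S)
  also have "(\<lambda>j. 4 / pi * a j - 4 / pi * (a j * (4 * s\<^sup>2 / D j))) =
     (\<lambda>j. (-1)^j * (4 * pi * (2 * real j + 1) / D j))"
  proof
    fix j
    have "1 - 4 * s\<^sup>2 / D j = (2 * real j + 1)\<^sup>2 * pi\<^sup>2 / D j"
      using D[of j] by (simp add: D_def field_simps)
    moreover have "4 / pi * a j - 4 / pi * (a j * (4 * s\<^sup>2 / D j)) = 4 / pi * a j * (1 - 4 * s\<^sup>2 / D j)"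
      by (simp add: algebra_simps)
    ultimately show "4 / pi * a j - 4 / pi * (a j * (4 * s\<^sup>2 / D j)) = (-1)^j * (4 * pi * (2 * real j + 1) / D j)"
      using D[of j] by (simp add: a_def divide_simps power2_eq_square)
  qed
  finally have "(\<lambda>n. \<Sum>j\<in>{n * 2..<n * 2 + 2}. (-1)^j * (4 * pi * (2 * real j + 1) / D j)) sums (4 / pi * (pi / 4) - 4 / pi * S)"
    by (rule sums_group) simp
  also have "(\<lambda>n. \<Sum>j\<in>{n * 2..<n * 2 + 2}. (-1)^j * (4 * pi * (2 * real j + 1) / D j)) =
     (\<lambda>k. 4 * pi * (4 * real k + 1) / ((4 * real k + 1)\<^sup>2 * pi\<^sup>2 + 4 * s\<^sup>2)
            - 4 * pi * (4 * real k + 3) / ((4 * real k + 3)\<^sup>2 * pi\<^sup>2 + 4 * s\<^sup>2))"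
  proof
    fix n :: nat
    have "{n * 2..<n * 2 + 2} = {2 * n, Suc (2 * n)}" by auto
    then show "(\<Sum>j\<in>{n * 2..<n * 2 + 2}. (-1)^j * (4 * pi * (2 * real j + 1) / D j)) =
      4 * pi * (4 * real n + 1) / ((4 * real n + 1)\<^sup>2 * pi\<^sup>2 + 4 * s\<^sup>2)
            - 4 * pi * (4 * real n + 3) / ((4 * real n + 3)\<^sup>2 * pi\<^sup>2 + 4 * s\<^sup>2)"
      by (simp add: D_def add.commute)
  qed
  finally have "4 / pi * (pi / 4) - 4 / pi * S = 1 / cosh s"
    using sech_paired_sums sums_unique2 by blast
  then have "4 / pi * S = 1 - 1 / cosh s" by simp
  then show ?thesis
    using sums_mult[OF S, of "4 / pi"] by (simp add: a_def D_def)
qed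

text \<open>The limiting tail, in the variable \<open>x = exp (- t)\<close> and extended by \<open>0\<close> at \<open>x = 0\<close>.\<close>

definition limit_cdf :: "real \<Rightarrow> real \<Rightarrow> real" where
  "limit_cdf \<kappa> x = 4 / pi * (\<Sum>j. (-1)^j * (x powr (\<kappa> * ((2 * real j + 1)\<^sup>2 * pi\<^sup>2 / 8)) / (2 * real j + 1)))"

context
  fixes \<kappa> :: real
  assumes \<kappa>: "\<kappa> > 0"
begin

text \<open>The remainder of an alternating series is at most its first omitted term, here at most 1
  / (4 n + 1) for every x in [0, 1]. The bound covers x = 1, where the series is the one for pi/4
  and no summable majorant exists.\<close>

lemma limit_cdf_leibniz:
  assumes "0 \<le> x" "x \<le> 1"
  defines "a \<equiv> (\<lambda>j::nat. x powr (\<kappa> * ((2 * real j + 1)\<^sup>2 * pi\<^sup>2 / 8)) / (2 * real j + 1))"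
  shows "\<bar>4 / pi * (\<Sum>j<2*n. (-1)^j * a j) - limit_cdf \<kappa> x\<bar> \<le> 4 / pi * (1 / (4 * real n + 1))"
proof -
  have a0: "0 \<le> a j" "a j \<le> 1 / (2 * real j + 1)" for j
  proof -
    have "x powr (\<kappa> * ((2 * real j + 1)\<^sup>2 * pi\<^sup>2 / 8)) \<le> 1"
      using assms \<kappa> powr_mono2[of "\<kappa> * ((2 * real j + 1)\<^sup>2 * pi\<^sup>2 / 8)" x 1] by simp
    then show "0 \<le> a j" "a j \<le> 1 / (2 * real j + 1)"
      by (auto simp: a_def intro!: divide_right_mono)
  qed
  have mono: "a (Suc j) \<le> a j" for j
  proof -
    have "x powr (\<kappa> * ((2 * real (Suc j) + 1)\<^sup>2 * pi\<^sup>2 / 8)) \<le> x powr (\<kappa> * ((2 * real j + 1)\<^sup>2 * pi\<^sup>2 / 8))"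
      using assms \<kappa> by (intro powr_mono') (auto intro!: mult_left_mono divide_right_mono mult_right_mono power_mono)
    then show ?thesis
      unfolding a_def by (intro frac_le) auto
  qed
  have "(\<lambda>j. 1 / (2 * real j + 1)) \<longlonglongrightarrow> 0"
    by real_asymp
  then have lim: "a \<longlonglongrightarrow> 0"
    by (rule tendsto_0_le[where K = 1]) (use a0 in \<open>auto intro!: always_eventually\<close>)
  note L = summable_Leibniz'[OF lim a0(1) mono]
  have "\<bar>(\<Sum>j<2*n. (-1)^j * a j) - (\<Sum>j. (-1)^j * a j)\<bar> \<le> a (2 * n)"
    using L(2)[of n] L(4)[of n] by auto
  also have "\<dots> \<le> 1 / (4 * real n + 1)"
    using a0(2)[of "2 * n"] by simp
  finally have "4 / pi * \<bar>(\<Sum>j<2*n. (-1)^j * a j) - (\<Sum>j. (-1)^j * a j)\<bar> \<le> 4 / pi * (1 / (4 * real n + 1))"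
    by (intro mult_left_mono) auto
  then show ?thesis
    unfolding limit_cdf_def a_def right_diff_distrib[symmetric] abs_mult by simp
qed

lemma limit_cdf_uniform_limit:
  "uniform_limit {0..1} (\<lambda>n x. 4 / pi * (\<Sum>j<2*n. (-1)^j * (x powr (\<kappa> * ((2 * real j + 1)\<^sup>2 * pi\<^sup>2 / 8)) / (2 * real j + 1))))
     (limit_cdf \<kappa>) sequentially"
proof (rule uniform_limitI)
  fix e :: real assume "e > 0"
  have "(\<lambda>n. 4 / pi * (1 / (4 * real n + 1))) \<longlonglongrightarrow> 0"
    by real_asymp
  then have "\<forall>\<^sub>F n in sequentially. 4 / pi * (1 / (4 * real n + 1)) < e"
    using \<open>e > 0\<close> by (rule order_tendstoD)
  then show "\<forall>\<^sub>F n in sequentially. \<forall>x\<in>{0..1}. dist (4 / pi * (\<Sum>j<2*n. (-1)^j * (x powr (\<kappa> * ((2 * real j + 1)\<^sup>2 * pi\<^sup>2 / 8)) / (2 * real j + 1)))) (limit_cdf \<kappa> x) < e"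
    by eventually_elim (use limit_cdf_leibniz in \<open>fastforce simp only: dist_real_def atLeastAtMost_iff intro: le_less_trans\<close>)
qed

lemma continuous_on_limit_cdf: "continuous_on {0..1} (limit_cdf \<kappa>)"
proof (rule uniform_limit_theorem[OF _ limit_cdf_uniform_limit])
  show "\<forall>\<^sub>F n in sequentially. continuous_on {0..1} (\<lambda>x. 4 / pi * (\<Sum>j<2*n. (-1)^j * (x powr (\<kappa> * ((2 * real j + 1)\<^sup>2 * pi\<^sup>2 / 8)) / (2 * real j + 1))))"
    using \<kappa> by (intro always_eventually allI continuous_intros continuous_on_powr') auto
qed simp

lemma limit_cdf_0: "limit_cdf \<kappa> 0 = 0"
  by (simp add: limit_cdf_def)

lemma limit_cdf_1: "limit_cdf \<kappa> 1 = 1"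
  using pi_series by (simp add: limit_cdf_def mult.commute add.commute)

lemma limit_cdf_exp: "limit_cdf \<kappa> (exp (- \<bar>t\<bar>)) = 2 * phi_infty (\<kappa> * t)"
  using \<kappa> by (simp add: limit_cdf_def phi_infty_def powr_def abs_mult mult_ac)

text \<open>After x = exp (- t) the integral is the Laplace transform of the limiting tail at n.
  Uniform convergence permits termwise integration, and the result is the expansion of 1 - 1 / cosh
  s at s^2 = 2 n / \<kappa>.\<close>

lemma limit_cdf_moment:
  assumes "n \<ge> 1"
  shows "((\<lambda>x. x ^ (n - 1) * limit_cdf \<kappa> x) has_integral (1 - 1 / cosh (sqrt (2 * real n / \<kappa>))) / n) {0..1}"
proof -
  define \<beta> where "\<beta> j = \<kappa> * ((2 * real j + 1)\<^sup>2 * pi\<^sup>2 / 8)" for j :: nat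
  have \<beta>: "\<beta> j > 0" for j
    using \<kappa> by (simp add: \<beta>_def)
  define P where "P = (\<lambda>N x. 4 / pi * (\<Sum>j<2*N. (-1)^j * (x powr \<beta> j / (2 * real j + 1))))"
  have "uniform_limit {0..1} (\<lambda>N x. x ^ (n - 1) * P N x) (\<lambda>x. x ^ (n - 1) * limit_cdf \<kappa> x) sequentially"
  proof (rule uniform_lim_mult)
    show "uniform_limit {0..1} P (limit_cdf \<kappa>) sequentially"
      using limit_cdf_uniform_limit by (simp add: P_def \<beta>_def)
    show "bounded (limit_cdf \<kappa> ` {0..1})"
      by (intro compact_imp_bounded compact_continuous_image continuous_on_limit_cdf) auto
    show "bounded ((\<lambda>x::real. x ^ (n - 1)) ` {0..1})"
      by (intro compact_imp_bounded compact_continuous_image continuous_intros) auto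
  qed (simp add: uniform_limit_const)
  moreover have "continuous_on {0..1} (\<lambda>x. x ^ (n - 1) * P N x)" for N
    unfolding P_def using \<beta> by (intro continuous_intros continuous_on_powr') (auto simp: less_imp_le)
  ultimately obtain I J where I: "\<And>N. ((\<lambda>x. x ^ (n - 1) * P N x) has_integral I N) {0..1}"
     and J: "((\<lambda>x. x ^ (n - 1) * limit_cdf \<kappa> x) has_integral J) {0..1}" and IJ: "I \<longlonglongrightarrow> J"
    by (rule uniform_limit_integral) auto
  have "I N = 4 / pi * (\<Sum>j<2*N. (-1)^j * (1 / (n + \<beta> j) / (2 * real j + 1)))" for N
  proof (rule has_integral_unique[OF I])
    have int_powr: "((\<lambda>x. x powr (real n - 1 + \<beta> j)) has_integral (1 / (n + \<beta> j))) {0..1}" for j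
      using has_integral_powr_from_0[of "real n - 1 + \<beta> j" 1] \<beta>[of j] assms by simp
    have "((\<lambda>x. 4 / pi * (\<Sum>j<2*N. (-1)^j * (x powr (real n - 1 + \<beta> j) / (2 * real j + 1))))
        has_integral (4 / pi * (\<Sum>j<2*N. (-1)^j * (1 / (n + \<beta> j) / (2 * real j + 1))))) {0..1}"
      by (intro has_integral_mult_right has_integral_sum has_integral_divide int_powr) auto
    moreover have "4 / pi * (\<Sum>j<2*N. (-1)^j * (x powr (real n - 1 + \<beta> j) / (2 * real j + 1))) = x ^ (n - 1) * P N x"
      if "x \<in> {0..1}" for x
    \<comment> \<open>At 0 the exponents cannot be merged by \<open>powr_add\<close> when n = 1,
      since x ^ 0 = 1; both sides vanish there because \<open>0 powr r\<close> is 0.\<close>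
    proof (cases "x = 0")
      case False
      then have "x powr (real n - 1 + \<beta> j) = x ^ (n - 1) * x powr \<beta> j" for j
        using that assms by (simp add: powr_add of_nat_diff flip: powr_realpow)
      then show ?thesis by (simp add: P_def sum_distrib_left mult_ac)
    qed (simp add: P_def)
    ultimately show "((\<lambda>x. x ^ (n - 1) * P N x) has_integral (4 / pi * (\<Sum>j<2*N. (-1)^j * (1 / (n + \<beta> j) / (2 * real j + 1))))) {0..1}"
      by (subst (asm) has_integral_cong) auto
  qed
  moreover have "(\<lambda>N. 4 / pi * (\<Sum>j<2*N. (-1)^j * (1 / (n + \<beta> j) / (2 * real j + 1)))) \<longlonglongrightarrow> (1 - 1 / cosh (sqrt (2 * real n / \<kappa>))) / n"
  proof -
    define s where "s = sqrt (2 * real n / \<kappa>)"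
    have s2: "s\<^sup>2 = 2 * real n / \<kappa>" using \<kappa> by (simp add: s_def)
    have eq: "4 / pi * ((-1)^j / (2 * real j + 1) * (4 * s\<^sup>2 / (4 * s\<^sup>2 + (2 * real j + 1)\<^sup>2 * pi\<^sup>2))) / n
           = 4 / pi * ((-1)^j * (1 / (n + \<beta> j) / (2 * real j + 1)))" for j
    proof -
      have "4 * s\<^sup>2 + (2 * real j + 1)\<^sup>2 * pi\<^sup>2 = 8 / \<kappa> * (n + \<beta> j)"
        using \<kappa> by (simp add: s2 \<beta>_def field_simps)
      moreover have "4 * s\<^sup>2 = 8 / \<kappa> * n" by (simp add: s2)
      moreover have "8 / \<kappa> \<noteq> 0" using \<kappa> by simp
      ultimately have "4 * s\<^sup>2 / (4 * s\<^sup>2 + (2 * real j + 1)\<^sup>2 * pi\<^sup>2) = n / (n + \<beta> j)"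
        by (simp only: mult_divide_mult_cancel_left simp_thms)
      then show ?thesis using assms by simp
    qed
    have "(\<lambda>j. 4 / pi * ((-1)^j * (1 / (n + \<beta> j) / (2 * real j + 1)))) sums ((1 - 1 / cosh s) / n)"
      using sums_divide[OF one_minus_sech_sums[of s], of n] unfolding eq .
    then have "(\<lambda>N. \<Sum>j<2*N. 4 / pi * ((-1)^j * (1 / (n + \<beta> j) / (2 * real j + 1)))) \<longlonglongrightarrow> (1 - 1 / cosh s) / n"
      unfolding sums_def by (rule filterlim_compose) (auto intro!: filterlim_subseq simp: strict_mono_def)
    then show ?thesis by (simp add: sum_distrib_left s_def)
  qed
  ultimately have "I \<longlonglongrightarrow> (1 - 1 / cosh (sqrt (2 * real n / \<kappa>))) / n"
    by presburger
  then have "J = (1 - 1 / cosh (sqrt (2 * real n / \<kappa>))) / n"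
    using IJ LIMSEQ_unique by blast
  then show ?thesis using J by simp
qed

end

section \<open>Uniform convergence from convergence of moments\<close>

text \<open>Polynomials are uniformly dense among the continuous weights and all
  \<open>\<Theta> h\<close> are bounded by 1, so convergence of the moments passes to every
  continuous weight.\<close>

lemma tendsto_integral_weierstrass:
  fixes \<Theta> :: "'h \<Rightarrow> real \<Rightarrow> real" and g u :: "real \<Rightarrow> real"
  assumes mono: "\<And>h. mono_on {0..1} (\<Theta> h)"
    and rng: "\<And>h x. x \<in> {0..1} \<Longrightarrow> \<Theta> h x \<in> {0..1}"
    and g: "continuous_on {0..1} g"
    and mom: "\<And>k. ((\<lambda>h. integral {0..1} (\<lambda>x. x ^ k * \<Theta> h x)) \<longlongrightarrow> integral {0..1} (\<lambda>x. x ^ k * g x)) F"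
    and u: "continuous_on {0..1} u"
  shows "((\<lambda>h. integral {0..1} (\<lambda>x. u x * \<Theta> h x)) \<longlongrightarrow> integral {0..1} (\<lambda>x. u x * g x)) F"
    and "\<And>h. (\<lambda>x. u x * \<Theta> h x) integrable_on {0..1}"
proof -
  have cint: "(\<lambda>x. v x * \<Theta> h x) integrable_on {0..1}" if "continuous_on {0..1} v" for v :: "real \<Rightarrow> real" and h
  proof -
    have "v integrable_on {0..1}" using that by (rule integrable_continuous_interval)
    \<comment> \<open>The second mean value theorem enters through its integrability part: a
      monotone function times an integrable one is integrable.\<close>
    then obtain c where "((\<lambda>x. \<Theta> h x * v x) has_integral (\<Theta> h 0 * integral {0..c} v + \<Theta> h 1 * integral {c..1} v)) {0..1}"
      by (rule second_mean_value_theorem_full[where g = "\<Theta> h"]) (use mono[of h] in \<open>auto simp: mono_on_def\<close>)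
    then show ?thesis by (auto simp: integrable_on_def mult.commute)
  qed
  show "(\<lambda>x. u x * \<Theta> h x) integrable_on {0..1}" for h by (rule cint[OF u])
  have gint: "(\<lambda>x. v x * g x) integrable_on {0..1}" if "continuous_on {0..1} v" for v :: "real \<Rightarrow> real"
    using that g by (intro integrable_continuous_interval continuous_intros)
  have "bounded (g ` {0..1})"
    by (intro compact_imp_bounded compact_continuous_image g) auto
  then obtain G where G: "\<forall>x\<in>{0..1}. \<bar>g x\<bar> \<le> G" "G > 0"
    unfolding bounded_pos by auto
  have poly: "((\<lambda>h. integral {0..1} (\<lambda>x. p x * \<Theta> h x)) \<longlongrightarrow> integral {0..1} (\<lambda>x. p x * g x)) F"
    if "real_polynomial_function p" for p
  proof -
    obtain a n where p: "p = (\<lambda>x. \<Sum>i\<le>n. a i * x ^ i)"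
      using \<open>real_polynomial_function p\<close> by (auto simp: real_polynomial_function_iff_sum)
    have eq: "integral {0..1} (\<lambda>x. p x * f x) = (\<Sum>i\<le>n. a i * integral {0..1} (\<lambda>x. x ^ i * f x))"
      if "\<And>i. (\<lambda>x. x ^ i * f x) integrable_on {0..1}" for f
    proof -
      have "(\<lambda>x. p x * f x) = (\<lambda>x. \<Sum>i\<le>n. a i * (x ^ i * f x))"
        by (simp add: p sum_distrib_right mult.assoc)
      then show ?thesis
        using that by (simp add: integral_sum integrable_on_mult_right)
    qed
    show ?thesis
      by (subst (1 2) eq) (auto intro!: cint gint continuous_intros tendsto_sum tendsto_mult mom)
  qed
  show "((\<lambda>h. integral {0..1} (\<lambda>x. u x * \<Theta> h x)) \<longlongrightarrow> integral {0..1} (\<lambda>x. u x * g x)) F"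
  proof (rule tendstoI)
    fix e :: real assume "e > 0"
    \<comment> \<open>Replacing \<open>u\<close> by a polynomial costs d in the integral with
      \<open>\<Theta> h\<close>, which is bounded by 1, and d * G in the one with \<open>g\<close>:
      together e / 4.\<close>
    define d where "d = e / 4 / (1 + G)"
    have "d > 0" using \<open>e > 0\<close> G by (simp add: d_def)
    obtain p where p: "real_polynomial_function p" "\<And>x. x \<in> {0..1} \<Longrightarrow> \<bar>u x - p x\<bar> < d"
      using Stone_Weierstrass_real_polynomial_function[OF _ u \<open>d > 0\<close>] by auto
    have pc: "continuous_on {0..1} p"
      using p(1) by (auto intro!: continuous_on_polymonial_function simp: real_polynomial_function_eq)
    have close: "\<bar>integral {0..1} (\<lambda>x. u x * f x) - integral {0..1} (\<lambda>x. p x * f x)\<bar> \<le> d * B"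
      if "(\<lambda>x. u x * f x) integrable_on {0..1}" "(\<lambda>x. p x * f x) integrable_on {0..1}"
         "\<And>x. x \<in> {0..1} \<Longrightarrow> \<bar>f x\<bar> \<le> B" for f :: "real \<Rightarrow> real" and B
    proof -
      have "integral {0..1} (\<lambda>x. u x * f x) - integral {0..1} (\<lambda>x. p x * f x) = integral {0..1} (\<lambda>x. u x * f x - p x * f x)"
        using that by (simp add: integral_diff)
      also have "norm \<dots> \<le> integral {0..1} (\<lambda>x::real. d * B)"
      proof (rule integral_norm_bound_integral)
        show "(\<lambda>x. u x * f x - p x * f x) integrable_on {0..1}"
          using that by (intro integrable_diff)
        show "norm (u x * f x - p x * f x) \<le> d * B" if "x \<in> {0..1}" for x
        proof -
          have "norm (u x * f x - p x * f x) = \<bar>u x - p x\<bar> * \<bar>f x\<bar>"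
            by (simp add: abs_mult flip: left_diff_distrib)
          also have "\<dots> \<le> d * B"
            using p(2)[OF that] \<open>\<And>x. x \<in> {0..1} \<Longrightarrow> \<bar>f x\<bar> \<le> B\<close>[OF that] \<open>d > 0\<close>
            by (intro mult_mono) auto
          finally show ?thesis .
        qed
      qed auto
      finally show ?thesis by simp
    qed
    have "\<forall>\<^sub>F h in F. dist (integral {0..1} (\<lambda>x. p x * \<Theta> h x)) (integral {0..1} (\<lambda>x. p x * g x)) < e / 2"
      using \<open>e > 0\<close> by (intro tendstoD[OF poly[OF p(1)]]) simp
    then show "\<forall>\<^sub>F h in F. dist (integral {0..1} (\<lambda>x. u x * \<Theta> h x)) (integral {0..1} (\<lambda>x. u x * g x)) < e"
    proof eventually_elim
      case (elim h)
      have "\<bar>integral {0..1} (\<lambda>x. u x * \<Theta> h x) - integral {0..1} (\<lambda>x. p x * \<Theta> h x)\<bar> \<le> d * 1"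
        using rng[of _ h] by (intro close cint u pc) auto
      moreover have "\<bar>integral {0..1} (\<lambda>x. u x * g x) - integral {0..1} (\<lambda>x. p x * g x)\<bar> \<le> d * G"
        using G(1) by (intro close gint u pc) auto
      moreover have "d * 1 + d * G = e / 4"
      proof -
        have "1 + G \<noteq> 0" using G by simp
        then have "d * (1 + G) = e / 4" using d_def by (simp only: nonzero_eq_divide_eq simp_thms)
        then show ?thesis by (simp add: distrib_left)
      qed
      ultimately show ?case
        using elim \<open>e > 0\<close> unfolding dist_real_def by linarith
    qed
  qed
qed

text \<open>A convergent Hausdorff moment problem: test functions supported on \<open>[a, b]\<close> trap the monotone
  functions \<open>\<Theta> h\<close>.\<close>

lemma moments_trap:
  fixes \<Theta> :: "'h \<Rightarrow> real \<Rightarrow> real" and g :: "real \<Rightarrow> real"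
  assumes mono: "\<And>h. mono_on {0..1} (\<Theta> h)"
    and rng: "\<And>h x. x \<in> {0..1} \<Longrightarrow> \<Theta> h x \<in> {0..1}"
    and g: "continuous_on {0..1} g"
    and mom: "\<And>k. ((\<lambda>h. integral {0..1} (\<lambda>x. x ^ k * \<Theta> h x)) \<longlongrightarrow> integral {0..1} (\<lambda>x. x ^ k * g x)) F"
    and ab: "0 \<le> a" "a < b" "b \<le> 1" and e: "e > 0"
  shows "(\<And>x. x \<in> {a..b} \<Longrightarrow> g x \<le> C) \<Longrightarrow> \<forall>\<^sub>F h in F. \<Theta> h a < C + e"
    and "(\<And>x. x \<in> {a..b} \<Longrightarrow> g x \<ge> C) \<Longrightarrow> \<forall>\<^sub>F h in F. \<Theta> h b > C - e"
proof -
  \<comment> \<open>A tent over [a, b]. Wherever it is positive, monotonicity puts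
    \<open>\<Theta> h x\<close> between \<open>\<Theta> h a\<close> and \<open>\<Theta> h b\<close>,
    so a single value of \<open>\<Theta> h\<close> is compared with a weighted average of
    \<open>g\<close> near it.\<close>
  define u :: "real \<Rightarrow> real" where "u x = max 0 (min (x - a) (b - x))" for x
  have u: "continuous_on {0..1} u"
    unfolding u_def by (intro continuous_intros)
  have u0: "u x \<ge> 0" "x \<notin> {a..b} \<Longrightarrow> u x = 0" for x
    by (auto simp: u_def)
  define I where "I = integral {0..1} u"
  have "I > 0"
  proof -
    \<comment> \<open>On the middle half of [a, b] the tent is at least (b - a) / 4.\<close>
    have "I \<ge> integral {a + (b - a) / 4..b - (b - a) / 4} u"
      unfolding I_def using ab u u0
      by (intro integral_subset_le integrable_continuous_interval continuous_on_subset[OF u]) (auto simp: field_simps)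
    moreover have "integral {a + (b - a) / 4..b - (b - a) / 4} (\<lambda>_. (b - a) / 4) \<le> integral {a + (b - a) / 4..b - (b - a) / 4} u"
      using ab by (intro integral_le integrable_continuous_interval continuous_on_subset[OF u]) (auto simp: u_def field_simps)
    moreover have "integral {a + (b - a) / 4..b - (b - a) / 4} (\<lambda>_. (b - a) / 4) > 0"
    proof -
      have "b - (b - a) / 4 - (a + (b - a) / 4) = (b - a) / 2" "a + (b - a) / 4 \<le> b - (b - a) / 4"
        using ab by (simp_all add: field_simps)
      then show ?thesis using ab by (simp add: content_real)
    qed
    ultimately show ?thesis by linarith
  qed
  note lim = tendsto_integral_weierstrass(1)[OF mono rng g mom u]
  note int = tendsto_integral_weierstrass(2)[OF mono rng g mom u]
  have uint: "u integrable_on {0..1}" using u by (rule integrable_continuous_interval)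
  have gint: "(\<lambda>x. u x * g x) integrable_on {0..1}"
    using u g by (intro integrable_continuous_interval continuous_intros)
  have cst: "integral {0..1} (\<lambda>x. u x * c) = I * c" for c
    unfolding I_def by (rule integral_mult_left)
  {
    assume C: "\<And>x. x \<in> {a..b} \<Longrightarrow> g x \<le> C"
    have "integral {0..1} (\<lambda>x. u x * g x) \<le> integral {0..1} (\<lambda>x. u x * C)"
    proof (rule integral_le[OF gint])
      show "u x * g x \<le> u x * C" for x
        using C[of x] u0[of x] by (cases "x \<in> {a..b}") (auto intro: mult_left_mono)
    qed (use uint in \<open>auto intro: integrable_on_mult_left\<close>)
    also have "\<dots> < I * (C + e)"
      unfolding cst using \<open>I > 0\<close> e by simp
    finally have "\<forall>\<^sub>F h in F. integral {0..1} (\<lambda>x. u x * \<Theta> h x) < I * (C + e)"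
      using lim by (rule order_tendstoD(2)[rotated])
    then show "\<forall>\<^sub>F h in F. \<Theta> h a < C + e"
    proof eventually_elim
      case (elim h)
      have "integral {0..1} (\<lambda>x. u x * \<Theta> h a) \<le> integral {0..1} (\<lambda>x. u x * \<Theta> h x)"
      proof (rule integral_le[OF _ int])
        show "u x * \<Theta> h a \<le> u x * \<Theta> h x" if "x \<in> {0..1}" for x
          using u0[of x] mono_onD[OF mono[of h], of a x] ab that
          by (cases "x \<in> {a..b}") (auto intro: mult_left_mono)
      qed (use uint in \<open>auto intro: integrable_on_mult_left\<close>)
      then have "I * \<Theta> h a < I * (C + e)" using elim unfolding cst by linarith
      then show ?case using \<open>I > 0\<close> by simp
    qed
  }
  {
    assume C: "\<And>x. x \<in> {a..b} \<Longrightarrow> g x \<ge> C"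
    have "I * (C - e) < integral {0..1} (\<lambda>x. u x * C)"
      unfolding cst using \<open>I > 0\<close> e by simp
    also have "\<dots> \<le> integral {0..1} (\<lambda>x. u x * g x)"
    proof (rule integral_le[OF _ gint])
      show "u x * C \<le> u x * g x" for x
        using C[of x] u0[of x] by (cases "x \<in> {a..b}") (auto intro: mult_left_mono)
    qed (use uint in \<open>auto intro: integrable_on_mult_left\<close>)
    finally have "\<forall>\<^sub>F h in F. integral {0..1} (\<lambda>x. u x * \<Theta> h x) > I * (C - e)"
      using lim by (rule order_tendstoD(1)[rotated])
    then show "\<forall>\<^sub>F h in F. \<Theta> h b > C - e"
    proof eventually_elim
      case (elim h)
      have "integral {0..1} (\<lambda>x. u x * \<Theta> h x) \<le> integral {0..1} (\<lambda>x. u x * \<Theta> h b)"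
      proof (rule integral_le[OF int])
        show "u x * \<Theta> h x \<le> u x * \<Theta> h b" if "x \<in> {0..1}" for x
          using u0[of x] mono_onD[OF mono[of h], of x b] ab that
          by (cases "x \<in> {a..b}") (auto intro: mult_left_mono)
      qed (use uint in \<open>auto intro: integrable_on_mult_left\<close>)
      then have "I * (C - e) < I * \<Theta> h b" using elim unfolding cst by linarith
      then show ?case using \<open>I > 0\<close> by simp
    qed
  }
qed

text \<open>Polya's argument: for monotone functions with a continuous limit, closeness on a finite
  grid spreads to the whole interval. At a grid point the upper bound comes from the cell on its
  right, the lower bound from the cell on its left. At the two ends, where one cell is missing,
  \<open>g 0 = 0\<close>, \<open>g 1 = 1\<close> and the range of \<open>\<Theta> h\<close> replace
  it.\<close>

lemma moments_uniform_convergence: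
  fixes \<Theta> :: "'h \<Rightarrow> real \<Rightarrow> real" and g :: "real \<Rightarrow> real"
  assumes mono: "\<And>h. mono_on {0..1} (\<Theta> h)"
    and rng: "\<And>h x. x \<in> {0..1} \<Longrightarrow> \<Theta> h x \<in> {0..1}"
    and g: "continuous_on {0..1} g" "g 0 = 0" "g 1 = 1"
    and mom: "\<And>k. ((\<lambda>h. integral {0..1} (\<lambda>x. x ^ k * \<Theta> h x)) \<longlongrightarrow> integral {0..1} (\<lambda>x. x ^ k * g x)) F"
  shows "uniform_limit {0..1} \<Theta> g F"
proof (rule uniform_limitI)
  fix e :: real assume "e > 0"
  have "uniformly_continuous_on {0..1} g"
    using g(1) compact_uniformly_continuous by blast
  then obtain d where d: "d > 0" "\<And>x y. x \<in> {0..1} \<Longrightarrow> y \<in> {0..1} \<Longrightarrow> \<bar>x - y\<bar> < d \<Longrightarrow> \<bar>g x - g y\<bar> < e / 4"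
    using \<open>e > 0\<close> unfolding uniformly_continuous_on_def dist_real_def
    by (metis zero_less_divide_iff zero_less_numeral abs_minus_commute)
  obtain N :: nat where N: "real N > 3 / d" "N > 0"
    using reals_Archimedean2[of "max 1 (3 / d)"] by auto
  have step: "3 / N < d" using N d by (simp add: field_simps)
  define p where "p i = real i / N" for i :: nat
  have p01: "p i \<in> {0..1}" if "i \<le> N" for i using that N by (auto simp: p_def)
  have up: "\<forall>\<^sub>F h in F. \<Theta> h (p i) < g (p i) + e / 4 + e / 4" if "i < N" for i
  proof (rule moments_trap(1)[OF mono rng g(1) mom])
    show "0 \<le> p i" "p i < p (Suc i)" "p (Suc i) \<le> 1" "e / 4 > 0"
      using that N \<open>e > 0\<close> by (auto simp: p_def field_simps)
    fix x assume x: "x \<in> {p i..p (Suc i)}"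
    then have "\<bar>x - p i\<bar> \<le> 1 / N" by (auto simp: p_def add_divide_distrib)
    moreover have "1 / N < d" using step N by (simp add: field_simps)
    ultimately have "\<bar>g x - g (p i)\<bar> < e / 4"
      using x p01[of i] p01[of "Suc i"] that by (intro d(2)) auto
    then show "g x \<le> g (p i) + e / 4" by linarith
  qed
  have dn: "\<forall>\<^sub>F h in F. \<Theta> h (p (Suc i)) > g (p (Suc i)) - e / 4 - e / 4" if "i < N" for i
  proof (rule moments_trap(2)[OF mono rng g(1) mom])
    show "0 \<le> p i" "p i < p (Suc i)" "p (Suc i) \<le> 1" "e / 4 > 0"
      using that N \<open>e > 0\<close> by (auto simp: p_def field_simps)
    fix x assume x: "x \<in> {p i..p (Suc i)}"
    then have "\<bar>x - p (Suc i)\<bar> \<le> 1 / N" by (auto simp: p_def add_divide_distrib)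
    moreover have "1 / N < d" using step N by (simp add: field_simps)
    ultimately have "\<bar>g x - g (p (Suc i))\<bar> < e / 4"
      using x p01[of i] p01[of "Suc i"] that by (intro d(2)) auto
    then show "g (p (Suc i)) - e / 4 \<le> g x" by linarith
  qed
  have "\<forall>\<^sub>F h in F. \<forall>i\<in>{..<N}. \<Theta> h (p i) < g (p i) + e / 4 + e / 4"
    by (intro eventually_ball_finite) (use up in auto)
  moreover have "\<forall>\<^sub>F h in F. \<forall>i\<in>{..<N}. \<Theta> h (p (Suc i)) > g (p (Suc i)) - e / 4 - e / 4"
    by (intro eventually_ball_finite) (use dn in auto)
  ultimately show "\<forall>\<^sub>F h in F. \<forall>x\<in>{0..1}. dist (\<Theta> h x) (g x) < e"
  proof eventually_elim
    case (elim h)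
    show ?case
    proof
      fix x :: real assume x: "x \<in> {0..1}"
      \<comment> \<open>The point 1 is assigned to the last cell; every other point goes to the cell
        that starts at or before it.\<close>
      define i where "i = (if x = 1 then N - 1 else nat \<lfloor>x * N\<rfloor>)"
      have i: "i < N" "p i \<le> x" "x \<le> p (Suc i)"
      proof -
        have "i < N \<and> real i \<le> x * N \<and> x * N \<le> real (Suc i)"
        proof (cases "x = 1")
          case False
          then have "x * N < N" "0 \<le> x * N" using x N by auto
          then have "real i \<le> x * N" "x * N < real i + 1"
            using False by (simp_all add: i_def)
          then have "real i < real N" using \<open>x * N < N\<close> by linarith
          then show ?thesis
            using \<open>real i \<le> x * N\<close> \<open>x * N < real i + 1\<close> by simp
        qed (use N in \<open>simp add: i_def\<close>)
        then show "i < N" "p i \<le> x" "x \<le> p (Suc i)"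
          using N by (auto simp: p_def field_simps)
      qed
      have near: "\<bar>g y - g x\<bar> < e / 4" if "y = p i \<or> y = p (Suc i)" for y
      proof -
        have "y \<in> {0..1}" using that p01[of i] p01[of "Suc i"] i by auto
        have "p (Suc i) - p i = 1 / N" by (simp add: p_def diff_divide_distrib[symmetric])
        moreover have "1 / N < d" using step N by (simp add: field_simps)
        ultimately have "\<bar>y - x\<bar> < d"
          using that i by auto
        then show ?thesis using d(2) x \<open>y \<in> {0..1}\<close> by auto
      qed
      have "\<Theta> h x < g x + e"
      proof (cases "Suc i < N")
        case True
        have "\<Theta> h x \<le> \<Theta> h (p (Suc i))"
          using mono_onD[OF mono[of h], of x "p (Suc i)"] x i p01[of "Suc i"] True by auto
        moreover have "\<Theta> h (p (Suc i)) < g (p (Suc i)) + e / 4 + e / 4"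
          using elim(1) True by blast
        moreover have "\<bar>g (p (Suc i)) - g x\<bar> < e / 4" by (rule near) simp
        ultimately show ?thesis using \<open>e > 0\<close> by linarith
      next
        case False
        then have "Suc i = N" using i by simp
        then have "p (Suc i) = 1" using N by (simp add: p_def)
        then have "g (p (Suc i)) = 1" using g(3) by simp
        moreover have "\<bar>g (p (Suc i)) - g x\<bar> < e / 4" by (rule near) simp
        moreover have "\<Theta> h x \<le> 1" using rng[OF x, of h] by simp
        ultimately show ?thesis using \<open>e > 0\<close> by linarith
      qed
      moreover have "\<Theta> h x > g x - e"
      proof (cases i)
        case 0
        then have "p i = 0" by (simp add: p_def)
        then have "g (p i) = 0" using g(2) by simp
        moreover have "\<bar>g (p i) - g x\<bar> < e / 4" by (rule near) simp
        moreover have "0 \<le> \<Theta> h x" using rng[OF x, of h] by simp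
        ultimately show ?thesis using \<open>e > 0\<close> by linarith
      next
        case (Suc i')
        have "\<Theta> h (p i) \<le> \<Theta> h x"
          using mono_onD[OF mono[of h], of "p i" x] x i p01[of i] by auto
        moreover have "\<Theta> h (p i) > g (p i) - e / 4 - e / 4"
          using elim(2) Suc i by auto
        moreover have "\<bar>g (p i) - g x\<bar> < e / 4" by (rule near) simp
        ultimately show ?thesis using \<open>e > 0\<close> by linarith
      qed
      ultimately show "dist (\<Theta> h x) (g x) < e" by (auto simp: dist_real_def)
    qed
  qed
qed

section \<open>Exits and drawdowns of a path\<close>

definition walk :: "(nat \<Rightarrow> real) \<Rightarrow> nat \<Rightarrow> real" where
  "walk y n = (\<Sum>i<n. y i)"

definition shift :: "nat \<Rightarrow> (nat \<Rightarrow> 'b) \<Rightarrow> nat \<Rightarrow> 'b" where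
  "shift k y i = y (k + i)"

lemma walk_0 [simp]: "walk y 0 = 0"
  by (simp add: walk_def)

lemma walk_Suc: "walk y (Suc n) = walk y n + y n"
  by (simp add: walk_def)

lemma walk_uminus [simp]: "walk (\<lambda>i. - y i) n = - walk y n"
  by (simp add: walk_def sum_negf)

lemma walk_shift: "walk (shift k y) n = walk y (k + n) - walk y k"
  by (induction n) (simp_all add: walk_Suc shift_def)

text \<open>The flag \<open>w\<close> selects weak records. A left extremum seen from the right of it involves strict
  records, seen from the left of it weak ones.\<close>

definition hit :: "bool \<Rightarrow> real \<Rightarrow> bool" where
  "hit w e \<longleftrightarrow> 0 < e \<or> w \<and> e = 0"

lemma hitD: "hit w e \<Longrightarrow> 0 \<le> e" "\<not> hit w e \<Longrightarrow> e \<le> 0"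
  by (auto simp: hit_def)

text \<open>Exit of the walk from the strip between 0 and h through the top; \<open>hit_at\<close>
  is exit through the bottom and \<open>alive\<close> is no exit so far. The conditions start at
  time 1, since with weak records the start itself would count as a bottom exit.\<close>

definition top_at :: "bool \<Rightarrow> real \<Rightarrow> (nat \<Rightarrow> real) \<Rightarrow> nat \<Rightarrow> bool" where
  "top_at w h y k \<longleftrightarrow> 1 \<le> k \<and> h \<le> walk y k \<and> (\<forall>j. 1 \<le> j \<and> j < k \<longrightarrow> walk y j < h \<and> \<not> hit w (- walk y j))"

definition hit_at :: "bool \<Rightarrow> real \<Rightarrow> (nat \<Rightarrow> real) \<Rightarrow> nat \<Rightarrow> bool" where
  "hit_at w h y k \<longleftrightarrow> 1 \<le> k \<and> hit w (- walk y k) \<and> (\<forall>j. 1 \<le> j \<and> j < k \<longrightarrow> walk y j < h \<and> \<not> hit w (- walk y j))"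

definition alive :: "bool \<Rightarrow> real \<Rightarrow> (nat \<Rightarrow> real) \<Rightarrow> nat \<Rightarrow> bool" where
  "alive w h y n \<longleftrightarrow> (\<forall>j. 1 \<le> j \<and> j \<le> n \<longrightarrow> walk y j < h \<and> \<not> hit w (- walk y j))"

definition first_drawdown :: "real \<Rightarrow> (nat \<Rightarrow> real) \<Rightarrow> nat \<Rightarrow> bool" where
  "first_drawdown h y l \<longleftrightarrow> (\<exists>i<l. h \<le> walk y i - walk y l) \<and> (\<forall>j<l. \<forall>i<j. walk y i - walk y j < h)"

text \<open>Argument of the maximum up to the first drawdown of size h. With \<open>w\<close> false
  it is the first maximiser, with \<open>w\<close> true the last one; the two differ when the
  maximum is attained several times.\<close>

definition peak_at :: "bool \<Rightarrow> real \<Rightarrow> (nat \<Rightarrow> real) \<Rightarrow> nat \<Rightarrow> bool" where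
  "peak_at w h y m \<longleftrightarrow> (\<exists>l>m. first_drawdown h y l \<and> (\<forall>j<m. hit w (walk y m - walk y j)) \<and>
      (\<forall>j. m < j \<and> j \<le> l \<longrightarrow> \<not> hit w (walk y j - walk y m)))"

definition valley_peak_at :: "bool \<Rightarrow> real \<Rightarrow> (nat \<Rightarrow> real) \<Rightarrow> nat \<Rightarrow> bool" where
  "valley_peak_at w h y m \<longleftrightarrow> (\<exists>k. top_at w h y k) \<and> peak_at w h y m"

lemma first_drawdownD: "first_drawdown h y l \<Longrightarrow> i < j \<Longrightarrow> j < l \<Longrightarrow> walk y i - walk y j < h"
  by (auto simp: first_drawdown_def)

lemma first_drawdown_unique:
  assumes "first_drawdown h y l" "first_drawdown h y l'"
  shows "l = l'"
  using assms unfolding first_drawdown_def by (meson linorder_neqE_nat not_le)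

lemma peak_at_unique:
  assumes "peak_at w h y m" "peak_at w h y m'"
  shows "m = m'"
proof -
  obtain l where l: "m < l" "m' < l" "\<forall>j<m. hit w (walk y m - walk y j)" "\<forall>j<m'. hit w (walk y m' - walk y j)"
     "\<forall>j. m < j \<and> j \<le> l \<longrightarrow> \<not> hit w (walk y j - walk y m)" "\<forall>j. m' < j \<and> j \<le> l \<longrightarrow> \<not> hit w (walk y j - walk y m')"
    using assms first_drawdown_unique unfolding peak_at_def by blast
  then show ?thesis
    by (meson less_imp_le linorder_neqE_nat)
qed

lemma top_at_unique: "top_at w h y k \<Longrightarrow> top_at w h y k' \<Longrightarrow> k = k'"
  unfolding top_at_def by (meson linorder_neqE_nat not_le)

lemma hit_at_unique: "hit_at w h y k \<Longrightarrow> hit_at w h y k' \<Longrightarrow> k = k'"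
  unfolding hit_at_def by (meson linorder_neqE_nat)

lemma top_at_not_hit_at:
  assumes "0 < h" "top_at w h y k"
  shows "\<not> hit_at w h y k'"
proof
  assume "hit_at w h y k'"
  with assms(2) have "k = k'"
    unfolding top_at_def hit_at_def by (meson linorder_neqE_nat not_le)
  then show False
    using assms \<open>hit_at w h y k'\<close> by (auto simp: top_at_def hit_at_def dest!: hitD)
qed

text \<open>At a record the path may forget its past: earlier values do not exceed the current one,
  so a drawdown that straddles \<open>k\<close> is at most the one measured from
  \<open>k\<close>.\<close>

lemma first_drawdown_record:
  assumes h: "0 < h" and rec: "\<And>i. i < k \<Longrightarrow> hit w (walk y k - walk y i)"
    and small: "\<And>i j. i < j \<Longrightarrow> j \<le> k \<Longrightarrow> walk y i - walk y j < h"
  shows "first_drawdown h y l \<longleftrightarrow> k < l \<and> first_drawdown h (shift k y) (l - k)"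
proof
  assume fd: "first_drawdown h y l"
  then obtain i where i: "i < l" "h \<le> walk y i - walk y l"
    by (auto simp: first_drawdown_def)
  have kl: "k < l"
  proof (rule ccontr)
    assume "\<not> k < l" then show False using small[of i l] i by auto
  qed
  have "\<exists>i'<l - k. h \<le> walk (shift k y) i' - walk (shift k y) (l - k)"
  proof (cases "k \<le> i")
    case True
    then show ?thesis using i kl by (intro exI[of _ "i - k"]) (auto simp: walk_shift)
  next
    case False
    then show ?thesis using i kl hitD(1)[OF rec[of i]] by (intro exI[of _ 0]) (auto simp: walk_shift)
  qed
  moreover have "walk (shift k y) i' - walk (shift k y) j' < h" if "j' < l - k" "i' < j'" for i' j'
    using fd that by (auto simp: first_drawdown_def walk_shift dest!: spec[where x = "k + j'"] spec[where x = "k + i'"])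
  ultimately show "k < l \<and> first_drawdown h (shift k y) (l - k)"
    using kl by (auto simp: first_drawdown_def)
next
  assume "k < l \<and> first_drawdown h (shift k y) (l - k)"
  then have kl: "k < l" and fd: "first_drawdown h (shift k y) (l - k)" by auto
  from fd obtain i' where "i' < l - k" "h \<le> walk (shift k y) i' - walk (shift k y) (l - k)"
    by (auto simp: first_drawdown_def)
  then have "\<exists>i<l. h \<le> walk y i - walk y l"
    using kl by (intro exI[of _ "k + i'"]) (auto simp: walk_shift)
  moreover have "walk y i - walk y j < h" if "j < l" "i < j" for i j
  proof (cases "j \<le> k")
    case True then show ?thesis using small that by simp
  next
    case False
    have "\<forall>i'<j - k. walk (shift k y) i' - walk (shift k y) (j - k) < h"
      using fd False that by (auto simp: first_drawdown_def)
    moreover have "i - k < j - k" using False that by auto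
    ultimately have *: "walk (shift k y) (i - k) - walk (shift k y) (j - k) < h" by blast
    show ?thesis
    proof (cases "k \<le> i")
      case True
      then show ?thesis using * False by (simp add: walk_shift)
    next
      case False
      then show ?thesis using * \<open>\<not> j \<le> k\<close> hitD(1)[OF rec[of i]] by (simp add: walk_shift)
    qed
  qed
  ultimately show "first_drawdown h y l" by (auto simp: first_drawdown_def)
qed

lemma hit_add: "hit w a \<Longrightarrow> hit w b \<Longrightarrow> hit w (a + b)"
  by (auto simp: hit_def)

text \<open>A candidate before \<open>k\<close> is beaten by the record at \<open>k\<close>.
  Conversely a later peak beats \<open>k\<close>, and \<open>hit_add\<close> acts as transitivity
  and carries this over to everything before \<open>k\<close>.\<close>

lemma peak_at_record:
  assumes h: "0 < h" and rec: "\<And>i. i < k \<Longrightarrow> hit w (walk y k - walk y i)"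
    and small: "\<And>i j. i < j \<Longrightarrow> j \<le> k \<Longrightarrow> walk y i - walk y j < h"
  shows "peak_at w h y m \<longleftrightarrow> k \<le> m \<and> peak_at w h (shift k y) (m - k)"
proof
  assume "peak_at w h y m"
  then obtain l where l: "m < l" "first_drawdown h y l" "\<forall>j<m. hit w (walk y m - walk y j)"
      "\<forall>j. m < j \<and> j \<le> l \<longrightarrow> \<not> hit w (walk y j - walk y m)"
    by (auto simp: peak_at_def)
  have fd: "k < l" "first_drawdown h (shift k y) (l - k)"
    using first_drawdown_record[OF assms] l(2) by auto
  have "k \<le> m" using l rec[of m] fd(1) by (meson less_imp_le not_le)
  moreover have "peak_at w h (shift k y) (m - k)"
    unfolding peak_at_def
  proof (intro exI[of _ "l - k"] conjI allI impI)
    fix j assume "j < m - k"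
    then show "hit w (walk (shift k y) (m - k) - walk (shift k y) j)"
      using \<open>k \<le> m\<close> l(3)[rule_format, of "k + j"] by (simp add: walk_shift)
  next
    fix j assume "m - k < j \<and> j \<le> l - k"
    then have "m < k + j \<and> k + j \<le> l" using \<open>k \<le> m\<close> fd by linarith
    then show "\<not> hit w (walk (shift k y) j - walk (shift k y) (m - k))"
      using \<open>k \<le> m\<close> l(4) by (simp add: walk_shift)
  qed (use l fd \<open>k \<le> m\<close> in auto)
  ultimately show "k \<le> m \<and> peak_at w h (shift k y) (m - k)" by simp
next
  assume "k \<le> m \<and> peak_at w h (shift k y) (m - k)"
  then obtain l' where km: "k \<le> m" and l: "m - k < l'" "first_drawdown h (shift k y) l'"
      "\<forall>j<m - k. hit w (walk (shift k y) (m - k) - walk (shift k y) j)"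
      "\<forall>j. m - k < j \<and> j \<le> l' \<longrightarrow> \<not> hit w (walk (shift k y) j - walk (shift k y) (m - k))"
    by (auto simp: peak_at_def)
  have fd: "first_drawdown h y (k + l')"
    using first_drawdown_record[OF assms, of "k + l'"] l by simp
  show "peak_at w h y m"
    unfolding peak_at_def
  proof (intro exI[of _ "k + l'"] conjI allI impI)
    fix j assume j: "j < m"
    show "hit w (walk y m - walk y j)"
    proof (cases "k \<le> j")
      case True
      then show ?thesis using l(3)[rule_format, of "j - k"] j km by (simp add: walk_shift)
    next
      case False
      show ?thesis
      proof (cases "k = m")
        case True then show ?thesis using rec False by auto
      next
        case False
        then have "hit w (walk y m - walk y k)" using l(3)[rule_format, of 0] km by (simp add: walk_shift)
        then show ?thesis using hit_add[OF _ rec[of j]] \<open>\<not> k \<le> j\<close> by fastforce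
      qed
    qed
  next
    fix j assume "m < j \<and> j \<le> k + l'"
    then have "m - k < j - k \<and> j - k \<le> l'" "k \<le> j" using km by linarith+
    then show "\<not> hit w (walk y j - walk y m)"
      using l(4)[rule_format, of "j - k"] km by (simp add: walk_shift)
  qed (use l km fd in auto)
qed

text \<open>A bottom exit of the negated path is the first ladder epoch of the path itself, reached
  before it has fallen by h. Until then all values lie between - h and 0, which leaves no room for a
  drawdown of size h.\<close>

lemma hit_at_record:
  assumes "0 < h" "hit_at w h (\<lambda>i. - y i) k"
  shows "i < k \<Longrightarrow> hit w (walk y k - walk y i)"
    and "i < j \<Longrightarrow> j \<le> k \<Longrightarrow> walk y i - walk y j < h"
proof -
  have a: "walk y i \<le> 0" if "i < k" for i
    using assms that hitD(2)[of w "walk y i"] by (cases "i = 0") (auto simp: hit_at_def)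
  have k: "hit w (walk y k)" using assms by (simp add: hit_at_def)
  show "i < k \<Longrightarrow> hit w (walk y k - walk y i)"
    using a[of i] k by (auto simp: hit_def)
  assume ij: "i < j" "j \<le> k"
  show "walk y i - walk y j < h"
  proof (cases "j = k")
    case True then show ?thesis using a[of i] ij hitD(1)[OF k] assms(1) by auto
  next
    case False
    then have "- walk y j < h" using assms(2) ij by (auto simp: hit_at_def)
    then show ?thesis using a[of i] ij by auto
  qed
qed

text \<open>Before the exit all values lie in [0, h), so their differences stay below h, and the
  exit point is above all of them. The search for a peak can restart there.\<close>

lemma top_at_record:
  assumes "0 < h" "top_at w h y k"
  shows "i < k \<Longrightarrow> hit w (walk y k - walk y i)"
    and "i < j \<Longrightarrow> j \<le> k \<Longrightarrow> walk y i - walk y j < h"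
proof -
  have a: "walk y i < h \<and> 0 \<le> walk y i" if "i < k" for i
    using assms that hitD(2)[of w "- walk y i"] by (cases "i = 0") (auto simp: top_at_def)
  have k: "h \<le> walk y k" using assms by (simp add: top_at_def)
  show "i < k \<Longrightarrow> hit w (walk y k - walk y i)"
    using a[of i] k by (auto simp: hit_def)
  assume ij: "i < j" "j \<le> k"
  show "walk y i - walk y j < h"
    using a[of i] a[of j] k ij assms(1) by (cases "j = k") auto
qed

lemma top_at_fall:
  assumes "0 < h" "top_at w h (\<lambda>i. - y i) l"
  shows "first_drawdown h y l" "peak_at w h y 0"
proof -
  have a: "walk y i \<le> 0 \<and> - walk y i < h" if "i < l" for i
    using assms that hitD(2)[of w "walk y i"] by (cases "i = 0") (auto simp: top_at_def)
  have l: "1 \<le> l" "walk y l \<le> - h" using assms by (auto simp: top_at_def)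
  show fd: "first_drawdown h y l"
    unfolding first_drawdown_def
  proof (intro conjI allI impI)
    show "\<exists>i<l. h \<le> walk y i - walk y l" using l by (intro exI[of _ 0]) auto
    show "walk y i - walk y j < h" if "j < l" "i < j" for i j
      using a[of i] a[of j] that by auto
  qed
  show "peak_at w h y 0"
    unfolding peak_at_def
  proof (intro exI[of _ l] conjI allI impI)
    fix j assume "0 < j \<and> j \<le> l"
    then show "\<not> hit w (walk y j - walk y 0)"
      using assms l by (cases "j = l") (auto simp: top_at_def hit_def)
  qed (use l fd in auto)
qed

lemma peak_at_0_iff:
  assumes "0 < h"
  shows "peak_at w h y 0 \<longleftrightarrow> (\<exists>l. top_at w h (\<lambda>i. - y i) l)"
proof
  assume "peak_at w h y 0"
  then obtain l where l: "0 < l" "first_drawdown h y l" "\<forall>j. 0 < j \<and> j \<le> l \<longrightarrow> \<not> hit w (walk y j)"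
    by (auto simp: peak_at_def)
  from l(2) obtain i where i: "i < l" "h \<le> walk y i - walk y l" by (auto simp: first_drawdown_def)
  then have "walk y l \<le> - h" using l(3) by (cases "i = 0") (auto dest!: spec[where x = i] hitD)
  moreover have "- walk y j < h" if "1 \<le> j" "j < l" for j
    using first_drawdownD[OF l(2), of 0 j] that by simp
  ultimately have "top_at w h (\<lambda>i. - y i) l"
    using l by (auto simp: top_at_def)
  then show "\<exists>l. top_at w h (\<lambda>i. - y i) l" ..
qed (use top_at_fall assms in blast)

lemma ex_hit_at:
  assumes "hit w (walk y k)" "1 \<le> k" "\<And>j. 1 \<le> j \<Longrightarrow> j < k \<Longrightarrow> - walk y j < h"
  obtains k' where "k' \<in> {1..k}" "hit_at w h (\<lambda>i. - y i) k'"
proof -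
  define k' where "k' = (LEAST k. 1 \<le> k \<and> hit w (walk y k))"
  have "1 \<le> k' \<and> hit w (walk y k')" "k' \<le> k"
    unfolding k'_def using assms by (auto intro: LeastI2 Least_le)
  moreover have "\<not> hit w (walk y j)" if "1 \<le> j" "j < k'" for j
    using not_less_Least[of j "\<lambda>k. 1 \<le> k \<and> hit w (walk y k)"] that by (auto simp: k'_def)
  ultimately show thesis
    using assms(3) by (intro that[of k']) (auto simp: hit_at_def)
qed

text \<open>A peak that is not at the start lies at or after the first ladder epoch, and up to that
  epoch no drawdown is complete, so the record lemma restarts the search there.\<close>

lemma peak_at_pos_iff:
  assumes h: "0 < h" and m: "1 \<le> m"
  shows "peak_at w h y m \<longleftrightarrow> (\<exists>k\<in>{1..m}. hit_at w h (\<lambda>i. - y i) k \<and> peak_at w h (shift k y) (m - k))"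
proof
  assume p: "peak_at w h y m"
  then obtain l where l: "m < l" "first_drawdown h y l" "\<forall>j<m. hit w (walk y m - walk y j)"
    by (auto simp: peak_at_def)
  have hm: "hit w (walk y m)" using l(3)[rule_format, of 0] m by simp
  have small: "- walk y j < h" if "1 \<le> j" "j < m" for j
    using first_drawdownD[OF l(2), of 0 j] l(1) that by simp
  obtain k where k: "k \<in> {1..m}" "hit_at w h (\<lambda>i. - y i) k"
    by (rule ex_hit_at[OF hm m small])
  then show "\<exists>k\<in>{1..m}. hit_at w h (\<lambda>i. - y i) k \<and> peak_at w h (shift k y) (m - k)"
    using peak_at_record[OF h hit_at_record[OF h k(2)]] p by blast
next
  assume "\<exists>k\<in>{1..m}. hit_at w h (\<lambda>i. - y i) k \<and> peak_at w h (shift k y) (m - k)"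
  then obtain k where k: "k \<in> {1..m}" "hit_at w h (\<lambda>i. - y i) k" "peak_at w h (shift k y) (m - k)" by blast
  then show "peak_at w h y m"
    using peak_at_record[OF h hit_at_record[OF h k(2)], of m] by auto
qed

text \<open>The path falls by h before its first ladder epoch, or it restarts at that epoch. Strict
  and weak ladder epochs both give a valid decomposition, so the flag on the right is free.\<close>

lemma first_drawdown_iff:
  assumes h: "0 < h"
  shows "first_drawdown h y l \<longleftrightarrow> top_at w h (\<lambda>i. - y i) l \<or>
    (\<exists>k\<in>{1..l}. hit_at w h (\<lambda>i. - y i) k \<and> first_drawdown h (shift k y) (l - k))"
proof
  assume fd: "first_drawdown h y l"
  then have 0: "- walk y j < h" if "1 \<le> j" "j < l" for j
    using first_drawdownD[OF fd, of 0 j] that by simp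
  show "top_at w h (\<lambda>i. - y i) l \<or>
    (\<exists>k\<in>{1..l}. hit_at w h (\<lambda>i. - y i) k \<and> first_drawdown h (shift k y) (l - k))"
  proof (cases "\<exists>k. 1 \<le> k \<and> k < l \<and> hit w (walk y k)")
    case True
    then obtain k where hk: "hit w (walk y k)" "1 \<le> k" and "k < l" by blast
    then have small: "- walk y j < h" if "1 \<le> j" "j < k" for j
      using 0 that by simp
    obtain k' where k: "k' \<in> {1..k}" "hit_at w h (\<lambda>i. - y i) k'"
      by (rule ex_hit_at[OF hk small])
    then show ?thesis
      using first_drawdown_record[OF h hit_at_record[OF h k(2)]] fd \<open>k < l\<close> by force
  next
    case False
    obtain i where i: "i < l" "h \<le> walk y i - walk y l" using fd by (auto simp: first_drawdown_def)
    then have "walk y l \<le> - h" using False by (cases "i = 0") (auto dest!: spec[where x = i] hitD)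
    then have "top_at w h (\<lambda>i. - y i) l" using i 0 False by (auto simp: top_at_def)
    then show ?thesis ..
  qed
next
  assume "top_at w h (\<lambda>i. - y i) l \<or>
    (\<exists>k\<in>{1..l}. hit_at w h (\<lambda>i. - y i) k \<and> first_drawdown h (shift k y) (l - k))"
  then show "first_drawdown h y l"
  proof (elim disjE bexE conjE)
    fix k assume k: "k \<in> {1..l}" "hit_at w h (\<lambda>i. - y i) k" "first_drawdown h (shift k y) (l - k)"
    then have "k < l" by (auto simp: first_drawdown_def)
    then show ?thesis
      using first_drawdown_record[OF h hit_at_record[OF h k(2)], of l] k by auto
  qed (use top_at_fall h in blast)
qed

text \<open>The end of the climb is a record with no drawdown of size h behind it. Hence the peak is
  found in the path after the climb, which is independent of the climb.\<close>

lemma valley_peak_at_iff: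
  assumes h: "0 < h"
  shows "valley_peak_at w h y m \<longleftrightarrow> (\<exists>k\<in>{1..m}. top_at w h y k \<and> peak_at w h (shift k y) (m - k))"
proof
  assume "valley_peak_at w h y m"
  then obtain k where k: "top_at w h y k" "peak_at w h y m" by (auto simp: valley_peak_at_def)
  then have "1 \<le> k" by (simp add: top_at_def)
  then show "\<exists>k\<in>{1..m}. top_at w h y k \<and> peak_at w h (shift k y) (m - k)"
    using peak_at_record[OF h top_at_record[OF h k(1)]] k by force
next
  assume "\<exists>k\<in>{1..m}. top_at w h y k \<and> peak_at w h (shift k y) (m - k)"
  then obtain k where k: "k \<in> {1..m}" "top_at w h y k" "peak_at w h (shift k y) (m - k)" by blast
  then show "valley_peak_at w h y m"
    using peak_at_record[OF h top_at_record[OF h k(2)], of m] by (auto simp: valley_peak_at_def)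
qed

section \<open>Generating functions of a walk\<close>

text \<open>Shifted step sequences and the half-lines read outwards from a site are all injective
  reindexings of one family; product laws are invariant under them, which gives stationarity and
  translation invariance at once.\<close>

lemma (in prob_space) iid_law:
  fixes X :: "'i \<Rightarrow> 'a \<Rightarrow> real" and f :: "'j \<Rightarrow> 'i"
  assumes ind: "indep_vars (\<lambda>_. borel) X UNIV" and law: "\<And>i. distr M borel (X i) = \<nu>"
    and f: "inj f"
  shows "distr M (Pi\<^sub>M UNIV (\<lambda>_. borel)) (\<lambda>s i. X (f i) s) = Pi\<^sub>M UNIV (\<lambda>_. \<nu>)"
    and "indep_vars (\<lambda>_. borel) (\<lambda>i. X (f i)) UNIV"
proof -
  have rv: "\<And>i. random_variable borel (X i)"
    using ind by (auto simp: indep_vars_def)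
  have ps: "prob_space \<nu>"
    using prob_space_distr[OF rv] law by metis
  have sets: "sets \<nu> = sets borel" using law[of undefined] by auto
  have full: "distr M (Pi\<^sub>M UNIV (\<lambda>_. borel)) (\<lambda>s i. X i s) = Pi\<^sub>M UNIV (\<lambda>_. \<nu>)"
    using ind indep_vars_iff_distr_eq_PiM[where I = UNIV and M' = "\<lambda>_. borel" and X = X] rv by (simp add: law restrict_UNIV)
  have sP: "sets (Pi\<^sub>M UNIV (\<lambda>_. \<nu>)) = sets (Pi\<^sub>M (UNIV :: 'x set) (\<lambda>_. borel))" for \<theta> :: 'x
    by (intro sets_PiM_cong sets refl)
  have m1: "(\<lambda>s i. X i s) \<in> measurable M (Pi\<^sub>M UNIV (\<lambda>_. borel))"
    by (intro measurable_PiM_single') (auto intro: rv)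
  have "distr M (Pi\<^sub>M UNIV (\<lambda>_. borel)) (\<lambda>s i. X (f i) s)
      = distr (distr M (Pi\<^sub>M UNIV (\<lambda>_. borel)) (\<lambda>s i. X i s)) (Pi\<^sub>M UNIV (\<lambda>_. borel)) (\<lambda>\<omega> n. \<omega> (f n))"
    by (subst distr_distr) (auto simp: comp_def m1 intro!: measurable_PiM_single')
  also have "\<dots> = distr (Pi\<^sub>M UNIV (\<lambda>_. \<nu>)) (Pi\<^sub>M UNIV (\<lambda>_. \<nu>)) (\<lambda>\<omega> n. \<omega> (f n))"
    unfolding full by (intro distr_cong refl sP[symmetric])
  also have "\<dots> = Pi\<^sub>M UNIV (\<lambda>_. \<nu>)"
    using distr_PiM_reindex[of UNIV "\<lambda>_. \<nu>" f UNIV] ps f by (simp add: restrict_UNIV)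
  finally show law': "distr M (Pi\<^sub>M UNIV (\<lambda>_. borel)) (\<lambda>s i. X (f i) s) = Pi\<^sub>M UNIV (\<lambda>_. \<nu>)" .
  then show "indep_vars (\<lambda>_. borel) (\<lambda>i. X (f i)) UNIV"
    using indep_vars_iff_distr_eq_PiM[where I = UNIV and M' = "\<lambda>_. borel" and X = "\<lambda>i. X (f i)"] rv by (simp add: law restrict_UNIV)
qed

abbreviation seq_space :: "(nat \<Rightarrow> real) measure" where
  "seq_space \<equiv> Pi\<^sub>M UNIV (\<lambda>_. borel)"

definition walk_prob :: "'a measure \<Rightarrow> (nat \<Rightarrow> 'a \<Rightarrow> real) \<Rightarrow> ((nat \<Rightarrow> real) \<Rightarrow> bool) \<Rightarrow> real" where
  "walk_prob M Y Q = measure M {s \<in> space M. Q (\<lambda>i. Y i s)}"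

definition walk_gf :: "'a measure \<Rightarrow> (nat \<Rightarrow> 'a \<Rightarrow> real) \<Rightarrow> ((nat \<Rightarrow> real) \<Rightarrow> nat \<Rightarrow> bool) \<Rightarrow> real \<Rightarrow> real" where
  "walk_gf M Y Q x = (\<Sum>k. walk_prob M Y (\<lambda>y. Q y k) * x ^ k)"

lemma measurable_walk [measurable]: "(\<lambda>y. walk y k) \<in> borel_measurable seq_space"
  unfolding walk_def by measurable

lemma measurable_shift [measurable]: "shift k \<in> measurable seq_space seq_space"
  unfolding shift_def[abs_def] by (intro measurable_PiM_single') auto

lemma measurable_uminus_seq [measurable]: "(\<lambda>y i. - y i) \<in> measurable seq_space seq_space"
  by (intro measurable_PiM_single') auto

lemma measurable_top_at [measurable]: "Measurable.pred seq_space (\<lambda>y. top_at w h y k)"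
  unfolding top_at_def hit_def by measurable

lemma measurable_hit_at [measurable]: "Measurable.pred seq_space (\<lambda>y. hit_at w h y k)"
  unfolding hit_at_def hit_def by measurable

lemma measurable_alive [measurable]: "Measurable.pred seq_space (\<lambda>y. alive w h y k)"
  unfolding alive_def hit_def by measurable

lemma measurable_first_drawdown [measurable]: "Measurable.pred seq_space (\<lambda>y. first_drawdown h y k)"
  unfolding first_drawdown_def by measurable

lemma measurable_peak_at [measurable]: "Measurable.pred seq_space (\<lambda>y. peak_at w h y k)"
  unfolding peak_at_def hit_def by measurable

lemma measurable_valley_peak_at [measurable]: "Measurable.pred seq_space (\<lambda>y. valley_peak_at w h y k)"
  unfolding valley_peak_at_def by measurable

text \<open>On such events the index is a partially defined random time, so their probabilities sum
  to that of the union.\<close>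

definition exclusive :: "((nat \<Rightarrow> real) \<Rightarrow> nat \<Rightarrow> bool) \<Rightarrow> bool" where
  "exclusive Q \<longleftrightarrow> (\<forall>y k k'. Q y k \<longrightarrow> Q y k' \<longrightarrow> k = k')"

lemma exclusiveD: "exclusive Q \<Longrightarrow> Q y k \<Longrightarrow> Q y k' \<Longrightarrow> k = k'"
  by (simp add: exclusive_def)

lemma exclusive_top_at: "exclusive (top_at w h)" "exclusive (\<lambda>y. top_at w h (\<lambda>i. - y i))"
  by (auto simp: exclusive_def dest: top_at_unique)

lemma exclusive_hit_at: "exclusive (hit_at w h)" "exclusive (\<lambda>y. hit_at w h (\<lambda>i. - y i))"
  by (auto simp: exclusive_def dest: hit_at_unique)

lemma exclusive_first_drawdown: "exclusive (first_drawdown h)"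
  by (auto simp: exclusive_def dest: first_drawdown_unique)

lemma exclusive_peak_at: "exclusive (peak_at w h)"
  by (auto simp: exclusive_def dest: peak_at_unique)

lemma exclusive_valley_peak_at: "exclusive (valley_peak_at w h)"
  by (auto simp: exclusive_def valley_peak_at_def dest: peak_at_unique)

text \<open>The steps are bounded at every point of the space, not just almost surely. Overshoots
  are then confined pointwise, and all exit positions lie in a fixed compact set.\<close>

locale iid_walk = prob_space M for M :: "'a measure" +
  fixes Y :: "nat \<Rightarrow> 'a \<Rightarrow> real" and L \<sigma> :: real
  assumes indep: "indep_vars (\<lambda>_. borel) Y UNIV"
    and ident: "\<And>i. distr M borel (Y i) = distr M borel (Y 0)"
    and bdd: "\<And>i s. s \<in> space M \<Longrightarrow> \<bar>Y i s\<bar> \<le> L"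
    and mean: "expectation (Y 0) = 0"
    and var: "expectation (\<lambda>s. (Y 0 s)\<^sup>2) = \<sigma>\<^sup>2"
    and sigma_pos: "0 < \<sigma>"
begin

lemma rv [measurable]: "Y i \<in> borel_measurable M"
  using indep by (auto simp: indep_vars_def)

lemma measurable_path [measurable]: "(\<lambda>s i. Y i s) \<in> measurable M seq_space"
  by (intro measurable_PiM_single') auto

lemma L_nonneg: "0 \<le> L"
  using bdd[of _ 0] not_empty by fastforce

lemma iid_walk_uminus: "iid_walk M (\<lambda>i s. - Y i s) L \<sigma>"
proof
  show "indep_vars (\<lambda>_. borel) (\<lambda>i s. - Y i s) UNIV"
    by (rule indep_vars_compose2[OF indep]) auto
  show "distr M borel (\<lambda>s. - Y i s) = distr M borel (\<lambda>s. - Y 0 s)" for i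
  proof -
    have "distr M borel (\<lambda>s. - Y i s) = distr (distr M borel (Y i)) borel uminus" for i
      by (subst distr_distr) (auto simp: comp_def)
    then show ?thesis using ident by metis
  qed
qed (use bdd mean var sigma_pos in auto)

lemma walk_prob_uminus: "walk_prob M Y (\<lambda>y. Q (\<lambda>i. - y i)) = walk_prob M (\<lambda>i s. - Y i s) Q"
  by (simp add: walk_prob_def)

lemma shift_law: "distr M seq_space (\<lambda>s i. Y (k + i) s) = distr M seq_space (\<lambda>s i. Y i s)"
  using iid_law(1)[OF indep ident, of "\<lambda>i. k + i"] iid_law(1)[OF indep ident, of "\<lambda>i. i"] by simp

lemma expectation_shift:
  assumes [measurable]: "G \<in> borel_measurable seq_space"
  shows "expectation (\<lambda>s. G (shift k (\<lambda>i. Y i s)) :: real) = expectation (\<lambda>s. G (\<lambda>i. Y i s))"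
proof -
  have "expectation (\<lambda>s. G (shift k (\<lambda>i. Y i s))) = integral\<^sup>L (distr M seq_space (\<lambda>s i. Y (k + i) s)) G"
    by (subst integral_distr) (auto simp: shift_def[abs_def] intro!: measurable_PiM_single')
  also have "\<dots> = expectation (\<lambda>s. G (\<lambda>i. Y i s))"
    unfolding shift_law by (subst integral_distr) auto
  finally show ?thesis .
qed

text \<open>The first \<open>k\<close> steps and the later ones are disjoint blocks of an
  independent family. \<open>F\<close> is evaluated on the first block continued by zeros, so that
  it becomes a function of that block alone.\<close>

lemma markov_expectation:
  assumes F[measurable]: "F \<in> borel_measurable seq_space" and G[measurable]: "G \<in> borel_measurable seq_space"
    and dep: "\<And>y y'. (\<And>i. i < k \<Longrightarrow> y i = y' i) \<Longrightarrow> F y = F y'"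
    and bF: "\<And>s. s \<in> space M \<Longrightarrow> \<bar>F (\<lambda>i. Y i s)\<bar> \<le> CF"
    and bG: "\<And>s. s \<in> space M \<Longrightarrow> \<bar>G (shift k (\<lambda>i. Y i s))\<bar> \<le> CG"
  shows "expectation (\<lambda>s. F (\<lambda>i. Y i s) * G (shift k (\<lambda>i. Y i s)))
      = expectation (\<lambda>s. F (\<lambda>i. Y i s)) * expectation (\<lambda>s. G (\<lambda>i. Y i s) :: real)"
proof -
  let ?A = "{..<k}" and ?B = "{k..}"
  have "indep_var (PiM ?A (\<lambda>_. borel)) (\<lambda>s. restrict (\<lambda>i. Y i s) ?A) (PiM ?B (\<lambda>_. borel)) (\<lambda>s. restrict (\<lambda>i. Y i s) ?B)"
    by (rule indep_var_restrict[OF indep]) auto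
  then have "indep_var borel ((\<lambda>g. F (\<lambda>i. if i < k then g i else 0)) \<circ> (\<lambda>s. restrict (\<lambda>i. Y i s) ?A))
               borel ((\<lambda>g. G (\<lambda>i. g (k + i))) \<circ> (\<lambda>s. restrict (\<lambda>i. Y i s) ?B))"
  proof (rule indep_var_compose)
    have "(\<lambda>g. if i < k then g i else 0) \<in> borel_measurable (PiM ?A (\<lambda>_. borel :: real measure))" for i
      by (cases "i < k") (auto intro!: measurable_component_singleton)
    then have "(\<lambda>g i. if i < k then g i else 0) \<in> measurable (PiM ?A (\<lambda>_. borel)) seq_space"
      by (intro measurable_PiM_single') auto
    then show "(\<lambda>g. F (\<lambda>i. if i < k then g i else 0)) \<in> borel_measurable (PiM ?A (\<lambda>_. borel))"
      by measurable
    have "(\<lambda>g i. g (k + i)) \<in> measurable (PiM ?B (\<lambda>_. borel)) seq_space"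
      by (intro measurable_PiM_single') (auto intro!: measurable_component_singleton)
    then show "(\<lambda>g. G (\<lambda>i. g (k + i))) \<in> borel_measurable (PiM ?B (\<lambda>_. borel))"
      by measurable
  qed
  moreover have "(\<lambda>g. F (\<lambda>i. if i < k then g i else 0)) \<circ> (\<lambda>s. restrict (\<lambda>i. Y i s) ?A) = (\<lambda>s. F (\<lambda>i. Y i s))"
    by (auto simp: fun_eq_iff intro!: dep)
  moreover have "(\<lambda>g. G (\<lambda>i. g (k + i))) \<circ> (\<lambda>s. restrict (\<lambda>i. Y i s) ?B) = (\<lambda>s. G (shift k (\<lambda>i. Y i s)))"
    by (auto simp: fun_eq_iff shift_def[abs_def])
  ultimately have "indep_var borel (\<lambda>s. F (\<lambda>i. Y i s)) borel (\<lambda>s. G (shift k (\<lambda>i. Y i s)))"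
    by simp
  then have "expectation (\<lambda>s. F (\<lambda>i. Y i s) * G (shift k (\<lambda>i. Y i s)))
      = expectation (\<lambda>s. F (\<lambda>i. Y i s)) * expectation (\<lambda>s. G (shift k (\<lambda>i. Y i s)))"
  proof (rule indep_var_lebesgue_integral)
    show "integrable M (\<lambda>s. F (\<lambda>i. Y i s))"
      by (rule integrable_const_bound[where B = CF]) (auto intro!: AE_I2 bF)
    show "integrable M (\<lambda>s. G (shift k (\<lambda>i. Y i s)))"
      by (rule integrable_const_bound[where B = CG]) (auto intro!: AE_I2 bG)
  qed
  then show ?thesis by (simp add: expectation_shift)
qed

lemma walk_prob_eq_expectation:
  assumes [measurable]: "Measurable.pred seq_space Q"
  shows "walk_prob M Y Q = expectation (\<lambda>s. indicator {y. Q y} (\<lambda>i. Y i s))"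
proof -
  have "expectation (\<lambda>s. indicator {y. Q y} (\<lambda>i. Y i s)) = expectation (indicator {s \<in> space M. Q (\<lambda>i. Y i s)})"
    by (intro Bochner_Integration.integral_cong) (auto simp: indicator_def)
  also have "\<dots> = walk_prob M Y Q"
    unfolding walk_prob_def by (simp add: Int_absorb2 Collect_restrict)
  finally show ?thesis by simp
qed

lemma walk_prob_markov:
  assumes Q[measurable]: "Measurable.pred seq_space Q" and R[measurable]: "Measurable.pred seq_space R"
    and dep: "\<And>y y'. (\<And>i. i < k \<Longrightarrow> y i = y' i) \<Longrightarrow> Q y = Q y'"
  shows "walk_prob M Y (\<lambda>y. Q y \<and> R (shift k y)) = walk_prob M Y Q * walk_prob M Y R"
proof -
  have [measurable]: "(indicator {y. Q y} :: _ \<Rightarrow> real) \<in> borel_measurable seq_space"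
     "(indicator {y. R y} :: _ \<Rightarrow> real) \<in> borel_measurable seq_space"
    by (auto intro!: borel_measurable_indicator) (auto simp: pred_def space_PiM)?
  have "walk_prob M Y (\<lambda>y. Q y \<and> R (shift k y))
     = expectation (\<lambda>s. indicator {y. Q y} (\<lambda>i. Y i s) * indicator {y. R y} (shift k (\<lambda>i. Y i s)))"
    by (subst walk_prob_eq_expectation) (auto simp: indicator_def intro!: Bochner_Integration.integral_cong)
  also have "\<dots> = walk_prob M Y Q * walk_prob M Y R"
    unfolding walk_prob_eq_expectation[OF Q] walk_prob_eq_expectation[OF R]
  proof (rule markov_expectation[where CF = 1 and CG = 1])
    show "(indicator {y. Q y} y :: real) = indicator {y. Q y} y'" if "\<And>i. i < k \<Longrightarrow> y i = y' i" for y y'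
      using dep[OF that] by (simp add: indicator_def)
  qed (auto simp: indicator_def)
  finally show ?thesis .
qed

lemma walk_prob_sums:
  assumes [measurable]: "\<And>k. Measurable.pred seq_space (\<lambda>y. Q y k)"
    and disj: "exclusive Q"
  shows "(\<lambda>k. walk_prob M Y (\<lambda>y. Q y k)) sums walk_prob M Y (\<lambda>y. \<exists>k. Q y k)"
proof -
  have "(\<lambda>k. measure M {s \<in> space M. Q (\<lambda>i. Y i s) k}) sums measure M (\<Union>k. {s \<in> space M. Q (\<lambda>i. Y i s) k})"
    by (intro finite_measure_UNION) (auto simp: disjoint_family_on_def dest: exclusiveD[OF disj])
  also have "(\<Union>k. {s \<in> space M. Q (\<lambda>i. Y i s) k}) = {s \<in> space M. \<exists>k. Q (\<lambda>i. Y i s) k}" by auto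
  finally show ?thesis by (simp add: walk_prob_def)
qed

lemma walk_prob_range: "0 \<le> walk_prob M Y Q" "walk_prob M Y Q \<le> 1"
  by (auto simp: walk_prob_def)

lemma walk_gf_summable:
  assumes [measurable]: "\<And>k. Measurable.pred seq_space (\<lambda>y. Q y k)"
    and disj: "exclusive Q"
    and x: "0 \<le> x" "x \<le> 1"
  shows "summable (\<lambda>k. walk_prob M Y (\<lambda>y. Q y k) * x ^ k)"
proof (rule summable_comparison_test')
  show "summable (\<lambda>k. walk_prob M Y (\<lambda>y. Q y k))"
    by (rule sums_summable[OF walk_prob_sums[OF assms(1) disj]])
  show "norm (walk_prob M Y (\<lambda>y. Q y k) * x ^ k) \<le> walk_prob M Y (\<lambda>y. Q y k)" for k
    using x walk_prob_range(1)[of "\<lambda>y. Q y k"] by (simp add: abs_mult mult_left_le power_le_one power_abs)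
qed

lemma walk_gf_sums:
  assumes "\<And>k. Measurable.pred seq_space (\<lambda>y. Q y k)"
    and "exclusive Q"
    and "0 \<le> x" "x \<le> 1"
  shows "(\<lambda>k. walk_prob M Y (\<lambda>y. Q y k) * x ^ k) sums walk_gf M Y Q x"
  unfolding walk_gf_def by (rule summable_sums[OF walk_gf_summable[OF assms]])

lemma walk_gf_1:
  assumes "\<And>k. Measurable.pred seq_space (\<lambda>y. Q y k)"
    and "exclusive Q"
  shows "walk_gf M Y Q 1 = walk_prob M Y (\<lambda>y. \<exists>k. Q y k)"
  unfolding walk_gf_def power_one mult_1_right by (rule sums_unique[OF walk_prob_sums[OF assms], symmetric])

text \<open>A restart adds two independent times, hence a Cauchy product. As for a stopping time,
  \<open>Q y k\<close> must be decided by the first \<open>k\<close> steps; since \<open>Q\<close>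
  never occurs at 0, the sum from 1 to m is the full convolution.\<close>

lemma walk_gf_renewal:
  assumes Q[measurable]: "\<And>k. Measurable.pred seq_space (\<lambda>y. Q y k)"
    and R[measurable]: "\<And>k. Measurable.pred seq_space (\<lambda>y. R y k)"
    and disjQ: "exclusive Q"
    and disjR: "exclusive R"
    and dep: "\<And>y y' k. (\<And>i. i < k \<Longrightarrow> y i = y' i) \<Longrightarrow> Q y k = Q y' k"
    and Q0: "\<And>y. \<not> Q y 0"
    and x: "0 \<le> x" "x \<le> 1"
  shows "(\<lambda>m. walk_prob M Y (\<lambda>y. \<exists>k\<in>{1..m}. Q y k \<and> R (shift k y) (m - k)) * x ^ m)
     sums (walk_gf M Y Q x * walk_gf M Y R x)"
proof -
  let ?q = "\<lambda>k. walk_prob M Y (\<lambda>y. Q y k)" and ?r = "\<lambda>k. walk_prob M Y (\<lambda>y. R y k)"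
  have conv: "walk_prob M Y (\<lambda>y. \<exists>k\<in>{1..m}. Q y k \<and> R (shift k y) (m - k)) = (\<Sum>k\<le>m. ?q k * ?r (m - k))" for m
  proof -
    have q0: "?q 0 = 0" by (simp add: walk_prob_def Q0)
    have "walk_prob M Y (\<lambda>y. \<exists>k\<in>{1..m}. Q y k \<and> R (shift k y) (m - k))
       = measure M (\<Union>k\<in>{1..m}. {s \<in> space M. Q (\<lambda>i. Y i s) k \<and> R (shift k (\<lambda>i. Y i s)) (m - k)})"
      unfolding walk_prob_def by (intro arg_cong[where f = "measure M"]) auto
    also have "\<dots> = (\<Sum>k\<in>{1..m}. walk_prob M Y (\<lambda>y. Q y k \<and> R (shift k y) (m - k)))"
      unfolding walk_prob_def
      by (intro finite_measure_finite_Union) (auto simp: disjoint_family_on_def dest: exclusiveD[OF disjQ])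
    also have "\<dots> = (\<Sum>k\<in>{1..m}. ?q k * ?r (m - k))"
      by (intro sum.cong refl walk_prob_markov Q R dep)
    also have "\<dots> = (\<Sum>k\<le>m. ?q k * ?r (m - k))"
      by (rule sum.mono_neutral_left) (auto simp: not_le Suc_le_eq q0)
    finally show ?thesis .
  qed
  have s: "summable (\<lambda>k. ?q k * x ^ k)" "summable (\<lambda>k. ?r k * x ^ k)"
    using walk_gf_summable[OF Q disjQ x] walk_gf_summable[OF R disjR x] by blast+
  have nn: "norm (?q k * x ^ k) = ?q k * x ^ k" "norm (?r k * x ^ k) = ?r k * x ^ k" for k
    using x walk_prob_range(1) by (simp_all only: real_norm_def) (intro abs_of_nonneg mult_nonneg_nonneg zero_le_power; simp)+
  have "(\<lambda>m. \<Sum>k\<le>m. (?q k * x ^ k) * (?r (m - k) * x ^ (m - k))) sums ((\<Sum>k. ?q k * x ^ k) * (\<Sum>k. ?r k * x ^ k))"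
    by (rule Cauchy_product_sums) (simp_all only: nn s)
  moreover have "(\<Sum>k\<le>m. (?q k * x ^ k) * (?r (m - k) * x ^ (m - k))) = (\<Sum>k\<le>m. ?q k * ?r (m - k)) * x ^ m" for m
    unfolding sum_distrib_right
  proof (rule sum.cong)
    fix k assume "k \<in> {..m}"
    then have "x ^ m = x ^ k * x ^ (m - k)" by (simp flip: power_add)
    then show "(?q k * x ^ k) * (?r (m - k) * x ^ (m - k)) = ?q k * ?r (m - k) * x ^ m" by simp
  qed simp
  ultimately show ?thesis
    by (simp only: conv walk_gf_def)
qed

end

lemma walk_cong: "(\<And>i. i < k \<Longrightarrow> y i = y' i) \<Longrightarrow> j \<le> k \<Longrightarrow> walk y j = walk y' j"
  unfolding walk_def by (intro sum.cong) auto

lemma top_at_cong: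
  assumes "\<And>i. i < k \<Longrightarrow> y i = y' i"
  shows "top_at w h y k = top_at w h y' k"
  using walk_cong[of k y y'] assms by (simp add: top_at_def cong: conj_cong imp_cong)

lemma hit_at_cong:
  assumes "\<And>i. i < k \<Longrightarrow> y i = y' i"
  shows "hit_at w h y k = hit_at w h y' k"
  using walk_cong[of k y y'] assms by (simp add: hit_at_def cong: conj_cong imp_cong)

lemma alive_cong:
  assumes "\<And>i. i < k \<Longrightarrow> y i = y' i"
  shows "alive w h y k = alive w h y' k"
  using walk_cong[of k y y'] assms by (simp add: alive_def cong: conj_cong imp_cong)

lemma not_top_at_0 [simp]: "\<not> top_at w h y 0" and not_hit_at_0 [simp]: "\<not> hit_at w h y 0"
  by (simp_all add: top_at_def hit_at_def)

lemma alive_0 [simp]: "alive w h y 0"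
  by (simp add: alive_def)

lemma alive_bounds: "0 < h \<Longrightarrow> alive w h y n \<Longrightarrow> 0 \<le> walk y n \<and> walk y n < h"
  using hitD(2)[of w "- walk y n"] by (cases "n = 0") (auto simp: alive_def)

lemma alive_Suc_cases:
  assumes "0 < h"
  shows "indicator {y. alive w h y n} y = (indicator {y. alive w h y (Suc n)} y
    + indicator {y. top_at w h y (Suc n)} y + indicator {y. hit_at w h y (Suc n)} y :: real)"
proof -
  have "alive w h y (Suc n) \<longleftrightarrow> alive w h y n \<and> walk y (Suc n) < h \<and> \<not> hit w (- walk y (Suc n))"
    by (auto simp: alive_def le_Suc_eq)
  moreover have "top_at w h y (Suc n) \<longleftrightarrow> alive w h y n \<and> h \<le> walk y (Suc n)"
    by (auto simp: alive_def top_at_def less_Suc_eq_le)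
  moreover have "hit_at w h y (Suc n) \<longleftrightarrow> alive w h y n \<and> hit w (- walk y (Suc n))"
    by (auto simp: alive_def hit_at_def less_Suc_eq_le)
  ultimately show ?thesis
    using assms by (auto simp: indicator_def dest: hitD)
qed

text \<open>The position before the exit is still below h, so the overshoot is at most one
  step.\<close>

lemma top_at_bounds:
  assumes "0 < h" "top_at w h y k" "\<And>i. \<bar>y i\<bar> \<le> L"
  shows "walk y k \<in> {h..h + L}"
proof -
  obtain n where n: "k = Suc n" using assms(2) by (cases k) auto
  have "walk y n < h" using assms by (cases "n = 0") (auto simp: top_at_def n)
  moreover have "y n \<le> L" using assms(3)[of n] by simp
  ultimately show ?thesis using assms(2) by (auto simp: top_at_def n walk_Suc)
qed

lemma hit_at_bounds:
  assumes "0 < h" "hit_at w h y k" "\<And>i. \<bar>y i\<bar> \<le> L"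
  shows "walk y k \<in> {- L..0}"
proof -
  obtain n where n: "k = Suc n" using assms(2) by (cases k) auto
  have "0 \<le> walk y n" using assms hitD(2)[of w "- walk y n"] by (cases "n = 0") (auto simp: hit_at_def n)
  moreover have "- L \<le> y n" using assms(3)[of n] by simp
  ultimately show ?thesis using assms(2) by (auto simp: hit_at_def n walk_Suc dest: hitD)
qed

context iid_walk
begin

lemma walk_gf_uminus:
  "walk_gf M Y (\<lambda>y. Q (\<lambda>i. - y i)) x = walk_gf M (\<lambda>i s. - Y i s) Q x"
  by (simp add: walk_gf_def walk_prob_def)

lemma measurable_uminus_pred:
  assumes "Measurable.pred seq_space Q"
  shows "Measurable.pred seq_space (\<lambda>y. Q (\<lambda>i. - y i))"
  using measurable_compose[OF measurable_uminus_seq assms] by simp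

text \<open>A peak at time 0 has weight x^0, although the fall that certifies it takes time; hence
  the first term is an exit probability, taken at 1. In \<open>first_drawdown_gf\<close> the
  duration of that fall counts, and the same term is taken at \<open>x\<close>.\<close>

lemma peak_gf:
  assumes h: "0 < h" and x: "0 \<le> x" "x \<le> 1"
  shows "walk_gf M Y (peak_at w h) x = walk_gf M (\<lambda>i s. - Y i s) (top_at w h) 1
     + walk_gf M (\<lambda>i s. - Y i s) (hit_at w h) x * walk_gf M Y (peak_at w h) x"
proof -
  interpret N: iid_walk M "\<lambda>i s. - Y i s" L \<sigma> by (rule iid_walk_uminus)
  let ?P = "\<lambda>m. walk_prob M Y (\<lambda>y. peak_at w h y m)"
  let ?C = "\<lambda>m. walk_prob M Y (\<lambda>y. \<exists>k\<in>{1..m}. hit_at w h (\<lambda>i. - y i) k \<and> peak_at w h (shift k y) (m - k))"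
  let ?q = "walk_gf M (\<lambda>i s. - Y i s) (top_at w h) 1"
  have q: "?P 0 = ?q"
    unfolding N.walk_gf_1[OF measurable_top_at exclusive_top_at(1)] walk_prob_uminus[symmetric]
    by (simp add: peak_at_0_iff[OF h])
  have C0: "?C 0 = 0" by (simp add: walk_prob_def)
  have "?P m * x ^ m = (if m = 0 then ?q else 0) + ?C m * x ^ m" for m
  proof (cases "m = 0")
    case False
    then have "(\<lambda>y. peak_at w h y m) = (\<lambda>y. \<exists>k\<in>{1..m}. hit_at w h (\<lambda>i. - y i) k \<and> peak_at w h (shift k y) (m - k))"
      using peak_at_pos_iff[OF h] by (auto simp: fun_eq_iff)
    then show ?thesis using False by simp
  qed (use q C0 in simp)
  moreover have "(\<lambda>m. (if m = 0 then ?q else 0) + ?C m * x ^ m) sums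
      (?q + walk_gf M Y (\<lambda>y. hit_at w h (\<lambda>i. - y i)) x * walk_gf M Y (peak_at w h) x)"
  proof (rule sums_add)
    show "(\<lambda>m. if m = 0 then ?q else 0) sums ?q"
      using sums_single[of 0 "\<lambda>_. ?q"] by simp
    show "(\<lambda>m. ?C m * x ^ m) sums (walk_gf M Y (\<lambda>y. hit_at w h (\<lambda>i. - y i)) x * walk_gf M Y (peak_at w h) x)"
    proof (rule walk_gf_renewal[OF measurable_uminus_pred[OF measurable_hit_at] measurable_peak_at exclusive_hit_at(2) exclusive_peak_at _ _ x])
      show "hit_at w h (\<lambda>i. - y i) k = hit_at w h (\<lambda>i. - y' i) k" if "\<And>i. i < k \<Longrightarrow> y i = y' i" for y y' k
        by (rule hit_at_cong) (simp add: that)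
    qed auto
  qed
  ultimately have "(\<lambda>m. ?P m * x ^ m) sums
      (?q + walk_gf M Y (\<lambda>y. hit_at w h (\<lambda>i. - y i)) x * walk_gf M Y (peak_at w h) x)"
    by (simp only:)
  from sums_unique[OF this] show ?thesis
    unfolding walk_gf_uminus by (simp only: walk_gf_def)
qed

lemma first_drawdown_gf:
  assumes h: "0 < h" and x: "0 \<le> x" "x \<le> 1"
  shows "walk_gf M Y (first_drawdown h) x = walk_gf M (\<lambda>i s. - Y i s) (top_at w h) x
     + walk_gf M (\<lambda>i s. - Y i s) (hit_at w h) x * walk_gf M Y (first_drawdown h) x"
proof -
  interpret N: iid_walk M "\<lambda>i s. - Y i s" L \<sigma> by (rule iid_walk_uminus)
  let ?T = "\<lambda>m. walk_prob M Y (\<lambda>y. top_at w h (\<lambda>i. - y i) m)"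
  let ?C = "\<lambda>m. walk_prob M Y (\<lambda>y. \<exists>k\<in>{1..m}. hit_at w h (\<lambda>i. - y i) k \<and> first_drawdown h (shift k y) (m - k))"
  have "walk_prob M Y (\<lambda>y. first_drawdown h y m) = ?T m + ?C m" for m
  proof -
    have [measurable]: "Measurable.pred seq_space (\<lambda>y. top_at w h (\<lambda>i. - y i) m)"
       "\<And>k. Measurable.pred seq_space (\<lambda>y. hit_at w h (\<lambda>i. - y i) k)"
       "\<And>k. Measurable.pred seq_space (\<lambda>y. first_drawdown h (shift k y) (m - k))"
      by (rule measurable_uminus_pred[of "\<lambda>y. top_at w h y m", OF measurable_top_at],
          rule measurable_uminus_pred[of "\<lambda>y. hit_at w h y k" for k, OF measurable_hit_at],
          rule measurable_compose[OF measurable_shift measurable_first_drawdown])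
    let ?A = "{s \<in> space M. top_at w h (\<lambda>i. - Y i s) m}"
    let ?B = "{s \<in> space M. \<exists>k\<in>{1..m}. hit_at w h (\<lambda>i. - Y i s) k \<and> first_drawdown h (shift k (\<lambda>i. Y i s)) (m - k)}"
    have "?A \<in> events" "?B \<in> events"
      by measurable
    moreover have "?A \<inter> ?B = {}"
      using top_at_not_hit_at[OF h] by blast
    ultimately have "measure M (?A \<union> ?B) = measure M ?A + measure M ?B"
      by (rule finite_measure_Union)
    moreover have "?A \<union> ?B = {s \<in> space M. first_drawdown h (\<lambda>i. Y i s) m}"
    proof (rule set_eqI)
      show "s \<in> ?A \<union> ?B \<longleftrightarrow> s \<in> {s \<in> space M. first_drawdown h (\<lambda>i. Y i s) m}" for s
        using first_drawdown_iff[OF h, of "\<lambda>i. Y i s" m w] by blast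
    qed
    ultimately show ?thesis
      unfolding walk_prob_def by simp
  qed
  moreover have "(\<lambda>m. ?T m * x ^ m + ?C m * x ^ m) sums (walk_gf M Y (\<lambda>y. top_at w h (\<lambda>i. - y i)) x
      + walk_gf M Y (\<lambda>y. hit_at w h (\<lambda>i. - y i)) x * walk_gf M Y (first_drawdown h) x)"
  proof (rule sums_add)
    show "(\<lambda>m. ?T m * x ^ m) sums walk_gf M Y (\<lambda>y. top_at w h (\<lambda>i. - y i)) x"
      by (rule walk_gf_sums[OF measurable_uminus_pred[OF measurable_top_at] exclusive_top_at(2) x])
    show "(\<lambda>m. ?C m * x ^ m) sums (walk_gf M Y (\<lambda>y. hit_at w h (\<lambda>i. - y i)) x * walk_gf M Y (first_drawdown h) x)"
    proof (rule walk_gf_renewal[OF measurable_uminus_pred[OF measurable_hit_at] measurable_first_drawdown exclusive_hit_at(2) exclusive_first_drawdown _ _ x])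
      show "hit_at w h (\<lambda>i. - y i) k = hit_at w h (\<lambda>i. - y' i) k" if "\<And>i. i < k \<Longrightarrow> y i = y' i" for y y' k
        by (rule hit_at_cong) (simp add: that)
    qed auto
  qed
  ultimately have "(\<lambda>m. walk_prob M Y (\<lambda>y. first_drawdown h y m) * x ^ m) sums
      (walk_gf M Y (\<lambda>y. top_at w h (\<lambda>i. - y i)) x
      + walk_gf M Y (\<lambda>y. hit_at w h (\<lambda>i. - y i)) x * walk_gf M Y (first_drawdown h) x)"
    by (simp only: distrib_right)
  from sums_unique[OF this] show ?thesis
    unfolding walk_gf_uminus by (simp only: walk_gf_def)
qed

lemma valley_peak_gf:
  assumes h: "0 < h" and x: "0 \<le> x" "x \<le> 1"
  shows "walk_gf M Y (valley_peak_at w h) x = walk_gf M Y (top_at w h) x * walk_gf M Y (peak_at w h) x"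
proof -
  have "(\<lambda>m. walk_prob M Y (\<lambda>y. \<exists>k\<in>{1..m}. top_at w h y k \<and> peak_at w h (shift k y) (m - k)) * x ^ m)
     sums (walk_gf M Y (top_at w h) x * walk_gf M Y (peak_at w h) x)"
    by (rule walk_gf_renewal[OF measurable_top_at measurable_peak_at exclusive_top_at(1) exclusive_peak_at top_at_cong _ x]) auto
  from sums_unique[OF this] show ?thesis
    by (simp only: walk_gf_def valley_peak_at_iff[OF h])
qed

section \<open>Discounted expectations at exit times\<close>

definition stop_exp :: "((nat \<Rightarrow> real) \<Rightarrow> nat \<Rightarrow> bool) \<Rightarrow> (real \<Rightarrow> real) \<Rightarrow> nat \<Rightarrow> real" where
  "stop_exp Q f n = expectation (\<lambda>s. f (walk (\<lambda>i. Y i s) n) * indicator {y. Q y n} (\<lambda>i. Y i s))"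

definition stop_gf :: "((nat \<Rightarrow> real) \<Rightarrow> nat \<Rightarrow> bool) \<Rightarrow> (real \<Rightarrow> real) \<Rightarrow> real \<Rightarrow> real" where
  "stop_gf Q f x = (\<Sum>n. stop_exp Q f n * x ^ n)"

lemma indicator_pred_measurable [measurable (raw)]:
  assumes "Measurable.pred seq_space Q"
  shows "(indicator {y. Q y} :: _ \<Rightarrow> real) \<in> borel_measurable seq_space"
  using assms by (intro borel_measurable_indicator) (simp add: pred_def space_PiM)

text \<open>Confinement is asked only of paths that come from points of the space, since the step
  bound speaks only of those. It makes every continuous function of the stopped position bounded and
  hence integrable.\<close>

definition stop_region :: "((nat \<Rightarrow> real) \<Rightarrow> nat \<Rightarrow> bool) \<Rightarrow> real \<Rightarrow> real \<Rightarrow> bool" where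
  "stop_region Q lo hi \<longleftrightarrow> (\<forall>k. Measurable.pred seq_space (\<lambda>y. Q y k)) \<and>
     (\<forall>s\<in>space M. \<forall>k. Q (\<lambda>i. Y i s) k \<longrightarrow> walk (\<lambda>i. Y i s) k \<in> {lo..hi})"

context
  fixes Q :: "(nat \<Rightarrow> real) \<Rightarrow> nat \<Rightarrow> bool" and lo hi :: real
  assumes R: "stop_region Q lo hi"
begin

lemma stop_region_pred: "Measurable.pred seq_space (\<lambda>y. Q y k)"
  using R by (auto simp: stop_region_def)

lemma stop_regionD: "s \<in> space M \<Longrightarrow> Q (\<lambda>i. Y i s) k \<Longrightarrow> walk (\<lambda>i. Y i s) k \<in> {lo..hi}"
  using R unfolding stop_region_def by blast

lemma stop_integrable:
  fixes f :: "real \<Rightarrow> real"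
  assumes "continuous_on UNIV f"
  shows "integrable M (\<lambda>s. f (walk (\<lambda>i. Y i s) n) * indicator {y. Q y n} (\<lambda>i. Y i s))"
proof -
  have [measurable]: "f \<in> borel_measurable borel"
    using assms by (rule borel_measurable_continuous_onI)
  have [measurable]: "(indicator {y. Q y n} :: _ \<Rightarrow> real) \<in> borel_measurable seq_space"
    by (rule indicator_pred_measurable[OF stop_region_pred])
  have "bounded (f ` {lo..hi})"
    by (intro compact_imp_bounded compact_continuous_image continuous_on_subset[OF assms]) auto
  then obtain C where C: "C > 0" "\<forall>x\<in>{lo..hi}. \<bar>f x\<bar> \<le> C"
    unfolding bounded_pos by auto
  have "(\<lambda>s. f (walk (\<lambda>i. Y i s) n) * indicator {y. Q y n} (\<lambda>i. Y i s)) \<in> borel_measurable M"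
    by measurable
  moreover have "norm (f (walk (\<lambda>i. Y i s) n) * indicator {y. Q y n} (\<lambda>i. Y i s)) \<le> C" if "s \<in> space M" for s
    using C stop_regionD[OF that, of n] by (auto simp: indicator_def)
  ultimately show ?thesis
    by (intro integrable_const_bound[where B = C]) auto
qed

lemma stop_exp_add:
  assumes "continuous_on UNIV f" "continuous_on UNIV g"
  shows "stop_exp Q (\<lambda>s. f s + g s) n = stop_exp Q f n + stop_exp Q g n"
  unfolding stop_exp_def
  by (subst Bochner_Integration.integral_add[symmetric]) (auto intro!: stop_integrable assms simp: distrib_right)

lemma stop_exp_cmult: "stop_exp Q (\<lambda>s. c * f s) n = c * stop_exp Q f n"
  unfolding stop_exp_def by (simp add: mult.assoc)

lemma stop_exp_mono:
  assumes "continuous_on UNIV f" "continuous_on UNIV g" "\<And>s. s \<in> {lo..hi} \<Longrightarrow> f s \<le> g s"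
  shows "stop_exp Q f n \<le> stop_exp Q g n"
  unfolding stop_exp_def
  by (intro integral_mono stop_integrable assms) (use assms(3) stop_regionD in \<open>auto simp: indicator_def\<close>)

lemma stop_exp_const: "stop_exp Q (\<lambda>_. c) n = c * walk_prob M Y (\<lambda>y. Q y n)"
  unfolding stop_exp_def walk_prob_eq_expectation[OF stop_region_pred] by simp

context
  assumes disj: "exclusive Q"
begin

lemma stop_gf_sums:
  assumes f: "continuous_on UNIV f" and x: "0 \<le> x" "x \<le> 1"
  shows "(\<lambda>n. stop_exp Q f n * x ^ n) sums stop_gf Q f x"
proof -
  have "bounded (f ` {lo..hi})"
    by (intro compact_imp_bounded compact_continuous_image continuous_on_subset[OF f]) auto
  then obtain C where C: "C > 0" "\<forall>x\<in>{lo..hi}. \<bar>f x\<bar> \<le> C"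
    unfolding bounded_pos by auto
  have "summable (\<lambda>n. stop_exp Q f n * x ^ n)"
  proof (rule summable_comparison_test')
    show "summable (\<lambda>n. C * (walk_prob M Y (\<lambda>y. Q y n) * x ^ n))"
      by (intro summable_mult walk_gf_summable[OF stop_region_pred disj x])
    fix n
    have "stop_exp Q f n \<le> stop_exp Q (\<lambda>_. C) n" "stop_exp Q (\<lambda>_. - C) n \<le> stop_exp Q f n"
      by (rule stop_exp_mono; use f C in \<open>force intro: continuous_on_const\<close>)+
    then have "\<bar>stop_exp Q f n\<bar> \<le> C * walk_prob M Y (\<lambda>y. Q y n)"
      by (simp add: stop_exp_const abs_le_iff)
    then have "\<bar>stop_exp Q f n\<bar> * x ^ n \<le> C * walk_prob M Y (\<lambda>y. Q y n) * x ^ n"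
      using x by (intro mult_right_mono) auto
    then show "norm (stop_exp Q f n * x ^ n) \<le> C * (walk_prob M Y (\<lambda>y. Q y n) * x ^ n)"
      using x by (simp add: abs_mult mult.assoc)
  qed
  then show ?thesis unfolding stop_gf_def by (rule summable_sums)
qed

lemma stop_gf_add:
  assumes "continuous_on UNIV f" "continuous_on UNIV g" "0 \<le> x" "x \<le> 1"
  shows "stop_gf Q (\<lambda>s. f s + g s) x = stop_gf Q f x + stop_gf Q g x"
  unfolding stop_gf_def[of Q "\<lambda>s. f s + g s"] stop_exp_add[OF assms(1,2)] distrib_right
  by (rule sums_unique[symmetric], rule sums_add; rule stop_gf_sums; fact)

lemma stop_gf_cmult:
  assumes "continuous_on UNIV f" "0 \<le> x" "x \<le> 1"
  shows "stop_gf Q (\<lambda>s. c * f s) x = c * stop_gf Q f x"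
  unfolding stop_gf_def[of Q "\<lambda>s. c * f s"] stop_exp_cmult mult.assoc
  by (rule sums_unique[symmetric], rule sums_mult; rule stop_gf_sums; fact)

lemma stop_gf_const:
  assumes "0 \<le> x" "x \<le> 1"
  shows "stop_gf Q (\<lambda>_. c) x = c * walk_gf M Y Q x"
  unfolding stop_gf_def stop_exp_const mult.assoc
  by (rule sums_unique[symmetric], rule sums_mult; rule walk_gf_sums[OF stop_region_pred disj assms])

lemma stop_gf_mono:
  assumes "continuous_on UNIV f" "continuous_on UNIV g" "\<And>s. s \<in> {lo..hi} \<Longrightarrow> f s \<le> g s" "0 \<le> x" "x \<le> 1"
  shows "stop_gf Q f x \<le> stop_gf Q g x"
  by (rule sums_le[OF _ stop_gf_sums stop_gf_sums]) (use assms in \<open>auto intro!: mult_right_mono stop_exp_mono\<close>)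

end

end

end

section \<open>Optional stopping at the exit from a strip\<close>

context iid_walk
begin

lemma top_region: "0 < h \<Longrightarrow> stop_region (top_at w h) h (h + L)"
  using top_at_bounds[of h w "\<lambda>i. Y i s" k L for s k] bdd measurable_top_at unfolding stop_region_def by blast

lemma hit_region: "0 < h \<Longrightarrow> stop_region (hit_at w h) (- L) 0"
  using hit_at_bounds[of h w "\<lambda>i. Y i s" k L for s k] bdd measurable_hit_at unfolding stop_region_def by blast

lemma alive_region: "0 < h \<Longrightarrow> stop_region (alive w h) 0 h"
  using alive_bounds[of h w "\<lambda>i. Y i s" k for s k] measurable_alive unfolding stop_region_def by fastforce

lemmas top_sums = stop_gf_sums[OF top_region exclusive_top_at(1)]
lemmas hit_sums = stop_gf_sums[OF hit_region exclusive_hit_at(1)]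
lemmas top_mono = stop_gf_mono[OF top_region exclusive_top_at(1)]
lemmas hit_mono = stop_gf_mono[OF hit_region exclusive_hit_at(1)]
lemmas top_linear = stop_gf_add[OF top_region exclusive_top_at(1)] stop_gf_cmult[OF top_region exclusive_top_at(1)]
lemmas hit_linear = stop_gf_add[OF hit_region exclusive_hit_at(1)] stop_gf_cmult[OF hit_region exclusive_hit_at(1)]
lemmas top_const = stop_gf_const[OF top_region exclusive_top_at(1)]
lemmas hit_const = stop_gf_const[OF hit_region exclusive_hit_at(1)]
lemmas alive_mono = stop_exp_mono[OF alive_region]
lemmas alive_const = stop_exp_const[OF alive_region]

text \<open>Step \<open>n\<close> is independent of the path before it and of survival up to time
  \<open>n\<close>. Products of a function of the position and a function of the step cover all
  martingales that occur: exponentials factor, and first and second powers of a sum are sums of such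
  products.\<close>

lemma alive_step:
  fixes u v :: "real \<Rightarrow> real"
  assumes h: "0 < h" and u: "continuous_on UNIV u" and v: "continuous_on UNIV v"
  shows "expectation (\<lambda>s. u (walk (\<lambda>i. Y i s) n) * v (Y n s) * indicator {y. alive w h y n} (\<lambda>i. Y i s))
    = stop_exp (alive w h) u n * expectation (\<lambda>s. v (Y 0 s))"
   and "integrable M (\<lambda>s. u (walk (\<lambda>i. Y i s) n) * v (Y n s) * indicator {y. alive w h y n} (\<lambda>i. Y i s))"
proof -
  have [measurable]: "u \<in> borel_measurable borel" "v \<in> borel_measurable borel"
    using u v by (auto intro: borel_measurable_continuous_onI)
  have "bounded (u ` {0..h})" "bounded (v ` {- L..L})"
    by (auto intro!: compact_imp_bounded compact_continuous_image continuous_on_subset[OF u] continuous_on_subset[OF v])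
  then obtain CF CG where CF: "CF > 0" "\<forall>x\<in>{0..h}. \<bar>u x\<bar> \<le> CF" and CG: "CG > 0" "\<forall>x\<in>{- L..L}. \<bar>v x\<bar> \<le> CG"
    unfolding bounded_pos by auto
  have ind[measurable]: "(indicator {y. alive w h y n} :: _ \<Rightarrow> real) \<in> borel_measurable seq_space"
    by (rule indicator_pred_measurable[OF measurable_alive])
  define F where "F = (\<lambda>y. u (walk y n) * indicator {y. alive w h y n} y)"
  define G where "G = (\<lambda>y::nat \<Rightarrow> real. v (y 0))"
  have [measurable]: "F \<in> borel_measurable seq_space" "G \<in> borel_measurable seq_space"
    unfolding F_def G_def by measurable
  have bF: "\<bar>F (\<lambda>i. Y i s)\<bar> \<le> CF" if "s \<in> space M" for s
    using CF stop_regionD[OF alive_region[OF h] that, of w n] by (auto simp: F_def indicator_def)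
  have bG: "\<bar>G (shift n (\<lambda>i. Y i s))\<bar> \<le> CG" if "s \<in> space M" for s
    using CG bdd[OF that, of n] by (auto simp: G_def shift_def abs_le_iff)
  have eq: "u (walk (\<lambda>i. Y i s) n) * v (Y n s) * indicator {y. alive w h y n} (\<lambda>i. Y i s)
     = F (\<lambda>i. Y i s) * G (shift n (\<lambda>i. Y i s))" for s
    by (simp add: F_def G_def shift_def)
  show "expectation (\<lambda>s. u (walk (\<lambda>i. Y i s) n) * v (Y n s) * indicator {y. alive w h y n} (\<lambda>i. Y i s))
    = stop_exp (alive w h) u n * expectation (\<lambda>s. v (Y 0 s))"
    unfolding eq
  proof (subst markov_expectation[where CF = CF and CG = CG])
    show "F y = F y'" if "\<And>i. i < n \<Longrightarrow> y i = y' i" for y y'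
      using walk_cong[of n y y' n] alive_cong[of n y y' w h] that by (simp add: F_def indicator_def)
  qed (use bF bG in \<open>auto simp: stop_exp_def F_def G_def\<close>)
  have "\<bar>F (\<lambda>i. Y i s) * G (shift n (\<lambda>i. Y i s))\<bar> \<le> CF * CG" if "s \<in> space M" for s
    unfolding abs_mult using bF[OF that] bG[OF that] CF by (intro mult_mono) auto
  then show "integrable M (\<lambda>s. u (walk (\<lambda>i. Y i s) n) * v (Y n s) * indicator {y. alive w h y n} (\<lambda>i. Y i s))"
    unfolding eq by (intro integrable_const_bound[where B = "CF * CG"]) auto
qed

lemma alive_next:
  fixes f :: "real \<Rightarrow> real"
  assumes h: "0 < h" and f: "continuous_on UNIV f"
  shows "expectation (\<lambda>s. f (walk (\<lambda>i. Y i s) n + Y n s) * indicator {y. alive w h y n} (\<lambda>i. Y i s))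
     = stop_exp (alive w h) f (Suc n) + stop_exp (top_at w h) f (Suc n) + stop_exp (hit_at w h) f (Suc n)"
proof -
  have "integrable M (\<lambda>s. f (walk (\<lambda>i. Y i s) (Suc n)) * indicator {y. alive w h y (Suc n)} (\<lambda>i. Y i s))"
    "integrable M (\<lambda>s. f (walk (\<lambda>i. Y i s) (Suc n)) * indicator {y. top_at w h y (Suc n)} (\<lambda>i. Y i s))"
    "integrable M (\<lambda>s. f (walk (\<lambda>i. Y i s) (Suc n)) * indicator {y. hit_at w h y (Suc n)} (\<lambda>i. Y i s))"
    by (rule stop_integrable[OF alive_region[OF h] f] stop_integrable[OF top_region[OF h] f]
        stop_integrable[OF hit_region[OF h] f])+
  then show ?thesis
    unfolding stop_exp_def alive_Suc_cases[OF h, of w n] walk_Suc distrib_left by simp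
qed

lemma stop_exp_0: "stop_exp (alive w h) f 0 = f 0" "stop_exp (top_at w h) f 0 = 0" "stop_exp (hit_at w h) f 0 = 0"
  by (simp_all add: stop_exp_def prob_space)

text \<open>The choice of \<open>a\<close> makes x^n exp (a S_n) a martingale. On survival the
  exponential is at most exp (|a| h), and the factor x^n removes the surviving part in the
  limit.\<close>

lemma exp_stopping:
  assumes h: "0 < h" and x: "0 < x" "x < 1" and a: "x * expectation (\<lambda>s. exp (a * Y 0 s)) = 1"
  shows "stop_gf (top_at w h) (\<lambda>s. exp (a * s)) x + stop_gf (hit_at w h) (\<lambda>s. exp (a * s)) x = 1"
proof -
  let ?f = "\<lambda>s. exp (a * s)"
  have f: "continuous_on UNIV ?f" by (intro continuous_intros)
  have step: "stop_exp (alive w h) ?f (Suc n) + stop_exp (top_at w h) ?f (Suc n) + stop_exp (hit_at w h) ?f (Suc n)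
      = stop_exp (alive w h) ?f n * expectation (\<lambda>s. exp (a * Y 0 s))" for n
    unfolding alive_next[OF h f, symmetric] alive_step(1)[OF h f f, symmetric]
    by (simp add: distrib_left exp_add)
  have id: "(\<Sum>k\<le>n. (stop_exp (top_at w h) ?f k + stop_exp (hit_at w h) ?f k) * x ^ k) = 1 - stop_exp (alive w h) ?f n * x ^ n" for n
  proof (induction n)
    case (Suc n)
    have "(stop_exp (top_at w h) ?f (Suc n) + stop_exp (hit_at w h) ?f (Suc n)) * x ^ Suc n
       = (stop_exp (alive w h) ?f n * expectation (\<lambda>s. exp (a * Y 0 s)) - stop_exp (alive w h) ?f (Suc n)) * x ^ Suc n"
    proof -
      have "stop_exp (top_at w h) ?f (Suc n) + stop_exp (hit_at w h) ?f (Suc n)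
         = stop_exp (alive w h) ?f n * expectation (\<lambda>s. exp (a * Y 0 s)) - stop_exp (alive w h) ?f (Suc n)"
        using step[of n] by linarith
      then show ?thesis by (simp only:)
    qed
    also have "\<dots> = stop_exp (alive w h) ?f n * x ^ n * (x * expectation (\<lambda>s. exp (a * Y 0 s))) - stop_exp (alive w h) ?f (Suc n) * x ^ Suc n"
      by (simp add: algebra_simps)
    finally show ?case using Suc a by simp
  qed (simp add: stop_exp_0)
  have bd: "norm (stop_exp (alive w h) ?f n * x ^ n) \<le> exp (\<bar>a\<bar> * h) * x ^ n" for n
  proof -
    have "stop_exp (alive w h) (\<lambda>_. 0) n \<le> stop_exp (alive w h) ?f n"
      by (rule alive_mono[OF h]) (auto intro: f)
    moreover have "stop_exp (alive w h) ?f n \<le> stop_exp (alive w h) (\<lambda>_. exp (\<bar>a\<bar> * h)) n"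
    proof (rule alive_mono[OF h])
      show "exp (a * s) \<le> exp (\<bar>a\<bar> * h)" if "s \<in> {0..h}" for s
        using that by (auto intro: mult_mono abs_ge_self)
    qed (auto intro: f)
    moreover have "exp (\<bar>a\<bar> * h) * walk_prob M Y (\<lambda>y. alive w h y n) \<le> exp (\<bar>a\<bar> * h) * 1"
      by (intro mult_left_mono walk_prob_range) auto
    ultimately have "0 \<le> stop_exp (alive w h) ?f n" "stop_exp (alive w h) ?f n \<le> exp (\<bar>a\<bar> * h)"
      unfolding alive_const[OF h] by linarith+
    then show ?thesis
      using x by (simp add: abs_mult mult_right_mono)
  qed
  have "(\<lambda>n. x ^ n) \<longlonglongrightarrow> 0" using x by (intro LIMSEQ_power_zero) auto
  then have "(\<lambda>n. exp (\<bar>a\<bar> * h) * x ^ n) \<longlonglongrightarrow> 0" by (rule tendsto_mult_right_zero)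
  then have "(\<lambda>n. stop_exp (alive w h) ?f n * x ^ n) \<longlonglongrightarrow> 0"
    by (rule Lim_null_comparison[OF always_eventually[OF allI[OF bd]]])
  then have "(\<lambda>n. \<Sum>k\<le>n. (stop_exp (top_at w h) ?f k + stop_exp (hit_at w h) ?f k) * x ^ k) \<longlonglongrightarrow> 1 - 0"
    unfolding id by (intro tendsto_intros)
  moreover have "(\<lambda>k. (stop_exp (top_at w h) ?f k + stop_exp (hit_at w h) ?f k) * x ^ k)
      sums (stop_gf (top_at w h) ?f x + stop_gf (hit_at w h) ?f x)"
    unfolding distrib_right by (intro sums_add top_sums[OF h] hit_sums[OF h] f) (use x in auto)
  ultimately show ?thesis
    unfolding sums_def_le by (intro LIMSEQ_unique) (assumption | simp)+
qed

lemma const_stopping: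
  assumes h: "0 < h"
  shows "(\<Sum>k\<le>n. walk_prob M Y (\<lambda>y. top_at w h y k) + walk_prob M Y (\<lambda>y. hit_at w h y k)) = 1 - walk_prob M Y (\<lambda>y. alive w h y n)"
proof (induction n)
  case 0
  show ?case by (simp add: walk_prob_def prob_space)
next
  case (Suc n)
  have c: "continuous_on UNIV (\<lambda>_::real. 1::real)" by simp
  have "walk_prob M Y (\<lambda>y. alive w h y n) = walk_prob M Y (\<lambda>y. alive w h y (Suc n))
     + walk_prob M Y (\<lambda>y. top_at w h y (Suc n)) + walk_prob M Y (\<lambda>y. hit_at w h y (Suc n))"
    using alive_next[OF h c, where w = w and n = n] alive_step(1)[OF h c c, where w = w and n = n]
    by (simp add: alive_const[OF h] prob_space stop_exp_const[OF top_region[OF h]]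
         stop_exp_const[OF hit_region[OF h]])
  then show ?case using Suc by simp
qed

text \<open>S_n^2 - n \<sigma>^2 is a martingale and positions stay bounded up to the exit. So the
  expected exit time is finite, which makes the survival probabilities summable.\<close>

lemma alive_tendsto_0:
  assumes h: "0 < h"
  shows "(\<lambda>n. walk_prob M Y (\<lambda>y. alive w h y n)) \<longlonglongrightarrow> 0"
proof -
  let ?a = "\<lambda>n. walk_prob M Y (\<lambda>y. alive w h y n)"
  let ?f = "\<lambda>s::real. s * s"
  have c: "continuous_on UNIV ?f" "continuous_on UNIV (\<lambda>s::real. s)" "continuous_on UNIV (\<lambda>_::real. 1::real)"
    by (intro continuous_intros)+
  have step: "stop_exp (alive w h) ?f (Suc n) + stop_exp (top_at w h) ?f (Suc n) + stop_exp (hit_at w h) ?f (Suc n)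
     = stop_exp (alive w h) ?f n + \<sigma>\<^sup>2 * ?a n" for n
  proof -
    let ?I = "\<lambda>s. indicator {y. alive w h y n} (\<lambda>i. Y i s) :: real"
    let ?S = "\<lambda>s. walk (\<lambda>i. Y i s) n"
    have "expectation (\<lambda>s. ?f (?S s + Y n s) * ?I s)
       = expectation (\<lambda>s. ?f (?S s) * 1 * ?I s + (2 * (?S s * Y n s * ?I s) + 1 * ?f (Y n s) * ?I s))"
      by (intro Bochner_Integration.integral_cong) (auto simp: algebra_simps)
    also have "\<dots> = expectation (\<lambda>s. ?f (?S s) * 1 * ?I s)
        + (2 * expectation (\<lambda>s. ?S s * Y n s * ?I s) + expectation (\<lambda>s. 1 * ?f (Y n s) * ?I s))"
      using alive_step(2)[OF h c(1,3), of n w] alive_step(2)[OF h c(2,2), of n w] alive_step(2)[OF h c(3,1), of n w]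
      by (subst Bochner_Integration.integral_add) (auto intro!: Bochner_Integration.integral_add)
    also have "\<dots> = stop_exp (alive w h) ?f n + \<sigma>\<^sup>2 * ?a n"
      unfolding alive_step(1)[OF h c(1,3)] alive_step(1)[OF h c(2,2)] alive_step(1)[OF h c(3,1)]
      using var by (simp add: mean prob_space alive_const[OF h] power2_eq_square)
    finally show ?thesis unfolding alive_next[OF h c(1), symmetric] .
  qed
  have id: "stop_exp (alive w h) ?f n + (\<Sum>k\<le>n. stop_exp (top_at w h) ?f k + stop_exp (hit_at w h) ?f k)
      = \<sigma>\<^sup>2 * (\<Sum>k<n. ?a k)" for n
  proof (induction n)
    case (Suc n)
    then show ?case using step[of n] by (simp add: algebra_simps)
  qed (simp add: stop_exp_0)
  \<comment> \<open>Survivors are at height at most h, and exit positions have absolute value at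
    most h + L.\<close>
  have "\<sigma>\<^sup>2 * (\<Sum>k<n. ?a k) \<le> h * h + (h + L) * (h + L)" for n
  proof -
    have "stop_exp (alive w h) ?f n \<le> stop_exp (alive w h) (\<lambda>_. h * h) n"
      by (rule alive_mono[OF h c(1)]) (auto intro!: mult_mono)
    also have "\<dots> \<le> h * h"
      unfolding alive_const[OF h] using walk_prob_range by (intro mult_left_le) auto
    finally have 1: "stop_exp (alive w h) ?f n \<le> h * h" .
    have "stop_exp (top_at w h) ?f k + stop_exp (hit_at w h) ?f k
      \<le> (h + L) * (h + L) * (walk_prob M Y (\<lambda>y. top_at w h y k) + walk_prob M Y (\<lambda>y. hit_at w h y k))" for k
    proof -
      have "stop_exp (top_at w h) ?f k \<le> stop_exp (top_at w h) (\<lambda>_. (h + L) * (h + L)) k"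
        by (rule stop_exp_mono[OF top_region[OF h] c(1)]) (use h in \<open>auto intro!: mult_mono\<close>)
      moreover have "stop_exp (hit_at w h) ?f k \<le> stop_exp (hit_at w h) (\<lambda>_. (h + L) * (h + L)) k"
      proof (rule stop_exp_mono[OF hit_region[OF h] c(1)])
        show "s * s \<le> (h + L) * (h + L)" if "s \<in> {- L..0}" for s
          using mult_mono[of "- s" "h + L" "- s" "h + L"] that h L_nonneg by auto
      qed auto
      ultimately show ?thesis
        by (simp add: distrib_left stop_exp_const[OF top_region[OF h]] stop_exp_const[OF hit_region[OF h]])
    qed
    then have "(\<Sum>k\<le>n. stop_exp (top_at w h) ?f k + stop_exp (hit_at w h) ?f k)
      \<le> (\<Sum>k\<le>n. (h + L) * (h + L) * (walk_prob M Y (\<lambda>y. top_at w h y k) + walk_prob M Y (\<lambda>y. hit_at w h y k)))"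
      by (intro sum_mono)
    also have "\<dots> = (h + L) * (h + L) * (1 - ?a n)"
      unfolding sum_distrib_left[symmetric] const_stopping[OF h] ..
    also have "\<dots> \<le> (h + L) * (h + L)"
      using walk_prob_range[of "\<lambda>y. alive w h y n"] by (intro mult_left_le) auto
    finally show ?thesis using 1 id[of n] by linarith
  qed
  then have "(\<Sum>k<n. ?a k) \<le> (h * h + (h + L) * (h + L)) / \<sigma>\<^sup>2" for n
    using sigma_pos by (simp add: field_simps)
  then have "summable ?a"
    unfolding lessThan_Suc_atMost[symmetric] using walk_prob_range(1)
    by (intro bounded_imp_summable[where B = "(h * h + (h + L) * (h + L)) / \<sigma>\<^sup>2"])
       (simp_all only: lessThan_Suc_atMost[symmetric])
  then show ?thesis by (rule summable_LIMSEQ_zero)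
qed

lemma exit_gf_1:
  assumes h: "0 < h"
  shows "walk_gf M Y (top_at w h) 1 + walk_gf M Y (hit_at w h) 1 = 1"
proof -
  have "(\<lambda>n. \<Sum>k\<le>n. walk_prob M Y (\<lambda>y. top_at w h y k) + walk_prob M Y (\<lambda>y. hit_at w h y k)) \<longlonglongrightarrow> 1 - 0"
    unfolding const_stopping[OF h] by (intro tendsto_intros alive_tendsto_0 h)
  moreover have "(\<lambda>k. walk_prob M Y (\<lambda>y. top_at w h y k) * 1 ^ k + walk_prob M Y (\<lambda>y. hit_at w h y k) * 1 ^ k)
     sums (walk_gf M Y (top_at w h) 1 + walk_gf M Y (hit_at w h) 1)"
    by (intro sums_add walk_gf_sums measurable_top_at measurable_hit_at exclusive_top_at exclusive_hit_at) auto
  ultimately show ?thesis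
    unfolding sums_def_le by (intro LIMSEQ_unique) (assumption | simp)+
qed

text \<open>Here there is no discount: the surviving part is at most h times the survival
  probability, and that tends to 0.\<close>

lemma id_stopping:
  assumes h: "0 < h"
  shows "stop_gf (top_at w h) (\<lambda>s. s) 1 + stop_gf (hit_at w h) (\<lambda>s. s) 1 = 0"
proof -
  let ?f = "\<lambda>s::real. s"
  have c: "continuous_on UNIV ?f" "continuous_on UNIV (\<lambda>_::real. 1::real)"
    by (intro continuous_intros)+
  have step: "stop_exp (alive w h) ?f (Suc n) + stop_exp (top_at w h) ?f (Suc n) + stop_exp (hit_at w h) ?f (Suc n)
     = stop_exp (alive w h) ?f n" for n
  proof -
    let ?I = "\<lambda>s. indicator {y. alive w h y n} (\<lambda>i. Y i s) :: real"
    let ?S = "\<lambda>s. walk (\<lambda>i. Y i s) n"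
    have "expectation (\<lambda>s. (?S s + Y n s) * ?I s) = expectation (\<lambda>s. ?S s * 1 * ?I s + 1 * Y n s * ?I s)"
      by (intro Bochner_Integration.integral_cong) (auto simp: algebra_simps)
    also have "\<dots> = expectation (\<lambda>s. ?S s * 1 * ?I s) + expectation (\<lambda>s. 1 * Y n s * ?I s)"
      by (intro Bochner_Integration.integral_add alive_step(2)[OF h c(1,2), of n w] alive_step(2)[OF h c(2,1), of n w])
    also have "\<dots> = stop_exp (alive w h) ?f n"
      unfolding alive_step(1)[OF h c(1,2)] alive_step(1)[OF h c(2,1)]
      by (simp add: mean prob_space)
    finally show ?thesis unfolding alive_next[OF h c(1), symmetric] .
  qed
  have id: "(\<Sum>k\<le>n. stop_exp (top_at w h) ?f k + stop_exp (hit_at w h) ?f k) = - stop_exp (alive w h) ?f n" for n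
  proof (induction n)
    case (Suc n)
    then show ?case using step[of n] by (simp add: algebra_simps)
  qed (simp add: stop_exp_0)
  have bd: "norm (stop_exp (alive w h) ?f n) \<le> h * walk_prob M Y (\<lambda>y. alive w h y n)" for n
  proof -
    have "stop_exp (alive w h) ?f n \<le> stop_exp (alive w h) (\<lambda>_. h) n"
         "stop_exp (alive w h) (\<lambda>_. 0) n \<le> stop_exp (alive w h) ?f n"
      by (rule alive_mono[OF h]; auto)+
    then show ?thesis by (simp add: alive_const[OF h])
  qed
  have "(\<lambda>n. h * walk_prob M Y (\<lambda>y. alive w h y n)) \<longlonglongrightarrow> 0"
    by (rule tendsto_mult_right_zero[OF alive_tendsto_0[OF h]])
  then have "(\<lambda>n. stop_exp (alive w h) ?f n) \<longlonglongrightarrow> 0"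
    by (rule Lim_null_comparison[OF always_eventually[OF allI[OF bd]]])
  then have "(\<lambda>n. \<Sum>k\<le>n. stop_exp (top_at w h) ?f k + stop_exp (hit_at w h) ?f k) \<longlonglongrightarrow> - 0"
    unfolding id by (intro tendsto_intros)
  moreover have "(\<lambda>k. stop_exp (top_at w h) ?f k * 1 ^ k + stop_exp (hit_at w h) ?f k * 1 ^ k)
      sums (stop_gf (top_at w h) ?f 1 + stop_gf (hit_at w h) ?f 1)"
    by (intro sums_add top_sums[OF h] hit_sums[OF h] c) auto
  ultimately show ?thesis
    unfolding sums_def_le by (intro LIMSEQ_unique) (assumption | simp)+
qed

end

section \<open>Asymptotics of the exit times\<close>

lemma exp_taylor_bounds:
  fixes u :: real
  assumes "\<bar>u\<bar> \<le> 1"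
  shows "\<bar>exp u - 1 - u\<bar> \<le> 3 * u\<^sup>2" "\<bar>exp u - 1 - u - u\<^sup>2 / 2\<bar> \<le> 3 * \<bar>u\<bar> ^ 3"
proof -
  have e: "exp \<bar>u\<bar> \<le> 3"
    using assms exp_le order_trans[of "exp \<bar>u\<bar>" "exp 1" 3] by simp
  have T: "\<bar>exp u - (\<Sum>i\<le>n. u ^ i / fact i)\<bar> \<le> 3 * \<bar>u\<bar> ^ Suc n" for n
  proof -
    have "\<bar>exp u - (\<Sum>i\<le>n. u ^ i / fact i)\<bar> \<le> exp \<bar>u\<bar> * \<bar>u\<bar> ^ Suc n / fact n"
      using Taylor_exp_field[of u n] by simp
    also have "\<dots> \<le> exp \<bar>u\<bar> * \<bar>u\<bar> ^ Suc n / 1"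
      by (intro divide_left_mono) (auto simp: fact_ge_1)
    also have "\<dots> \<le> 3 * \<bar>u\<bar> ^ Suc n"
      using e by (simp add: mult_right_mono)
    finally show ?thesis .
  qed
  show "\<bar>exp u - 1 - u\<bar> \<le> 3 * u\<^sup>2"
    using T[of 1] by (simp add: diff_diff_eq numeral_2_eq_2 power2_eq_square)
  show "\<bar>exp u - 1 - u - u\<^sup>2 / 2\<bar> \<le> 3 * \<bar>u\<bar> ^ 3"
    using T[of 2] by (simp add: diff_diff_eq numeral_2_eq_2 numeral_3_eq_3)
qed

context iid_walk
begin

text \<open>The mean discounted depth below 0 at a bottom exit. Through it the undershoot enters the
  first-order expansion of the exponential martingales.\<close>

definition hit_loss :: "bool \<Rightarrow> real \<Rightarrow> real \<Rightarrow> real" where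
  "hit_loss w h x = - stop_gf (hit_at w h) (\<lambda>s. s) x"

lemma walk_gf_nonneg: "0 \<le> x \<Longrightarrow> x \<le> 1 \<Longrightarrow> exclusive Q \<Longrightarrow> (\<And>k. Measurable.pred seq_space (\<lambda>y. Q y k)) \<Longrightarrow> 0 \<le> walk_gf M Y Q x"
  by (rule sums_le[OF _ sums_zero walk_gf_sums]) (auto simp: walk_prob_range)

lemma walk_gf_mono:
  assumes "0 \<le> x" "x \<le> 1" "exclusive Q" "\<And>k. Measurable.pred seq_space (\<lambda>y. Q y k)"
  shows "walk_gf M Y Q x \<le> walk_gf M Y Q 1"
proof (rule sums_le[OF _ walk_gf_sums[OF assms(4,3,1,2)] walk_gf_sums[OF assms(4,3)]])
  show "walk_prob M Y (\<lambda>y. Q y n) * x ^ n \<le> walk_prob M Y (\<lambda>y. Q y n) * 1 ^ n" for n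
    using power_le_one[OF assms(1,2)] unfolding power_one by (intro mult_left_mono walk_prob_range)
qed auto

lemma walk_gf_le_1:
  assumes "0 \<le> x" "x \<le> 1" "exclusive Q" "\<And>k. Measurable.pred seq_space (\<lambda>y. Q y k)"
  shows "walk_gf M Y Q x \<le> 1"
  using walk_gf_mono[OF assms] walk_gf_1[OF assms(4,3)] walk_prob_range by (metis order_trans)

text \<open>The equation x E exp (u Y) = 1 has a positive root a and a negative root - b, so two
  stopped martingales are available. Their difference and sum act as 2 sinh and 2 cosh: at the top
  they are known up to the overshoot, and at the bottom they equal (a + b) s and 2 up to the Taylor
  error \<open>r\<close>. For an asymmetric step law a and b differ, which leaves the term |a - b|
  L.\<close>

lemma exit_estimates:
  fixes w :: bool and h x a b :: real
  assumes h: "0 < h" and x: "0 < x" "x < 1" and ab: "0 < a" "0 < b" "a * L \<le> 1" "b * L \<le> 1"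
    and a: "x * expectation (\<lambda>s. exp (a * Y 0 s)) = 1" and b: "x * expectation (\<lambda>s. exp (b * - Y 0 s)) = 1"
  defines "A \<equiv> walk_gf M Y (top_at w h) x" and "B \<equiv> walk_gf M Y (hit_at w h) x" and "D \<equiv> hit_loss w h x"
    and "r \<equiv> 3 * (a\<^sup>2 + b\<^sup>2) * L\<^sup>2"
  shows "A * (exp (a * h) - exp (- b * h)) \<le> (a + b) * D + r"
    and "(a + b) * D - r \<le> A * (exp (a * (h + L)) - exp (- b * (h + L)))"
    and "2 * (1 - B) \<le> A * (exp (a * (h + L)) + exp (- b * h)) + \<bar>a - b\<bar> * L + r"
    and "A * (exp (a * h) + exp (- b * (h + L))) - \<bar>a - b\<bar> * L - r \<le> 2 * (1 - B)"
proof -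
  let ?T = "\<lambda>f. stop_gf (top_at w h) f x" and ?H = "\<lambda>f. stop_gf (hit_at w h) f x"
  let ?a = "\<lambda>s. exp (a * s)" and ?b = "\<lambda>s. exp (- b * s)"
  have x': "0 \<le> x" "x \<le> 1" using x by auto
  have c: "continuous_on UNIV ?a" "continuous_on UNIV ?b" "continuous_on UNIV (\<lambda>s. c * s)" "continuous_on UNIV (\<lambda>s. c * ?b s)"
    "continuous_on UNIV (\<lambda>s::real. s)" "continuous_on UNIV (\<lambda>s::real. k)" for c k :: real
    by (intro continuous_intros)+
  have 1: "?T ?a + ?H ?a = 1" by (rule exp_stopping[OF h x a])
  have 2: "?T ?b + ?H ?b = 1" using exp_stopping[OF h x, of "- b"] b by simp
  have B1: "0 \<le> B" "B \<le> 1"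
    unfolding B_def by (intro walk_gf_nonneg walk_gf_le_1 x' exclusive_hit_at measurable_hit_at)+
  have r0: "0 \<le> r" by (simp add: r_def)
  define f where "f = (\<lambda>s. ?a s + (- 1) * ?b s)"
  define g where "g = (\<lambda>s. ?a s + 1 * ?b s)"
  have cf: "continuous_on UNIV f" "continuous_on UNIV g"
    unfolding f_def g_def by (intro continuous_intros)+
  have f0: "?T f + ?H f = 0"
    unfolding f_def top_linear(1)[OF h c(1) c(4) x'] hit_linear(1)[OF h c(1) c(4) x']
      top_linear(2)[OF h c(2) x'] hit_linear(2)[OF h c(2) x'] using 1 2 by simp
  have g2: "?T g + ?H g = 2"
    unfolding g_def top_linear(1)[OF h c(1) c(4) x'] hit_linear(1)[OF h c(1) c(4) x']
      top_linear(2)[OF h c(2) x'] hit_linear(2)[OF h c(2) x'] using 1 2 by simp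
  have T_lo: "k * A \<le> ?T u" if "continuous_on UNIV u" "\<And>s. s \<in> {h..h + L} \<Longrightarrow> k \<le> u s" for u k
  proof -
    have "?T (\<lambda>_. k) \<le> ?T u" by (rule top_mono[OF h c(6) that x'])
    then show ?thesis by (simp add: top_const[OF h x'] A_def)
  qed
  have T_hi: "?T u \<le> k * A" if "continuous_on UNIV u" "\<And>s. s \<in> {h..h + L} \<Longrightarrow> u s \<le> k" for u k
  proof -
    have "?T u \<le> ?T (\<lambda>_. k)" by (rule top_mono[OF h that(1) c(6) that(2) x'])
    then show ?thesis by (simp add: top_const[OF h x'] A_def)
  qed
  have lin: "?H (\<lambda>s. p * s + q) = - p * D + q * B" for p q
    unfolding hit_linear(1)[OF h c(3) c(6) x'] hit_linear(2)[OF h c(5) x'] hit_const[OF h x'] D_def hit_loss_def B_def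
    by simp
  have clin: "continuous_on UNIV (\<lambda>s. p * s + q)" for p q :: real by (intro continuous_intros)
  have H_lo: "- p * D + q * B \<le> ?H u" if "continuous_on UNIV u" "\<And>s. s \<in> {- L..0} \<Longrightarrow> p * s + q \<le> u s" for u p q
  proof -
    have "?H (\<lambda>s. p * s + q) \<le> ?H u" by (rule hit_mono[OF h clin that x'])
    then show ?thesis by (simp only: lin)
  qed
  have H_hi: "?H u \<le> - p * D + q * B" if "continuous_on UNIV u" "\<And>s. s \<in> {- L..0} \<Longrightarrow> u s \<le> p * s + q" for u p q
  proof -
    have "?H u \<le> ?H (\<lambda>s. p * s + q)" by (rule hit_mono[OF h that(1) clin that(2) x'])
    then show ?thesis by (simp only: lin)
  qed
  have tay: "\<bar>exp (a * s) - 1 - a * s\<bar> \<le> 3 * a\<^sup>2 * L\<^sup>2" "\<bar>exp (- b * s) - 1 + b * s\<bar> \<le> 3 * b\<^sup>2 * L\<^sup>2"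
    if "s \<in> {- L..0}" for s
  proof -
    have s: "\<bar>s\<bar> \<le> L" using that by auto
    have s2: "s\<^sup>2 \<le> L\<^sup>2" using s by (simp add: abs_le_square_iff[symmetric])
    have "\<bar>a * s\<bar> \<le> 1" "\<bar>- b * s\<bar> \<le> 1"
    proof -
      have "a * \<bar>s\<bar> \<le> a * L" "b * \<bar>s\<bar> \<le> b * L" using ab s by (auto intro: mult_left_mono)
      then have "a * \<bar>s\<bar> \<le> 1" "b * \<bar>s\<bar> \<le> 1" using ab by linarith+
      then show "\<bar>a * s\<bar> \<le> 1" "\<bar>- b * s\<bar> \<le> 1" using ab by (auto simp: abs_mult)
    qed
    note this[THEN exp_taylor_bounds(1)]
    moreover have "3 * (a * s)\<^sup>2 \<le> 3 * a\<^sup>2 * L\<^sup>2" "3 * (- b * s)\<^sup>2 \<le> 3 * b\<^sup>2 * L\<^sup>2"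
      using s2 by (auto simp: power_mult_distrib intro!: mult_left_mono)
    ultimately show "\<bar>exp (a * s) - 1 - a * s\<bar> \<le> 3 * a\<^sup>2 * L\<^sup>2" "\<bar>exp (- b * s) - 1 + b * s\<bar> \<le> 3 * b\<^sup>2 * L\<^sup>2"
      by auto
  qed
  have r: "r = 3 * a\<^sup>2 * L\<^sup>2 + 3 * b\<^sup>2 * L\<^sup>2" by (simp add: r_def algebra_simps)
  have rB: "r * B \<le> r" "0 \<le> r * B" using r0 B1 by (auto intro: mult_left_le)
  have mono_a: "exp (a * s) \<le> exp (a * t)" and mono_b: "exp (- b * t) \<le> exp (- b * s)" if "s \<le> t" for s t
    using that ab by auto
  have Hf: "- (a + b) * D - r \<le> ?H f" "?H f \<le> - (a + b) * D + r"
  proof -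
    have "- (a + b) * D + (- r) * B \<le> ?H f"
    proof (rule H_lo[OF cf(1)])
      fix s assume "s \<in> {- L..0}"
      from tay[OF this] show "(a + b) * s + - r \<le> f s"
        using r unfolding f_def distrib_right by linarith
    qed
    then show "- (a + b) * D - r \<le> ?H f" using rB by simp
    have "?H f \<le> - (a + b) * D + r * B"
    proof (rule H_hi[OF cf(1)])
      fix s assume "s \<in> {- L..0}"
      from tay[OF this] show "f s \<le> (a + b) * s + r"
        using r unfolding f_def distrib_right by linarith
    qed
    then show "?H f \<le> - (a + b) * D + r" using rB by simp
  qed
  show "A * (exp (a * h) - exp (- b * h)) \<le> (a + b) * D + r"
  proof -
    have "(exp (a * h) - exp (- b * h)) * A \<le> ?T f"
    proof (rule T_lo[OF cf(1)])
      show "exp (a * h) - exp (- b * h) \<le> f s" if "s \<in> {h..h + L}" for s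
      proof -
        have "exp (a * h) \<le> exp (a * s)" by (rule mono_a) (use that in simp)
        moreover have "exp (- b * s) \<le> exp (- b * h)" by (rule mono_b) (use that in simp)
        ultimately show ?thesis unfolding f_def by linarith
      qed
    qed
    then show ?thesis using Hf f0 by (simp add: algebra_simps)
  qed
  show "(a + b) * D - r \<le> A * (exp (a * (h + L)) - exp (- b * (h + L)))"
  proof -
    have "?T f \<le> (exp (a * (h + L)) - exp (- b * (h + L))) * A"
    proof (rule T_hi[OF cf(1)])
      show "f s \<le> exp (a * (h + L)) - exp (- b * (h + L))" if "s \<in> {h..h + L}" for s
      proof -
        have "exp (a * s) \<le> exp (a * (h + L))" by (rule mono_a) (use that in simp)
        moreover have "exp (- b * (h + L)) \<le> exp (- b * s)" by (rule mono_b) (use that in simp)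
        ultimately show ?thesis unfolding f_def by linarith
      qed
    qed
    then show ?thesis using Hf f0 by (simp add: algebra_simps)
  qed
  define q where "q = \<bar>a - b\<bar> * L + r"
  have q0: "0 \<le> q" using r0 L_nonneg by (simp add: q_def)
  have qB: "q * B \<le> q" "0 \<le> q * B" using q0 B1 by (auto intro: mult_left_le)
  have gs: "\<bar>g s - 2\<bar> \<le> q" if "s \<in> {- L..0}" for s
  proof -
    have "\<bar>(a - b) * s\<bar> \<le> \<bar>a - b\<bar> * L"
    proof -
      have "\<bar>s\<bar> \<le> L" using that by auto
      then show ?thesis unfolding abs_mult by (rule mult_left_mono) simp
    qed
    then have "\<bar>a * s - b * s\<bar> \<le> \<bar>a - b\<bar> * L" by (simp add: left_diff_distrib)
    then show ?thesis using tay[OF that] r unfolding q_def g_def by linarith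
  qed
  have Hg: "2 * B - q \<le> ?H g" "?H g \<le> 2 * B + q"
  proof -
    have "- 0 * D + (2 - q) * B \<le> ?H g"
    proof (rule H_lo[OF cf(2)])
      fix s assume "s \<in> {- L..0}"
      from gs[OF this] show "0 * s + (2 - q) \<le> g s" by linarith
    qed
    then show "2 * B - q \<le> ?H g" using qB by (simp add: left_diff_distrib)
    have "?H g \<le> - 0 * D + (2 + q) * B"
    proof (rule H_hi[OF cf(2)])
      fix s assume "s \<in> {- L..0}"
      from gs[OF this] show "g s \<le> 0 * s + (2 + q)" by linarith
    qed
    then show "?H g \<le> 2 * B + q" using qB by (simp add: distrib_right)
  qed
  show "2 * (1 - B) \<le> A * (exp (a * (h + L)) + exp (- b * h)) + \<bar>a - b\<bar> * L + r"
  proof -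
    have "?T g \<le> (exp (a * (h + L)) + exp (- b * h)) * A"
    proof (rule T_hi[OF cf(2)])
      show "g s \<le> exp (a * (h + L)) + exp (- b * h)" if "s \<in> {h..h + L}" for s
      proof -
        have "exp (a * s) \<le> exp (a * (h + L))" by (rule mono_a) (use that in simp)
        moreover have "exp (- b * s) \<le> exp (- b * h)" by (rule mono_b) (use that in simp)
        ultimately show ?thesis unfolding g_def by linarith
      qed
    qed
    then show ?thesis using Hg g2 by (simp add: algebra_simps q_def)
  qed
  show "A * (exp (a * h) + exp (- b * (h + L))) - \<bar>a - b\<bar> * L - r \<le> 2 * (1 - B)"
  proof -
    have "(exp (a * h) + exp (- b * (h + L))) * A \<le> ?T g"
    proof (rule T_lo[OF cf(2)])
      show "exp (a * h) + exp (- b * (h + L)) \<le> g s" if "s \<in> {h..h + L}" for s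
      proof -
        have "exp (a * h) \<le> exp (a * s)" by (rule mono_a) (use that in simp)
        moreover have "exp (- b * (h + L)) \<le> exp (- b * s)" by (rule mono_b) (use that in simp)
        ultimately show ?thesis unfolding g_def by linarith
      qed
    qed
    then show ?thesis using Hg g2 by (simp add: algebra_simps q_def)
  qed
qed

text \<open>The stopped walk has mean zero, so the loss at the bottom balances the gain at the top,
  which is between h and h + L times the exit probability. The last bound is a floor that does not
  depend on h: the first step alone loses E max (- Y) 0, and \<sigma>^2 \<le> L E|Y| = 2 L E max (-
  Y) 0 since the mean vanishes. The floor keeps the exit probability at the top from decaying faster
  than 1/h.\<close>

lemma hit_loss_bounds:
  fixes w :: bool and h x :: real
  assumes h: "0 < h" and x: "0 \<le> x" "x \<le> 1"
  defines "A1 \<equiv> walk_gf M Y (top_at w h) 1"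
  shows "h * A1 \<le> hit_loss w h 1" "hit_loss w h 1 \<le> (h + L) * A1"
    and "0 \<le> hit_loss w h x" "hit_loss w h x \<le> L"
    and "hit_loss w h x \<le> hit_loss w h 1"
    and "hit_loss w h 1 - hit_loss w h x \<le> L * (1 - walk_gf M Y (hit_at w h) x)"
    and "\<sigma>\<^sup>2 \<le> 2 * L * hit_loss w h 1"
proof -
  have c: "continuous_on UNIV (\<lambda>s::real. s)" "continuous_on UNIV (\<lambda>_::real. k::real)" for k
    by (intro continuous_intros)+
  have loss: "hit_loss w h 1 = stop_gf (top_at w h) (\<lambda>s. s) 1"
    using id_stopping[OF h, of w] by (simp add: hit_loss_def)
  show "h * A1 \<le> hit_loss w h 1"
  proof -
    have "stop_gf (top_at w h) (\<lambda>_. h) 1 \<le> stop_gf (top_at w h) (\<lambda>s. s) 1"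
      by (rule top_mono[OF h c(2) c(1)]) auto
    then show ?thesis unfolding loss by (simp add: top_const[OF h] A1_def)
  qed
  show "hit_loss w h 1 \<le> (h + L) * A1"
  proof -
    have "stop_gf (top_at w h) (\<lambda>s. s) 1 \<le> stop_gf (top_at w h) (\<lambda>_. h + L) 1"
      by (rule top_mono[OF h c(1) c(2)]) auto
    then show ?thesis unfolding loss by (simp add: top_const[OF h] A1_def)
  qed
  let ?e = "\<lambda>n. - stop_exp (hit_at w h) (\<lambda>s. s) n" and ?p = "\<lambda>n. walk_prob M Y (\<lambda>y. hit_at w h y n)"
  have e: "0 \<le> ?e n" "?e n \<le> L * ?p n" for n
  proof -
    have "stop_exp (hit_at w h) (\<lambda>s. s) n \<le> stop_exp (hit_at w h) (\<lambda>_. 0) n"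
         "stop_exp (hit_at w h) (\<lambda>_. - L) n \<le> stop_exp (hit_at w h) (\<lambda>s. s) n"
      by (rule stop_exp_mono[OF hit_region[OF h]]; use c in simp)+
    then show "0 \<le> ?e n" "?e n \<le> L * ?p n"
      by (simp_all add: stop_exp_const[OF hit_region[OF h]])
  qed
  have s: "(\<lambda>n. ?e n * x ^ n) sums hit_loss w h x" if "0 \<le> x" "x \<le> 1" for x
    using sums_minus[OF hit_sums[OF h c(1) that]] by (simp add: hit_loss_def)
  have p: "(\<lambda>n. ?p n * x ^ n) sums walk_gf M Y (hit_at w h) x" if "0 \<le> x" "x \<le> 1" for x
    by (rule walk_gf_sums[OF measurable_hit_at exclusive_hit_at(1) that])
  have s1: "?e sums hit_loss w h 1" "?p sums walk_gf M Y (hit_at w h) 1" using s[of 1] p[of 1] by simp_all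
  show "0 \<le> hit_loss w h x"
    by (rule sums_le[OF mult_nonneg_nonneg[OF e(1) zero_le_power[OF x(1)]] sums_zero s[OF x]])
  have B1: "walk_gf M Y (hit_at w h) 1 \<le> 1"
    by (intro walk_gf_le_1 exclusive_hit_at measurable_hit_at) auto
  show le: "hit_loss w h x \<le> hit_loss w h 1"
    by (rule sums_le[OF mult_left_le[OF power_le_one[OF x] e(1)] s[OF x] s1(1)])
  have "hit_loss w h 1 \<le> L * walk_gf M Y (hit_at w h) 1"
    by (rule sums_le[OF _ s1(1) sums_mult[OF s1(2)]]) (use e in auto)
  then show "hit_loss w h x \<le> L"
    using le mult_left_mono[OF B1 L_nonneg] by simp
  have "hit_loss w h 1 - hit_loss w h x \<le> L * (walk_gf M Y (hit_at w h) 1 - walk_gf M Y (hit_at w h) x)"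
  proof (rule sums_le[OF _ sums_diff[OF s1(1) s[OF x]] sums_mult[OF sums_diff[OF s1(2) p[OF x]]]])
    fix n
    have "0 \<le> 1 - x ^ n" using x by (simp add: power_le_one)
    from mult_right_mono[OF e(2)[of n] this]
    show "?e n - ?e n * x ^ n \<le> L * (?p n - ?p n * x ^ n)"
      by (simp add: algebra_simps)
  qed
  also have "\<dots> \<le> L * (1 - walk_gf M Y (hit_at w h) x)"
    using B1 L_nonneg by (intro mult_left_mono) auto
  finally show "hit_loss w h 1 - hit_loss w h x \<le> L * (1 - walk_gf M Y (hit_at w h) x)" .
  have "?e 1 \<le> hit_loss w h 1"
    using sum_le_suminf[OF sums_summable[OF s1(1)], of "{1}"] e(1) sums_unique[OF s1(1)] by simp
  moreover have "?e 1 = expectation (\<lambda>s. max (- Y 0 s) 0)"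
    unfolding stop_exp_def Bochner_Integration.integral_minus[symmetric]
    by (intro Bochner_Integration.integral_cong)
       (auto simp: walk_def hit_at_def hit_def indicator_def max_def)
  moreover have "\<sigma>\<^sup>2 \<le> 2 * L * expectation (\<lambda>s. max (- Y 0 s) 0)"
  proof -
    have iY: "integrable M (Y 0)"
      by (rule integrable_const_bound[where B = L]) (auto intro!: AE_I2 bdd)
    have im: "integrable M (\<lambda>s. max (- Y 0 s) 0)"
      by (rule integrable_const_bound[where B = L]) (use bdd L_nonneg in \<open>auto intro!: AE_I2 simp: max_def abs_le_iff\<close>)
    have i2: "integrable M (\<lambda>s. (Y 0 s)\<^sup>2)"
      by (rule integrable_const_bound[where B = "L\<^sup>2"])
         (use bdd L_nonneg in \<open>auto intro!: AE_I2 simp: abs_le_square_iff[symmetric]\<close>)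
    have "\<sigma>\<^sup>2 \<le> expectation (\<lambda>s. L * Y 0 s + 2 * L * max (- Y 0 s) 0)"
      unfolding var[symmetric]
    proof (rule integral_mono[OF i2])
      fix s assume "s \<in> space M"
      then have "\<bar>Y 0 s\<bar> * \<bar>Y 0 s\<bar> \<le> L * \<bar>Y 0 s\<bar>" by (intro mult_right_mono bdd) auto
      also have "\<bar>Y 0 s\<bar> = Y 0 s + 2 * max (- Y 0 s) 0" by auto
      finally show "(Y 0 s)\<^sup>2 \<le> L * Y 0 s + 2 * L * max (- Y 0 s) 0"
        by (simp add: power2_eq_square algebra_simps flip: abs_mult)
    qed (use iY im in auto)
    also have "\<dots> = 2 * L * expectation (\<lambda>s. max (- Y 0 s) 0)"
      using iY im mean by simp
    finally show ?thesis .
  qed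
  ultimately show "\<sigma>\<^sup>2 \<le> 2 * L * hit_loss w h 1"
    using mult_left_mono[of "?e 1" "hit_loss w h 1" "2 * L"] L_nonneg by simp
qed

section \<open>The moment generating function of a step and its roots at scale 1/h\<close>

definition mgf :: "real \<Rightarrow> real" where
  "mgf u = expectation (\<lambda>s. exp (u * Y 0 s))"

lemma integrable_continuous_step:
  fixes f :: "real \<Rightarrow> real"
  assumes "continuous_on UNIV f"
  shows "integrable M (\<lambda>s. f (Y 0 s))"
proof -
  have [measurable]: "f \<in> borel_measurable borel"
    using assms by (rule borel_measurable_continuous_onI)
  have "bounded (f ` {- L..L})"
    by (intro compact_imp_bounded compact_continuous_image continuous_on_subset[OF assms]) auto
  then obtain C where C: "\<forall>x\<in>{- L..L}. \<bar>f x\<bar> \<le> C" unfolding bounded_pos by auto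
  have "norm (f (Y 0 s)) \<le> C" if "s \<in> space M" for s
  proof -
    have "Y 0 s \<in> {- L..L}" using bdd[OF that, of 0] by auto
    then show ?thesis using C by simp
  qed
  then show ?thesis
    by (intro integrable_const_bound[where B = C] AE_I2) auto
qed

lemma mgf_taylor:
  assumes "\<bar>u\<bar> * L \<le> 1"
  shows "\<bar>mgf u - 1 - \<sigma>\<^sup>2 * u\<^sup>2 / 2\<bar> \<le> 3 * \<bar>u\<bar> ^ 3 * L ^ 3"
proof -
  let ?g = "\<lambda>y. exp (u * y) - 1 - u * y - (u * y)\<^sup>2 / 2"
  have i: "integrable M (\<lambda>s. exp (u * Y 0 s))" "integrable M (\<lambda>s. u * Y 0 s)" "integrable M (\<lambda>s. (u * Y 0 s)\<^sup>2 / 2)"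
    by (rule integrable_continuous_step, (intro continuous_intros; simp)?)+
  have "expectation (\<lambda>s. ?g (Y 0 s)) = mgf u - 1 - u * expectation (Y 0) - u\<^sup>2 * expectation (\<lambda>s. (Y 0 s)\<^sup>2) / 2"
    using i by (simp add: mgf_def prob_space power_mult_distrib)
  then have "mgf u - 1 - \<sigma>\<^sup>2 * u\<^sup>2 / 2 = expectation (\<lambda>s. ?g (Y 0 s))"
    by (simp add: mean var mult.commute)
  also have "\<bar>\<dots>\<bar> \<le> expectation (\<lambda>s. \<bar>?g (Y 0 s)\<bar>)"
    by (rule integral_abs_bound)
  also have "\<dots> \<le> expectation (\<lambda>s. 3 * \<bar>u\<bar> ^ 3 * L ^ 3)"
  proof (rule integral_mono)
    show "integrable M (\<lambda>s. \<bar>?g (Y 0 s)\<bar>)"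
      by (rule integrable_continuous_step) (intro continuous_intros; simp)
    fix s assume s: "s \<in> space M"
    have "\<bar>u * Y 0 s\<bar> \<le> \<bar>u\<bar> * L" unfolding abs_mult by (intro mult_left_mono bdd s) auto
    then have "\<bar>?g (Y 0 s)\<bar> \<le> 3 * \<bar>u * Y 0 s\<bar> ^ 3"
      using assms by (intro exp_taylor_bounds(2)) auto
    also have "\<dots> \<le> 3 * (\<bar>u\<bar> * L) ^ 3"
      using \<open>\<bar>u * Y 0 s\<bar> \<le> \<bar>u\<bar> * L\<close> by (intro mult_left_mono power_mono) auto
    finally show "\<bar>?g (Y 0 s)\<bar> \<le> 3 * \<bar>u\<bar> ^ 3 * L ^ 3" by (simp add: power_mult_distrib)
  qed auto
  finally show ?thesis by (simp add: prob_space)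
qed

text \<open>For both signs of y and 0 \<le> u \<le> v one has exp (v y) \<ge> exp (u y) + (v - u) y,
  and the linear term has mean zero.\<close>

lemma mgf_mono:
  assumes "0 \<le> u" "u \<le> v"
  shows "mgf u \<le> mgf v"
proof -
  have "expectation (\<lambda>s. exp (u * Y 0 s) + (v - u) * Y 0 s) \<le> mgf v"
    unfolding mgf_def
  proof (rule integral_mono)
    fix s
    let ?y = "Y 0 s"
    have "exp (v * ?y) = exp (u * ?y) * exp ((v - u) * ?y)"
      by (simp add: algebra_simps flip: exp_add)
    also have "\<dots> \<ge> exp (u * ?y) * (1 + (v - u) * ?y)"
      by (intro mult_left_mono exp_ge_add_one_self) auto
    finally have "exp (u * ?y) + exp (u * ?y) * ((v - u) * ?y) \<le> exp (v * ?y)"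
      by (simp add: distrib_left)
    moreover have "1 * ((v - u) * ?y) \<le> exp (u * ?y) * ((v - u) * ?y)"
    proof (cases "?y \<ge> 0")
      case True
      then show ?thesis using assms by (intro mult_right_mono) auto
    next
      case False
      then have "(v - u) * ?y \<le> 0" "exp (u * ?y) \<le> 1"
        using assms by (auto simp: mult_le_0_iff mult_nonneg_nonpos)
      then show ?thesis by (intro mult_right_mono_neg) auto
    qed
    ultimately show "exp (u * ?y) + (v - u) * ?y \<le> exp (v * ?y)" by simp
  qed (rule integrable_continuous_step, intro continuous_intros)+
  moreover have "expectation (\<lambda>s. exp (u * Y 0 s) + (v - u) * Y 0 s) = mgf u"
  proof -
    have "integrable M (\<lambda>s. exp (u * Y 0 s))" "integrable M (\<lambda>s. (v - u) * Y 0 s)"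
      by (rule integrable_continuous_step, intro continuous_intros)+
    then show ?thesis by (simp add: mgf_def mean)
  qed
  ultimately show ?thesis by simp
qed

lemma isCont_mgf: "isCont mgf u"
proof -
  have "((\<lambda>v. mgf v - mgf u) \<longlongrightarrow> 0) (at u)"
  proof (rule Lim_null_comparison)
    have "\<forall>\<^sub>F v in at u. \<bar>v - u\<bar> * L < 1"
    proof (rule order_tendstoD)
      show "((\<lambda>v. \<bar>v - u\<bar> * L) \<longlongrightarrow> \<bar>u - u\<bar> * L) (at u)" by (intro tendsto_intros)
    qed simp
    then show "\<forall>\<^sub>F v in at u. norm (mgf v - mgf u) \<le> exp (\<bar>u\<bar> * L) * (4 * (\<bar>v - u\<bar> * L))"
    proof eventually_elim
      case (elim v)
      have i: "integrable M (\<lambda>s. exp (v * Y 0 s))" for v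
        by (rule integrable_continuous_step) (intro continuous_intros)
      have "mgf v - mgf u = expectation (\<lambda>s. exp (v * Y 0 s) - exp (u * Y 0 s))"
        using i by (simp add: mgf_def)
      also have "\<bar>\<dots>\<bar> \<le> expectation (\<lambda>s. \<bar>exp (v * Y 0 s) - exp (u * Y 0 s)\<bar>)"
        by (rule integral_abs_bound)
      also have "\<dots> \<le> expectation (\<lambda>s. exp (\<bar>u\<bar> * L) * (4 * (\<bar>v - u\<bar> * L)))"
      proof (rule integral_mono)
        fix s assume s: "s \<in> space M"
        let ?t = "(v - u) * Y 0 s"
        have t: "\<bar>?t\<bar> \<le> \<bar>v - u\<bar> * L" unfolding abs_mult by (intro mult_left_mono bdd s) auto
        then have t1: "\<bar>?t\<bar> \<le> 1" using elim by linarith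
        have "?t\<^sup>2 \<le> \<bar>?t\<bar>"
          using mult_left_mono[OF t1, of "\<bar>?t\<bar>"] by (simp add: power2_eq_square abs_mult_self_eq flip: abs_mult)
        then have "\<bar>exp ?t - 1\<bar> \<le> 4 * \<bar>?t\<bar>"
          using exp_taylor_bounds(1)[OF t1] by linarith
        then have e1: "\<bar>exp ?t - 1\<bar> \<le> 4 * (\<bar>v - u\<bar> * L)" using t by linarith
        have "u * Y 0 s \<le> \<bar>u\<bar> * L"
          using mult_left_mono[OF bdd[OF s, of 0], of "\<bar>u\<bar>"] by (simp add: abs_mult[symmetric] abs_le_iff)
        then have e2: "exp (u * Y 0 s) \<le> exp (\<bar>u\<bar> * L)" by simp
        have "exp (v * Y 0 s) - exp (u * Y 0 s) = exp (u * Y 0 s) * (exp ?t - 1)"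
          by (simp add: algebra_simps flip: exp_add)
        then have "\<bar>exp (v * Y 0 s) - exp (u * Y 0 s)\<bar> = exp (u * Y 0 s) * \<bar>exp ?t - 1\<bar>"
          by (simp add: abs_mult)
        also have "\<dots> \<le> exp (\<bar>u\<bar> * L) * (4 * (\<bar>v - u\<bar> * L))"
          by (intro mult_mono e1 e2) auto
        finally show "\<bar>exp (v * Y 0 s) - exp (u * Y 0 s)\<bar> \<le> exp (\<bar>u\<bar> * L) * (4 * (\<bar>v - u\<bar> * L))" .
      qed (use i in auto)
      finally show ?case by (simp add: prob_space)
    qed
    have "((\<lambda>v. exp (\<bar>u\<bar> * L) * (4 * (\<bar>v - u\<bar> * L))) \<longlongrightarrow> exp (\<bar>u\<bar> * L) * (4 * (\<bar>u - u\<bar> * L))) (at u)"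
      by (intro tendsto_intros)
    then show "((\<lambda>v. exp (\<bar>u\<bar> * L) * (4 * (\<bar>v - u\<bar> * L))) \<longlongrightarrow> 0) (at u)" by simp
  qed
  then show ?thesis by (simp add: isCont_def LIM_zero_iff)
qed

end

context iid_walk
begin

lemma mgf_scaled:
  assumes t: "0 < t"
  shows "((\<lambda>h. h\<^sup>2 * (mgf (t / h) - 1)) \<longlongrightarrow> \<sigma>\<^sup>2 * t\<^sup>2 / 2) at_top"
proof -
  have "((\<lambda>h. h\<^sup>2 * (mgf (t / h) - 1) - \<sigma>\<^sup>2 * t\<^sup>2 / 2) \<longlongrightarrow> 0) at_top"
  proof (rule Lim_null_comparison)
    show "\<forall>\<^sub>F h in at_top. norm (h\<^sup>2 * (mgf (t / h) - 1) - \<sigma>\<^sup>2 * t\<^sup>2 / 2) \<le> 3 * t ^ 3 * L ^ 3 / h"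
      using eventually_gt_at_top[of 0] eventually_ge_at_top[of "t * L"]
    proof eventually_elim
      case (elim h)
      have "\<bar>t / h\<bar> * L \<le> 1" using elim t by (simp add: field_simps)
      from mgf_taylor[OF this]
      have m: "\<bar>mgf (t / h) - 1 - \<sigma>\<^sup>2 * (t / h)\<^sup>2 / 2\<bar> \<le> 3 * (t / h) ^ 3 * L ^ 3" using elim t by simp
      have "h\<^sup>2 * (mgf (t / h) - 1) - \<sigma>\<^sup>2 * t\<^sup>2 / 2 = h\<^sup>2 * (mgf (t / h) - 1 - \<sigma>\<^sup>2 * (t / h)\<^sup>2 / 2)"
        using elim by (simp add: field_simps)
      then have "norm (h\<^sup>2 * (mgf (t / h) - 1) - \<sigma>\<^sup>2 * t\<^sup>2 / 2) = h\<^sup>2 * \<bar>mgf (t / h) - 1 - \<sigma>\<^sup>2 * (t / h)\<^sup>2 / 2\<bar>"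
        by (simp add: abs_mult)
      also have "\<dots> \<le> h\<^sup>2 * (3 * (t / h) ^ 3 * L ^ 3)" by (intro mult_left_mono m) auto
      also have "\<dots> = 3 * t ^ 3 * L ^ 3 / h"
        using elim by (simp add: power_divide power2_eq_square power3_eq_cube)
      finally show ?case .
    qed
    show "((\<lambda>h. 3 * t ^ 3 * L ^ 3 / h) \<longlongrightarrow> 0) at_top"
      by (rule tendsto_divide_0[OF tendsto_const filterlim_at_top_imp_at_infinity[OF filterlim_ident]])
  qed
  then show ?thesis by (simp add: LIM_zero_iff)
qed

text \<open>A discount lam on the scale h^2 corresponds to an exponent of order 1/h:
  \<open>mgf (t / h) - 1\<close> is about \<sigma>^2 t^2 / (2 h^2), and this equals lam / h^2 at t =
  sqrt (2 lam) / \<sigma>.\<close>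

lemma tilt_exists:
  assumes lam: "0 < lam"
  obtains a :: "real \<Rightarrow> real" where
    "\<forall>\<^sub>F h in at_top. 0 < a h \<and> exp (- lam / h\<^sup>2) * mgf (a h) = 1"
    "((\<lambda>h. a h * h) \<longlongrightarrow> sqrt (2 * lam) / \<sigma>) at_top"
proof -
  define c where "c = sqrt (2 * lam) / \<sigma>"
  have c: "c > 0" using lam sigma_pos by (simp add: c_def)
  have c2: "\<sigma>\<^sup>2 * c\<^sup>2 / 2 = lam" using lam sigma_pos by (simp add: c_def power_divide)
  have lo: "\<forall>\<^sub>F h in at_top. mgf (t / h) < exp (lam / h\<^sup>2)" if "0 < t" "t < c" for t
  proof -
    have "\<sigma>\<^sup>2 * t\<^sup>2 / 2 < lam"
      unfolding c2[symmetric] using that sigma_pos by (simp add: power_strict_mono)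
    from order_tendstoD(2)[OF mgf_scaled[OF that(1)] this] eventually_gt_at_top[of 0]
    show ?thesis
    proof eventually_elim
      case (elim h)
      then have "mgf (t / h) < 1 + lam / h\<^sup>2" by (simp add: field_simps)
      also have "\<dots> \<le> exp (lam / h\<^sup>2)" by (rule exp_ge_add_one_self)
      finally show ?case .
    qed
  qed
  have hi: "\<forall>\<^sub>F h in at_top. exp (lam / h\<^sup>2) < mgf (t / h)" if "c < t" for t
  proof -
    have t: "0 < t" using c that by simp
    have "lam < \<sigma>\<^sup>2 * t\<^sup>2 / 2"
      unfolding c2[symmetric] using that c sigma_pos by (simp add: power_strict_mono)
    moreover have "((\<lambda>h. h\<^sup>2 * (mgf (t / h) - 1) - h\<^sup>2 * (exp (lam / h\<^sup>2) - 1)) \<longlongrightarrow> \<sigma>\<^sup>2 * t\<^sup>2 / 2 - lam) at_top"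
    proof (intro tendsto_diff mgf_scaled t)
      show "((\<lambda>h::real. h\<^sup>2 * (exp (lam / h\<^sup>2) - 1)) \<longlongrightarrow> lam) at_top" by real_asymp
    qed
    ultimately have "\<forall>\<^sub>F h in at_top. 0 < h\<^sup>2 * (mgf (t / h) - 1) - h\<^sup>2 * (exp (lam / h\<^sup>2) - 1)"
      by (intro order_tendstoD) auto
    then show ?thesis
    proof eventually_elim
      case (elim h)
      then have "0 < h\<^sup>2 * (mgf (t / h) - exp (lam / h\<^sup>2))" by (simp add: algebra_simps)
      then show ?case by (simp add: zero_less_mult_iff)
    qed
  qed
  \<comment> \<open>Any positive root may be selected. The intermediate value theorem shows that one
    exists, and monotonicity of \<open>mgf\<close> locates whichever was selected.\<close>
  define a where "a h = (SOME u. 0 < u \<and> mgf u = exp (lam / h\<^sup>2))" for h :: real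
  have "0 < c / 2" "c / 2 < c" "c < 2 * c" using c by auto
  note lh = lo[OF this(1,2)] hi[OF this(3)]
  have ex: "\<forall>\<^sub>F h in at_top. 0 < a h \<and> mgf (a h) = exp (lam / h\<^sup>2)"
    using lh eventually_gt_at_top[of 0]
  proof eventually_elim
    case (elim h)
    have "\<exists>u\<ge>(c / 2) / h. u \<le> (2 * c) / h \<and> mgf u = exp (lam / h\<^sup>2)"
    proof (rule IVT)
      show "mgf (c / 2 / h) \<le> exp (lam / h\<^sup>2)" "exp (lam / h\<^sup>2) \<le> mgf (2 * c / h)"
        using elim c by auto
      show "c / 2 / h \<le> 2 * c / h" using c elim by (intro divide_right_mono) auto
    qed (simp add: isCont_mgf)
    moreover have "0 < (c / 2) / h" using c elim by simp
    ultimately have "\<exists>u. 0 < u \<and> mgf u = exp (lam / h\<^sup>2)" by (meson less_le_trans)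
    then show ?case unfolding a_def by (rule someI_ex)
  qed
  have "((\<lambda>h. a h * h) \<longlongrightarrow> c) at_top"
  proof (rule order_tendstoI)
    fix t assume "t < c"
    then obtain t' where t': "max 0 t < t'" "t' < c" using c dense[of "max 0 t" c] by auto
    then have "0 < t'" by simp
    show "\<forall>\<^sub>F h in at_top. t < a h * h"
      using lo[OF \<open>0 < t'\<close> t'(2)] ex eventually_gt_at_top[of 0]
    proof eventually_elim
      case (elim h)
      have "\<not> a h \<le> t' / h"
        using mgf_mono[of "a h" "t' / h"] elim t' by auto
      then show ?case using elim t' by (simp add: field_simps not_le)
    qed
  next
    fix t assume t: "c < t"
    show "\<forall>\<^sub>F h in at_top. a h * h < t"
      using hi[OF t] ex eventually_gt_at_top[of 0]
    proof eventually_elim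
      case (elim h)
      have "\<not> t / h \<le> a h"
        using mgf_mono[of "t / h" "a h"] elim t c by auto
      then show ?case using elim by (simp add: field_simps not_le)
    qed
  qed
  moreover have "\<forall>\<^sub>F h in at_top. 0 < a h \<and> exp (- lam / h\<^sup>2) * mgf (a h) = 1"
    using ex by eventually_elim (auto simp flip: exp_add)
  ultimately show thesis using that c_def by blast
qed

lemma L_pos: "0 < L"
proof (rule ccontr)
  assume "\<not> 0 < L"
  then have "L = 0" using L_nonneg by simp
  then have "Y 0 s = 0" if "s \<in> space M" for s using bdd[OF that, of 0] by simp
  then have "expectation (\<lambda>s. (Y 0 s)\<^sup>2) = expectation (\<lambda>s. 0)"
    by (intro Bochner_Integration.integral_cong) auto
  then show False using var sigma_pos by simp
qed

text \<open>Everything is measured in units of the probability \<open>\<alpha> = P(T\<^sub>t\<^sub>o\<^sub>p)\<close>, which is of order \<open>1/h\<close> with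
  a constant that depends on the law of the overshoots.\<close>

lemma exit_asymptotics:
  fixes w :: bool and lam :: real
  assumes lam: "0 < lam"
  defines "c \<equiv> sqrt (2 * lam) / \<sigma>"
  defines "\<alpha> \<equiv> \<lambda>h. walk_gf M Y (top_at w h) 1"
  shows "((\<lambda>h. walk_gf M Y (top_at w h) (exp (- lam / h\<^sup>2)) / \<alpha> h) \<longlongrightarrow> c / sinh c) at_top"
    and "((\<lambda>h. (1 - walk_gf M Y (hit_at w h) (exp (- lam / h\<^sup>2))) / \<alpha> h) \<longlongrightarrow> c * cosh c / sinh c) at_top"
proof -
  interpret N: iid_walk M "\<lambda>i s. - Y i s" L \<sigma> by (rule iid_walk_uminus)
  have c: "c > 0" using lam sigma_pos by (simp add: c_def)
  obtain a where a: "\<forall>\<^sub>F h in at_top. 0 < a h \<and> exp (- lam / h\<^sup>2) * mgf (a h) = 1" and ah: "((\<lambda>h. a h * h) \<longlongrightarrow> c) at_top"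
    using tilt_exists[OF lam] unfolding c_def by blast
  obtain b where b: "\<forall>\<^sub>F h in at_top. 0 < b h \<and> exp (- lam / h\<^sup>2) * N.mgf (b h) = 1" and bh: "((\<lambda>h. b h * h) \<longlongrightarrow> c) at_top"
    using N.tilt_exists[OF lam] unfolding c_def by blast
  \<comment> \<open>The floor for the loss from \<open>hit_loss_bounds\<close>; it yields (h + L) *
    \<alpha> h \<ge> \<delta>.\<close>
  define \<delta> where "\<delta> = \<sigma>\<^sup>2 / (2 * L)"
  have \<delta>: "\<delta> > 0" using sigma_pos L_pos by (simp add: \<delta>_def)
  define A where "A h = walk_gf M Y (top_at w h) (exp (- lam / h\<^sup>2))" for h
  define B where "B h = walk_gf M Y (hit_at w h) (exp (- lam / h\<^sup>2))" for h
  define D where "D h = hit_loss w h (exp (- lam / h\<^sup>2))" for h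
  define r where "r h = 3 * ((a h)\<^sup>2 + (b h)\<^sup>2) * L\<^sup>2" for h
  have inv: "((\<lambda>h::real. k / h) \<longlongrightarrow> 0) at_top" for k
    by (rule tendsto_divide_0[OF tendsto_const filterlim_at_top_imp_at_infinity[OF filterlim_ident]])
  have a0: "(a \<longlongrightarrow> 0) at_top" and b0: "(b \<longlongrightarrow> 0) at_top"
  proof -
    have "((\<lambda>h. (a h * h) * (1 / h)) \<longlongrightarrow> c * 0) at_top" "((\<lambda>h. (b h * h) * (1 / h)) \<longlongrightarrow> c * 0) at_top"
      by (intro tendsto_mult ah bh inv)+
    moreover have "\<forall>\<^sub>F h in at_top. (a h * h) * (1 / h) = a h" "\<forall>\<^sub>F h in at_top. (b h * h) * (1 / h) = b h"
      using eventually_gt_at_top[of "0::real"] by (eventually_elim; simp)+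
    ultimately show "(a \<longlongrightarrow> 0) at_top" "(b \<longlongrightarrow> 0) at_top"
      by (auto intro: Lim_transform_eventually)
  qed
  have small: "\<forall>\<^sub>F h in at_top. a h * L \<le> 1 \<and> b h * L \<le> 1"
  proof -
    have "((\<lambda>h. a h * L) \<longlongrightarrow> 0) at_top" "((\<lambda>h. b h * L) \<longlongrightarrow> 0) at_top"
      using tendsto_mult_left_zero[OF a0] tendsto_mult_left_zero[OF b0] by auto
    then have "\<forall>\<^sub>F h in at_top. a h * L < 1" "\<forall>\<^sub>F h in at_top. b h * L < 1"
      by (auto dest: order_tendstoD(2)[where a = 1])
    then show ?thesis by eventually_elim auto
  qed
  have main: "\<forall>\<^sub>F h in at_top. 0 < h \<and> 0 < a h \<and> 0 < b h \<and>
      \<delta> \<le> (h + L) * \<alpha> h \<and> h * \<alpha> h \<le> L \<and> 0 \<le> A h \<and> A h \<le> \<alpha> h \<and> 0 \<le> 1 - B h \<and>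
      D h \<le> (h + L) * \<alpha> h \<and> h * \<alpha> h - D h \<le> L * (1 - B h) \<and>
      A h * (exp (a h * h) - exp (- (b h * h))) \<le> (a h + b h) * D h + r h \<and>
      (a h + b h) * D h - r h \<le> A h * (exp (a h * h + a h * L) - exp (- (b h * h + b h * L))) \<and>
      2 * (1 - B h) \<le> A h * (exp (a h * h + a h * L) + exp (- (b h * h))) + \<bar>a h - b h\<bar> * L + r h \<and>
      A h * (exp (a h * h) + exp (- (b h * h + b h * L))) - \<bar>a h - b h\<bar> * L - r h \<le> 2 * (1 - B h)"
    using a b small eventually_gt_at_top[of "0::real"]
  proof eventually_elim
    case (elim h)
    have x: "0 < exp (- lam / h\<^sup>2)" "exp (- lam / h\<^sup>2) < 1" using lam elim by auto
    have eq: "exp (- lam / h\<^sup>2) * expectation (\<lambda>s. exp (a h * Y 0 s)) = 1"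
      "exp (- lam / h\<^sup>2) * expectation (\<lambda>s. exp (b h * - Y 0 s)) = 1"
      using elim by (simp_all add: mgf_def N.mgf_def)
    note E = exit_estimates[OF elim(4) x _ _ _ _ eq, of w]
    note H = hit_loss_bounds[OF elim(4) less_imp_le[OF x(1)] less_imp_le[OF x(2)], of w]
    have H1: "hit_loss w h 1 \<le> L" using hit_loss_bounds(4)[OF elim(4), of 1 w] by simp
    have "\<delta> \<le> hit_loss w h 1" using H(7) L_pos by (simp add: \<delta>_def field_simps)
    moreover have "0 \<le> A h" "A h \<le> \<alpha> h" "B h \<le> 1"
      unfolding A_def \<alpha>_def B_def
      by (intro walk_gf_nonneg walk_gf_mono walk_gf_le_1 less_imp_le[OF x(1)] less_imp_le[OF x(2)]
          exclusive_top_at exclusive_hit_at measurable_top_at measurable_hit_at)+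
    moreover have "A h * (exp (a h * h) - exp (- (b h * h))) \<le> (a h + b h) * D h + r h"
      "(a h + b h) * D h - r h \<le> A h * (exp (a h * h + a h * L) - exp (- (b h * h + b h * L)))"
      "2 * (1 - B h) \<le> A h * (exp (a h * h + a h * L) + exp (- (b h * h))) + \<bar>a h - b h\<bar> * L + r h"
      "A h * (exp (a h * h) + exp (- (b h * h + b h * L))) - \<bar>a h - b h\<bar> * L - r h \<le> 2 * (1 - B h)"
      using E elim by (simp_all add: A_def B_def D_def r_def distrib_left)
    moreover have "h * \<alpha> h \<le> hit_loss w h 1" "hit_loss w h 1 \<le> (h + L) * \<alpha> h" "D h \<le> hit_loss w h 1"
      "hit_loss w h 1 - D h \<le> L * (1 - B h)"
      using H unfolding \<alpha>_def D_def B_def by auto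
    ultimately show ?case using H1 elim by (intro conjI) linarith+
  qed
  have \<alpha>0: "(\<alpha> \<longlongrightarrow> 0) at_top"
  proof (rule Lim_null_comparison[OF _ inv[of L]])
    show "\<forall>\<^sub>F h in at_top. norm (\<alpha> h) \<le> L / h"
      using main by eventually_elim (auto simp: field_simps)
  qed
  have \<alpha>pos: "\<forall>\<^sub>F h in at_top. 0 < \<alpha> h"
    using main
  proof eventually_elim
    case (elim h)
    then have "0 < (h + L) * \<alpha> h" using \<delta> by linarith
    moreover have "0 < h + L" using elim L_pos by linarith
    ultimately show ?case by (simp add: zero_less_mult_iff)
  qed
  have inv\<alpha>: "\<forall>\<^sub>F h in at_top. 1 / (h * \<alpha> h) \<le> (1 + L / h) / \<delta>"
    using main \<alpha>pos
  proof eventually_elim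
    case (elim h)
    then have eq: "(1 + L / h) * (h * \<alpha> h) = (h + L) * \<alpha> h" by (simp add: field_simps)
    have "\<delta> \<le> (1 + L / h) * (h * \<alpha> h)" unfolding eq using elim by blast
    then have "\<delta> / \<delta> \<le> (1 + L / h) * (h * \<alpha> h) / \<delta>"
      by (rule divide_right_mono) (use \<delta> in simp)
    then have "1 \<le> (1 + L / h) / \<delta> * (h * \<alpha> h)" using \<delta> by simp
    moreover have "0 < h * \<alpha> h" using elim by simp
    ultimately show ?case by (simp only: pos_divide_le_eq)
  qed
  have bnd: "((\<lambda>h. (1 + L / h) / \<delta>) \<longlongrightarrow> (1 + 0) / \<delta>) at_top"
    using \<delta> by (intro tendsto_intros inv) auto
  \<comment> \<open>h * \<alpha> h is bounded away from 0, so a numerator that tends to 0 remains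
    negligible after division by it.\<close>
  have over\<alpha>: "((\<lambda>h. f h / (h * \<alpha> h)) \<longlongrightarrow> 0) at_top"
    if f: "(f \<longlongrightarrow> 0) at_top" for f :: "real \<Rightarrow> real"
  proof (rule Lim_null_comparison)
    show "\<forall>\<^sub>F h in at_top. norm (f h / (h * \<alpha> h)) \<le> \<bar>f h\<bar> * ((1 + L / h) / \<delta>)"
      using inv\<alpha> \<alpha>pos main
    proof eventually_elim
      case (elim h)
      have "norm (f h / (h * \<alpha> h)) = \<bar>f h\<bar> * (1 / (h * \<alpha> h))" using elim by (simp add: abs_mult)
      also have "\<dots> \<le> \<bar>f h\<bar> * ((1 + L / h) / \<delta>)" using elim by (intro mult_left_mono) auto
      finally show ?case .
    qed
    have "((\<lambda>h. \<bar>f h\<bar> * ((1 + L / h) / \<delta>)) \<longlongrightarrow> \<bar>0\<bar> * ((1 + 0) / \<delta>)) at_top"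
      by (intro tendsto_mult tendsto_rabs f bnd)
    then show "((\<lambda>h. \<bar>f h\<bar> * ((1 + L / h) / \<delta>)) \<longlongrightarrow> 0) at_top" by simp
  qed
  \<comment> \<open>The two errors in units of \<alpha>, which is of order 1/h. The Taylor error is
    of order 1/h^2, and |a - b| is o(1/h) because a h * h and b h * h have the same limit.\<close>
  define e1 where "e1 h = r h / \<alpha> h" for h
  define e2 where "e2 h = \<bar>a h - b h\<bar> * L / \<alpha> h" for h
  have e1: "(e1 \<longlongrightarrow> 0) at_top"
  proof -
    have "((\<lambda>h. 3 * ((a h * h) * a h + (b h * h) * b h) * L\<^sup>2) \<longlongrightarrow> 3 * (c * 0 + c * 0) * L\<^sup>2) at_top"
      by (intro tendsto_intros ah bh a0 b0)
    then have "((\<lambda>h. (3 * ((a h * h) * a h + (b h * h) * b h) * L\<^sup>2) / (h * \<alpha> h)) \<longlongrightarrow> 0) at_top"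
      by (intro over\<alpha>) simp
    moreover have "\<forall>\<^sub>F h in at_top. (3 * ((a h * h) * a h + (b h * h) * b h) * L\<^sup>2) / (h * \<alpha> h) = e1 h"
      using main
    proof eventually_elim
      case (elim h)
      have "3 * ((a h * h) * a h + (b h * h) * b h) * L\<^sup>2 = h * r h"
        by (simp add: r_def power2_eq_square algebra_simps)
      then show ?case using elim by (simp add: e1_def)
    qed
    ultimately show ?thesis by (rule Lim_transform_eventually)
  qed
  have e2: "(e2 \<longlongrightarrow> 0) at_top"
  proof -
    have "((\<lambda>h. \<bar>a h * h - b h * h\<bar> * L) \<longlongrightarrow> \<bar>c - c\<bar> * L) at_top"
      by (intro tendsto_intros ah bh)
    then have "((\<lambda>h. (\<bar>a h * h - b h * h\<bar> * L) / (h * \<alpha> h)) \<longlongrightarrow> 0) at_top"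
      by (intro over\<alpha>) simp
    moreover have "\<forall>\<^sub>F h in at_top. (\<bar>a h * h - b h * h\<bar> * L) / (h * \<alpha> h) = e2 h"
      using main
    proof eventually_elim
      case (elim h)
      have "\<bar>a h * h - b h * h\<bar> = \<bar>(a h - b h) * h\<bar>" by (simp add: left_diff_distrib)
      also have "\<dots> = h * \<bar>a h - b h\<bar>" using elim by (simp add: abs_mult)
      finally show ?case using elim by (simp add: e2_def)
    qed
    ultimately show ?thesis by (rule Lim_transform_eventually)
  qed
  have top_prob_L: "((\<lambda>h. a h * h + a h * L) \<longlongrightarrow> c + 0 * L) at_top" and bL: "((\<lambda>h. b h * h + b h * L) \<longlongrightarrow> c + 0 * L) at_top"
    by (intro tendsto_intros ah bh a0 b0)+
  define E1 where "E1 h = exp (a h * h) - exp (- (b h * h))" for h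
  define E2 where "E2 h = exp (a h * h + a h * L) - exp (- (b h * h + b h * L))" for h
  define G1 where "G1 h = exp (a h * h) + exp (- (b h * h + b h * L))" for h
  define G2 where "G2 h = exp (a h * h + a h * L) + exp (- (b h * h))" for h
  have sc: "exp c - exp (- c) = 2 * sinh c" "exp c + exp (- c) = 2 * cosh c"
    by (simp_all add: sinh_def cosh_def)
  have EG: "(E1 \<longlongrightarrow> 2 * sinh c) at_top" "(E2 \<longlongrightarrow> 2 * sinh c) at_top" "(G1 \<longlongrightarrow> 2 * cosh c) at_top" "(G2 \<longlongrightarrow> 2 * cosh c) at_top"
    unfolding sc[symmetric] E1_def E2_def G1_def G2_def
    using top_prob_L bL by (intro tendsto_diff tendsto_add tendsto_exp tendsto_minus ah bh; simp only: mult_zero_left add_0_right)+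
  have sinh0: "sinh c > 0" using c by simp
  have one_minus_B: "((\<lambda>h. 1 - B h) \<longlongrightarrow> 0) at_top"
  proof (rule Lim_null_comparison)
    have q: "((\<lambda>h. \<bar>a h - b h\<bar> * L + r h) \<longlongrightarrow> \<bar>0 - 0\<bar> * L + 3 * (0\<^sup>2 + 0\<^sup>2) * L\<^sup>2) at_top"
      unfolding r_def by (intro tendsto_intros a0 b0)
    show "((\<lambda>h. \<alpha> h * G2 h + (\<bar>a h - b h\<bar> * L + r h)) \<longlongrightarrow> 0) at_top"
      using tendsto_add[OF tendsto_mult[OF \<alpha>0 EG(4)] q] by simp
    show "\<forall>\<^sub>F h in at_top. norm (1 - B h) \<le> \<alpha> h * G2 h + (\<bar>a h - b h\<bar> * L + r h)"
      using main
    proof eventually_elim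
      case (elim h)
      have "A h * G2 h \<le> \<alpha> h * G2 h" using elim by (intro mult_right_mono) (auto simp: G2_def)
      then show ?case using elim unfolding G2_def by simp
    qed
  qed
  \<comment> \<open>Discounting lowers the loss by at most L * (1 - B), which tends to 0 while h *
    \<alpha> does not. So the discounted loss is still h * \<alpha> to first order.\<close>
  define d where "d h = D h / (h * \<alpha> h)" for h
  have d: "(d \<longlongrightarrow> 1) at_top"
  proof (rule tendsto_sandwich)
    have "((\<lambda>h. 1 - L * (1 - B h) / (h * \<alpha> h)) \<longlongrightarrow> 1 - 0) at_top"
      using tendsto_mult_right_zero[OF one_minus_B, of L] by (intro tendsto_intros over\<alpha>)
    then show "((\<lambda>h. 1 - L * (1 - B h) / (h * \<alpha> h)) \<longlongrightarrow> 1) at_top" by simp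
    have "((\<lambda>h. 1 + L / h) \<longlongrightarrow> 1 + 0) at_top" by (intro tendsto_intros inv)
    then show "((\<lambda>h. 1 + L / h) \<longlongrightarrow> 1) at_top" by simp
    show "\<forall>\<^sub>F h in at_top. 1 - L * (1 - B h) / (h * \<alpha> h) \<le> d h"
      using main \<alpha>pos
    proof eventually_elim
      case (elim h)
      then have "(h * \<alpha> h - L * (1 - B h)) / (h * \<alpha> h) \<le> D h / (h * \<alpha> h)"
        by (intro divide_right_mono) (blast | simp)+
      then show ?case using elim by (simp add: d_def diff_divide_distrib)
    qed
    show "\<forall>\<^sub>F h in at_top. d h \<le> 1 + L / h"
      using main \<alpha>pos
    proof eventually_elim
      case (elim h)
      then have "D h / (h * \<alpha> h) \<le> (h + L) * \<alpha> h / (h * \<alpha> h)"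
        by (intro divide_right_mono) (blast | simp)+
      also have "\<dots> = 1 + L / h" using elim by (simp add: field_simps)
      finally show ?case by (simp add: d_def)
    qed
  qed
  have E0: "\<forall>\<^sub>F h in at_top. 0 < E1 h" "\<forall>\<^sub>F h in at_top. 0 < E2 h"
    using order_tendstoD(1)[OF EG(1), of 0] order_tendstoD(1)[OF EG(2), of 0] sinh0 by auto
  \<comment> \<open>Divided by \<alpha>, the two sinh estimates become \<rho> * 2 sinh c = 2 c in
    the limit.\<close>
  define \<rho> where "\<rho> h = A h / \<alpha> h" for h
  have \<rho>: "(\<rho> \<longlongrightarrow> c / sinh c) at_top"
  proof (rule tendsto_sandwich)
    have s: "((\<lambda>h. a h * h + b h * h) \<longlongrightarrow> c + c) at_top" by (intro tendsto_intros ah bh)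
    show "((\<lambda>h. ((a h * h + b h * h) * d h - e1 h) / E2 h) \<longlongrightarrow> c / sinh c) at_top"
      using tendsto_divide[OF tendsto_diff[OF tendsto_mult[OF s d] e1] EG(2)] sinh0 by simp
    show "((\<lambda>h. ((a h * h + b h * h) * d h + e1 h) / E1 h) \<longlongrightarrow> c / sinh c) at_top"
      using tendsto_divide[OF tendsto_add[OF tendsto_mult[OF s d] e1] EG(1)] sinh0 by simp
    have dd: "(a h * h + b h * h) * d h = (a h + b h) * D h / \<alpha> h" if "0 < h" "0 < \<alpha> h" for h
      using that by (simp add: d_def field_simps)
    show "\<forall>\<^sub>F h in at_top. ((a h * h + b h * h) * d h - e1 h) / E2 h \<le> \<rho> h"
      using main \<alpha>pos E0(2)
    proof eventually_elim
      case (elim h)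
      then have "((a h + b h) * D h - r h) / \<alpha> h \<le> A h * E2 h / \<alpha> h"
        by (intro divide_right_mono) (auto simp: E2_def)
      moreover have "(a h * h + b h * h) * d h - e1 h = ((a h + b h) * D h - r h) / \<alpha> h"
        using elim dd[of h] by (simp add: e1_def diff_divide_distrib)
      moreover have "\<rho> h * E2 h = A h * E2 h / \<alpha> h" by (simp add: \<rho>_def)
      ultimately show ?case using elim(3) by (simp only: pos_divide_le_eq)
    qed
    show "\<forall>\<^sub>F h in at_top. \<rho> h \<le> ((a h * h + b h * h) * d h + e1 h) / E1 h"
      using main \<alpha>pos E0(1)
    proof eventually_elim
      case (elim h)
      then have "A h * E1 h / \<alpha> h \<le> ((a h + b h) * D h + r h) / \<alpha> h"
        by (intro divide_right_mono) (auto simp: E1_def)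
      moreover have "(a h * h + b h * h) * d h + e1 h = ((a h + b h) * D h + r h) / \<alpha> h"
        using elim dd[of h] by (simp add: e1_def add_divide_distrib)
      moreover have "\<rho> h * E1 h = A h * E1 h / \<alpha> h" by (simp add: \<rho>_def)
      ultimately show ?case using elim(3) by (simp only: pos_le_divide_eq)
    qed
  qed
  then show "((\<lambda>h. walk_gf M Y (top_at w h) (exp (- lam / h\<^sup>2)) / \<alpha> h) \<longlongrightarrow> c / sinh c) at_top"
    by (simp add: \<rho>_def[abs_def] A_def)
  have half: "u \<le> 2 * v \<Longrightarrow> u / 2 \<le> v" "2 * v \<le> u \<Longrightarrow> v \<le> u / 2" for u v :: real
    by auto
  \<comment> \<open>The cosh estimates give 2 (1 - B) / \<alpha> = \<rho> * 2 cosh c in the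
    limit.\<close>
  have "((\<lambda>h. (1 - B h) / \<alpha> h) \<longlongrightarrow> c * cosh c / sinh c) at_top"
  proof (rule tendsto_sandwich)
    show "((\<lambda>h. (\<rho> h * G1 h - e2 h - e1 h) / 2) \<longlongrightarrow> c * cosh c / sinh c) at_top"
      using tendsto_divide[OF tendsto_diff[OF tendsto_diff[OF tendsto_mult[OF \<rho> EG(3)] e2] e1] tendsto_const[of 2]] by simp
    show "((\<lambda>h. (\<rho> h * G2 h + e2 h + e1 h) / 2) \<longlongrightarrow> c * cosh c / sinh c) at_top"
      using tendsto_divide[OF tendsto_add[OF tendsto_add[OF tendsto_mult[OF \<rho> EG(4)] e2] e1] tendsto_const[of 2]] by simp
    show "\<forall>\<^sub>F h in at_top. (\<rho> h * G1 h - e2 h - e1 h) / 2 \<le> (1 - B h) / \<alpha> h"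
      using main \<alpha>pos
    proof eventually_elim
      case (elim h)
      then have "(A h * G1 h - \<bar>a h - b h\<bar> * L - r h) / \<alpha> h \<le> 2 * (1 - B h) / \<alpha> h"
        by (intro divide_right_mono) (auto simp: G1_def)
      moreover have "(A h * G1 h - \<bar>a h - b h\<bar> * L - r h) / \<alpha> h = \<rho> h * G1 h - e2 h - e1 h"
        by (simp add: e1_def e2_def \<rho>_def diff_divide_distrib)
      ultimately have "\<rho> h * G1 h - e2 h - e1 h \<le> 2 * ((1 - B h) / \<alpha> h)"
        by (simp only: times_divide_eq_right)
      then show ?case by (rule half)
    qed
    show "\<forall>\<^sub>F h in at_top. (1 - B h) / \<alpha> h \<le> (\<rho> h * G2 h + e2 h + e1 h) / 2"
      using main \<alpha>pos
    proof eventually_elim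
      case (elim h)
      then have "2 * (1 - B h) / \<alpha> h \<le> (A h * G2 h + \<bar>a h - b h\<bar> * L + r h) / \<alpha> h"
        by (intro divide_right_mono) (auto simp: G2_def)
      moreover have "(A h * G2 h + \<bar>a h - b h\<bar> * L + r h) / \<alpha> h = \<rho> h * G2 h + e2 h + e1 h"
        by (simp add: e1_def e2_def \<rho>_def add_divide_distrib)
      ultimately have "2 * ((1 - B h) / \<alpha> h) \<le> \<rho> h * G2 h + e2 h + e1 h"
        by (simp only: times_divide_eq_right)
      then show ?case by (rule half)
    qed
  qed
  then show "((\<lambda>h. (1 - walk_gf M Y (hit_at w h) (exp (- lam / h\<^sup>2))) / \<alpha> h) \<longlongrightarrow> c * cosh c / sinh c) at_top"
    by (simp add: B_def)
qed

end

section \<open>Left extrema of a two-sided path\<close>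

definition steps :: "(int \<Rightarrow> real) \<Rightarrow> int \<Rightarrow> nat \<Rightarrow> real" where
  "steps v y i = v (y + int i + 1) - v (y + int i)"

lemma walk_steps: "walk (steps v y) n = v (y + int n) - v y"
  by (induction n) (simp_all add: walk_Suc steps_def add_ac)

definition flip :: "(int \<Rightarrow> real) \<Rightarrow> int \<Rightarrow> real" where
  "flip v j = v (- j)"

text \<open>With \<open>w\<close> false this is a left minimum. With \<open>w\<close> true the
  strict and the weak side are exchanged, which is what a left minimum becomes when the path is read
  from right to left.\<close>

definition hmin :: "bool \<Rightarrow> real \<Rightarrow> (int \<Rightarrow> real) \<Rightarrow> int \<Rightarrow> bool" where
  "hmin w h v y \<longleftrightarrow> (\<exists>\<alpha> \<beta>. \<alpha> < y \<and> y < \<beta> \<and> (\<forall>j. \<alpha> \<le> j \<and> j < y \<longrightarrow> hit w (v j - v y)) \<and>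
     (\<forall>j. y < j \<and> j \<le> \<beta> \<longrightarrow> \<not> hit w (v y - v j)) \<and> v y + h \<le> v \<alpha> \<and> v y + h \<le> v \<beta>)"

lemma left_h_minimum_iff: "left_h_minimum h v y \<longleftrightarrow> hmin False h v y"
proof -
  have "v y < Min (v ` {\<alpha>..y - 1}) \<longleftrightarrow> (\<forall>j. \<alpha> \<le> j \<and> j < y \<longrightarrow> hit False (v j - v y))" if "\<alpha> < y" for \<alpha>
    using that by (subst Min_gr_iff) (auto simp: hit_def)
  moreover have "v y \<le> Min (v ` {y + 1..\<beta>}) \<longleftrightarrow> (\<forall>j. y < j \<and> j \<le> \<beta> \<longrightarrow> \<not> hit False (v y - v j))" if "y < \<beta>" for \<beta>
  proof -
    have "{y + 1..\<beta>} = {y<..\<beta>}" by auto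
    then show ?thesis using that by (auto simp: hit_def not_less)
  qed
  ultimately show ?thesis
    unfolding left_h_minimum_def hmin_def by (intro ex_cong1) blast
qed

lemma hit_not: "hit (\<not> w) e \<longleftrightarrow> \<not> hit w (- e)"
  by (auto simp: hit_def)

lemma hmin_flip: "hmin w h (flip v) (- y) \<longleftrightarrow> hmin (\<not> w) h v y"
proof -
  have imp: "hmin w h (flip v) (- y)" if "hmin (\<not> w) h v y" for w v y
  proof -
    from that obtain \<alpha> \<beta> where a: "\<alpha> < y" "y < \<beta>" "\<And>j. \<alpha> \<le> j \<Longrightarrow> j < y \<Longrightarrow> hit (\<not> w) (v j - v y)"
      "\<And>j. y < j \<Longrightarrow> j \<le> \<beta> \<Longrightarrow> \<not> hit (\<not> w) (v y - v j)" "v y + h \<le> v \<alpha>" "v y + h \<le> v \<beta>"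
      unfolding hmin_def by blast
    show ?thesis
      unfolding hmin_def
    proof (rule exI[of _ "- \<beta>"], rule exI[of _ "- \<alpha>"], intro conjI allI impI)
      fix j assume "- \<beta> \<le> j \<and> j < - y"
      then show "hit w (flip v j - flip v (- y))"
        using a(4)[of "- j"] unfolding hit_not by (simp add: flip_def)
    next
      fix j assume "- y < j \<and> j \<le> - \<alpha>"
      then show "\<not> hit w (flip v (- y) - flip v j)"
        using a(3)[of "- j"] unfolding hit_not by (simp add: flip_def)
    qed (use a in \<open>auto simp: flip_def\<close>)
  qed
  have "flip (flip v) = v" by (simp add: flip_def fun_eq_iff)
  then show ?thesis
    using imp[of w v y] imp[of "\<not> w" "flip v" "- y"] by auto
qed

context
  fixes w :: bool and h :: real
  assumes h: "0 < h"
begin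

text \<open>After a minimum, the next extremum is the peak before the first drawdown of size h. That
  peak is at least h above \<open>y\<close>: the climb that certifies the minimum ends before the
  drawdown, or else the drawdown ends no lower than \<open>y\<close>. Strictly between, a minimum
  would need a fall of h that has not yet happened, and a maximum would have to remain unbeaten
  until such a fall, hence beyond the peak that beats it.\<close>

lemma hmin_next:
  assumes min: "hmin w h v y" and pk: "peak_at w h (steps v y) m"
  shows "0 < m" "hmin w h (\<lambda>j. - v j) (y + int m)"
    and "y < j \<Longrightarrow> j < y + int m \<Longrightarrow> \<not> hmin w h v j"
    and "y < j \<Longrightarrow> j < y + int m \<Longrightarrow> \<not> hmin w h (\<lambda>j. - v j) j"
proof -
  let ?S = "\<lambda>n. v (y + int n) - v y"
  obtain l where l: "m < l" "first_drawdown h (steps v y) l" and lm: "\<And>j. j < m \<Longrightarrow> hit w (?S m - ?S j)"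
     and rm: "\<And>j. m < j \<Longrightarrow> j \<le> l \<Longrightarrow> \<not> hit w (?S j - ?S m)"
    using pk unfolding peak_at_def walk_steps by blast
  obtain i where i: "i < l" "h \<le> ?S i - ?S l" using l(2) unfolding first_drawdown_def walk_steps by blast
  have nodd: "?S i - ?S j < h" if "i < j" "j < l" for i j
    using l(2) that unfolding first_drawdown_def walk_steps by blast
  have top: "?S j \<le> ?S m" if "j \<le> l" for j
  proof (cases "j < m")
    case True
    then show ?thesis using hitD(1)[OF lm[of j]] by simp
  next
    case False
    then show ?thesis using hitD(2)[OF rm[of j]] that by (cases "j = m") auto
  qed
  obtain \<beta>' where b': "y < \<beta>'" "\<And>j. y < j \<Longrightarrow> j \<le> \<beta>' \<Longrightarrow> \<not> hit w (v y - v j)" "v y + h \<le> v \<beta>'"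
    using min unfolding hmin_def by blast
  define \<beta> where "\<beta> = nat (\<beta>' - y)"
  have b: "0 < \<beta>" "h \<le> ?S \<beta>" and br: "\<And>j. 0 < j \<Longrightarrow> j \<le> \<beta> \<Longrightarrow> \<not> hit w (- ?S j)"
  proof -
    show "0 < \<beta>" "h \<le> ?S \<beta>" using b' by (auto simp: \<beta>_def)
    show "\<not> hit w (- ?S j)" if "0 < j" "j \<le> \<beta>" for j
      using b'(2)[of "y + int j"] that b'(1) by (auto simp: \<beta>_def)
  qed
  have Sm: "h \<le> ?S m"
  proof (cases "\<beta> < l")
    case True
    then show ?thesis using top[of \<beta>] b by simp
  next
    case False
    then have "0 \<le> ?S l" using hitD(2)[OF br[of l]] l(1) by simp
    then show ?thesis using top[of i] i by simp
  qed
  show m0: "0 < m" using Sm h by (cases m) auto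
  have dl: "h \<le> ?S m - ?S l" using top[of i] i by simp
  show "hmin w h (\<lambda>j. - v j) (y + int m)"
    unfolding hmin_def
  proof (rule exI[of _ y], rule exI[of _ "y + int l"], intro conjI allI impI)
    fix j assume j: "y \<le> j \<and> j < y + int m"
    then have "nat (j - y) < m" by linarith
    from lm[OF this] show "hit w (- v j - - v (y + int m))"
      using j by simp
  next
    fix j assume j: "y + int m < j \<and> j \<le> y + int l"
    then have "m < nat (j - y)" "nat (j - y) \<le> l" by linarith+
    from rm[OF this] show "\<not> hit w (- v (y + int m) - - v j)"
      using j by simp
  qed (use m0 l Sm dl in auto)
  {
    assume "y < j" "j < y + int m"
    then obtain i where j: "j = y + int i" and i0: "0 < i" "i < m"
      by (intro that[of "nat (j - y)"]) auto
    show "\<not> hmin w h v j"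
    proof
      assume "hmin w h v j"
      then obtain \<alpha> where a: "\<alpha> < j" "\<And>k. \<alpha> \<le> k \<Longrightarrow> k < j \<Longrightarrow> hit w (v k - v j)" "v j + h \<le> v \<alpha>"
        unfolding hmin_def by blast
      show False
      proof (cases "y \<le> \<alpha>")
        case True
        then have "nat (\<alpha> - y) < i" "i < l" using a(1) i0 l(1) by (simp_all add: j)
        from nodd[OF this] show False using a(3) True by (simp add: j)
      next
        case False
        then have hi: "hit w (- ?S i)" using a(2)[of y] i0 by (simp add: j)
        show False
        proof (cases "i \<le> \<beta>")
          case True
          then show False using br i0 hi by blast
        next
          case False
          then show False using nodd[of \<beta> i] b hitD(1)[OF hi] i0 l(1) by simp
        qed
      qed
    qed
    show "\<not> hmin w h (\<lambda>j. - v j) j"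
    proof
      assume "hmin w h (\<lambda>j. - v j) j"
      then obtain b where b: "j < b" "\<And>k. j < k \<Longrightarrow> k \<le> b \<Longrightarrow> \<not> hit w (v k - v j)" "v b \<le> v j - h"
        unfolding hmin_def by force
      have "y + int l \<le> b"
      proof (rule ccontr)
        assume "\<not> y + int l \<le> b"
        then have "i < nat (b - y)" "nat (b - y) < l" using b(1) by (simp_all add: j)
        from nodd[OF this] show False using b(1,3) by (simp add: j)
      qed
      then have "\<not> hit w (v (y + int m) - v j)"
        using b(2)[of "y + int m"] i0 l(1) by (simp add: j)
      then show False using lm[of i] i0 by (simp add: j)
    qed
  }
qed

text \<open>The start \<open>y\<close> is arbitrary. The first peak need only be followed by a fall
  of h, not preceded by a rise, so it may fail to be an extremum; the trough found after it is
  one.\<close>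

lemma ex_hmin:
  assumes p1: "peak_at w h (steps v y) m" and p2: "peak_at w h (steps (\<lambda>j. - v j) (y + int m)) m'"
  shows "hmin w h v (y + int m + int m')"
proof -
  let ?S = "\<lambda>n. v (y + int n) - v y"
  let ?z = "y + int m"
  obtain l where l: "m < l" "first_drawdown h (steps v y) l" and lm: "\<And>j. j < m \<Longrightarrow> hit w (?S m - ?S j)"
     and rm: "\<And>j. m < j \<Longrightarrow> j \<le> l \<Longrightarrow> \<not> hit w (?S j - ?S m)"
    using p1 unfolding peak_at_def walk_steps by blast
  obtain i where i: "i < l" "h \<le> ?S i - ?S l" using l(2) unfolding first_drawdown_def walk_steps by blast
  have nodd: "?S i - ?S j < h" if "i < j" "j < l" for i j
    using l(2) that unfolding first_drawdown_def walk_steps by blast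
  have top: "?S j \<le> ?S m" if "j \<le> l" for j
  proof (cases "j < m")
    case True
    then show ?thesis using hitD(1)[OF lm[of j]] by simp
  next
    case False
    then show ?thesis using hitD(2)[OF rm[of j]] that by (cases "j = m") auto
  qed
  have dl: "v (y + int l) \<le> v ?z - h" using top[of i] i by simp
  let ?U = "\<lambda>n. - v (?z + int n) + v ?z"
  have wU: "walk (steps (\<lambda>j. - v j) ?z) n = ?U n" for n by (simp add: walk_steps)
  obtain l' where l': "m' < l'" "first_drawdown h (steps (\<lambda>j. - v j) ?z) l'" and lm': "\<And>j. j < m' \<Longrightarrow> hit w (?U m' - ?U j)"
     and rm': "\<And>j. m' < j \<Longrightarrow> j \<le> l' \<Longrightarrow> \<not> hit w (?U j - ?U m')"
    using p2 unfolding peak_at_def wU by blast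
  obtain i' where i': "i' < l'" "h \<le> ?U i' - ?U l'" using l'(2) unfolding first_drawdown_def wU by blast
  have top': "?U j \<le> ?U m'" if "j \<le> l'" for j
  proof (cases "j < m'")
    case True
    then show ?thesis using hitD(1)[OF lm'[of j]] by simp
  next
    case False
    then show ?thesis using hitD(2)[OF rm'[of j]] that by (cases "j = m'") auto
  qed
  \<comment> \<open>A rise of h that ended by time \<open>l\<close> would end no higher than the
    first peak, so it would start at least h below that peak and complete a drawdown before
    \<open>l\<close>. Hence the second search sees the whole fall, and the trough is at least h
    below the peak.\<close>
  have ll: "l < m + l'"
  proof (rule ccontr)
    assume n: "\<not> l < m + l'"
    show False
      using nodd[of m "m + i'"] top[of "m + l'"] i' n h
      by (cases "i' = 0") (auto simp: add.assoc)
  qed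
  have "?U (l - m) \<le> ?U m'" by (rule top') (use ll l in simp)
  then have dn: "v (?z + int m') + h \<le> v ?z" using dl l by (simp add: of_nat_diff)
  have m0: "0 < m'" using dn h by (cases m') auto
  have up: "v (?z + int m') + h \<le> v (?z + int l')" using top'[of i'] i' by simp
  show ?thesis
    unfolding hmin_def
  proof (rule exI[of _ ?z], rule exI[of _ "?z + int l'"], intro conjI allI impI)
    fix j assume j: "?z \<le> j \<and> j < ?z + int m'"
    then have "nat (j - ?z) < m'" by linarith
    from lm'[OF this] show "hit w (v j - v (?z + int m'))"
      using j by simp
  next
    fix j assume j: "?z + int m' < j \<and> j \<le> ?z + int l'"
    then have "m' < nat (j - ?z)" "nat (j - ?z) \<le> l'" by linarith+
    from rm'[OF this] show "\<not> hit w (v (?z + int m') - v j)"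
      using j by simp
  qed (use m0 l' dn up in auto)
qed

end

lemma hmin_not_hmax: "0 < h \<Longrightarrow> hmin w h v y \<Longrightarrow> \<not> hmin w h (\<lambda>j. - v j) y"
proof
  assume h: "0 < h" and min: "hmin w h v y" and max: "hmin w h (\<lambda>j. - v j) y"
  obtain a where a: "a < y" "\<And>j. a \<le> j \<Longrightarrow> j < y \<Longrightarrow> hit w (v j - v y)" "v y + h \<le> v a"
    using min unfolding hmin_def by blast
  obtain b where b: "b < y" "\<And>j. b \<le> j \<Longrightarrow> j < y \<Longrightarrow> hit w (v y - v j)" "v b \<le> v y - h"
    using max unfolding hmin_def by force
  show False
  proof (cases "a \<le> b")
    case True
    then show False using a(2)[of b] b h by (auto dest: hitD)
  next
    case False
    then show False using b(2)[of a] a h by (auto dest: hitD)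
  qed
qed

text \<open>A pathwise replacement for the conditions on the lower and upper limits: countably many
  searches for a peak, from every site, in both directions and for both signs, each successful
  almost surely. The searches to the left carry the flag \<open>True\<close> because they run on the
  mirrored path.\<close>

definition oscillating :: "real \<Rightarrow> (int \<Rightarrow> real) \<Rightarrow> bool" where
  "oscillating h v \<longleftrightarrow> (\<forall>y. (\<exists>m. peak_at False h (steps v y) m) \<and> (\<exists>m. peak_at False h (steps (\<lambda>j. - v j) y) m) \<and>
      (\<exists>m. peak_at True h (steps (flip v) y) m) \<and> (\<exists>m. peak_at True h (steps (\<lambda>j. - flip v j) y) m))"

text \<open>Positive elements are listed upwards from index 1 and the others downwards from index 0;
  both lists are infinite. For uniqueness, the condition at 0 fixes the value there, and each
  further value is the adjacent element of the set.\<close>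

lemma ex1_enumeration:
  fixes S :: "int set"
  assumes up: "\<And>n. \<exists>y\<in>S. n < y" and dn: "\<And>n. \<exists>y\<in>S. y < n"
  shows "\<exists>!x :: int \<Rightarrow> int. strict_mono x \<and> range x = S \<and> x 0 \<le> 0 \<and> 0 < x 1"
proof -
  define P where "P = {n::nat. int n + 1 \<in> S}"
  define Q where "Q = {n::nat. - int n \<in> S}"
  have iP: "infinite P"
    unfolding infinite_nat_iff_unbounded
  proof
    fix k :: nat
    obtain y where "y \<in> S" "int k + 1 < y" using up by blast
    then show "\<exists>n>k. n \<in> P" by (intro exI[of _ "nat (y - 1)"]) (auto simp: P_def)
  qed
  have iQ: "infinite Q"
    unfolding infinite_nat_iff_unbounded
  proof
    fix k :: nat
    obtain y where "y \<in> S" "y < - int k" using dn by blast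
    then show "\<exists>n>k. n \<in> Q" by (intro exI[of _ "nat (- y)"]) (auto simp: Q_def)
  qed
  define x where "x k = (if 1 \<le> k then int (enumerate P (nat (k - 1))) + 1 else - int (enumerate Q (nat (- k))))" for k :: int
  have pos: "0 < x k" if "1 \<le> k" for k using that by (simp add: x_def)
  have neg: "x k \<le> 0" if "\<not> 1 \<le> k" for k using that by (simp add: x_def)
  have "strict_mono x"
  proof (rule strict_monoI)
    fix k k' :: int assume k: "k < k'"
    consider "1 \<le> k" | "\<not> 1 \<le> k" "1 \<le> k'" | "\<not> 1 \<le> k'" by blast
    then show "x k < x k'"
    proof cases
      case 1
      then have "nat (k - 1) < nat (k' - 1)" using k by auto
      from enumerate_mono[OF this iP] show ?thesis using 1 k by (simp add: x_def)
    next
      case 2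
      then show ?thesis using pos[of k'] neg[of k] by simp
    next
      case 3
      then have "nat (- k') < nat (- k)" using k by auto
      from enumerate_mono[OF this iQ] show ?thesis using 3 k by (simp add: x_def)
    qed
  qed
  moreover have "range x = S"
  proof
    show "range x \<subseteq> S"
      using enumerate_in_set[OF iP] enumerate_in_set[OF iQ] by (auto simp: x_def P_def Q_def)
    show "S \<subseteq> range x"
    proof
      fix y assume y: "y \<in> S"
      show "y \<in> range x"
      proof (cases "1 \<le> y")
        case True
        then have "nat (y - 1) \<in> P" using y by (simp add: P_def)
        then obtain n where "enumerate P n = nat (y - 1)" using enumerate_Ex[OF iP] by blast
        then have "x (int n + 1) = y" using True by (simp add: x_def)
        then show ?thesis by blast
      next
        case False
        then have "nat (- y) \<in> Q" using y by (simp add: Q_def)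
        then obtain n where "enumerate Q n = nat (- y)" using enumerate_Ex[OF iQ] by blast
        then have "x (- int n) = y" using False by (simp add: x_def)
        then show ?thesis by blast
      qed
    qed
  qed
  moreover have "x 0 \<le> 0" "0 < x 1" using pos[of 1] neg[of 0] by auto
  moreover have "x' = x" if x': "strict_mono x'" "range x' = S" "x' 0 \<le> 0" "0 < x' 1" for x' :: "int \<Rightarrow> int"
  proof -
    note xs = \<open>strict_mono x\<close> \<open>range x = S\<close>
    have le: "y (k + 1) \<le> z (k + 1)" if "strict_mono y" "range y = S" "strict_mono z" "range z = S" "y k = z k"
      for y z :: "int \<Rightarrow> int" and k
    proof -
      have "z (k + 1) \<in> range y" using that by blast
      then obtain j where j: "z (k + 1) = y j" by blast
      have "y k < y j" using that strict_monoD[of z k "k + 1"] j by simp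
      then have "k + 1 \<le> j" using strict_mono_less[OF that(1)] by simp
      then show ?thesis using strict_mono_less_eq[OF that(1)] j by simp
    qed
    have ge: "z (k - 1) \<le> y (k - 1)" if "strict_mono y" "range y = S" "strict_mono z" "range z = S" "y k = z k"
      for y z :: "int \<Rightarrow> int" and k
    proof -
      have "z (k - 1) \<in> range y" using that by blast
      then obtain j where j: "z (k - 1) = y j" by blast
      have "y j < y k" using that strict_monoD[of z "k - 1" k] j by simp
      then have "j \<le> k - 1" using strict_mono_less[OF that(1)] by simp
      then show ?thesis using strict_mono_less_eq[OF that(1)] j by simp
    qed
    have le0: "z 0 \<le> y 0" if "strict_mono y" "range y = S" "strict_mono z" "range z = S" "z 0 \<le> 0" "0 < y 1"
      for y z :: "int \<Rightarrow> int"
    proof -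
      have "z 0 \<in> range y" using that by blast
      then obtain j where j: "z 0 = y j" by blast
      then have "y j < y 1" using that by simp
      then have "j \<le> 0" using strict_mono_less[OF that(1)] by simp
      then show ?thesis using strict_mono_less_eq[OF that(1)] j by simp
    qed
    have "x' k = x k" for k
    proof (induction k rule: int_induct[where k = 0])
      case base
      show ?case
        by (rule antisym[OF le0[OF xs x'(1,2,3) \<open>0 < x 1\<close>] le0[OF x'(1,2) xs \<open>x 0 \<le> 0\<close> x'(4)]])
    next
      case (step1 k)
      show ?case
        by (rule antisym[OF le[OF x'(1,2) xs step1(2)] le[OF xs x'(1,2) step1(2)[symmetric]]])
    next
      case (step2 k)
      show ?case
        by (rule antisym[OF ge[OF xs x'(1,2) step2(2)[symmetric]] ge[OF x'(1,2) xs step2(2)]])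
    qed
    then show ?thesis by (rule ext)
  qed
  ultimately show ?thesis by blast
qed

lemma left_h_extremum_iff: "left_h_extremum h v y \<longleftrightarrow> hmin False h v y \<or> hmin False h (\<lambda>j. - v j) y"
  by (simp add: left_h_extremum_def left_h_maximum_def left_h_minimum_iff)

lemma flip_uminus: "flip (\<lambda>j. - v j) = (\<lambda>j. - flip v j)"
  by (simp add: flip_def fun_eq_iff)

lemma oscillating_unbounded:
  assumes h: "0 < h" and osc: "oscillating h v"
  shows "\<exists>y. hmin False h v y \<and> n < y" "\<exists>y. hmin False h v y \<and> y < n"
proof -
  obtain m where m: "peak_at False h (steps v (n + 1)) m" using osc unfolding oscillating_def by blast
  obtain m' where m': "peak_at False h (steps (\<lambda>j. - v j) (n + 1 + int m)) m'" using osc unfolding oscillating_def by blast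
  show "\<exists>y. hmin False h v y \<and> n < y"
    using ex_hmin[OF h m m'] by (intro exI[of _ "n + 1 + int m + int m'"]) auto
  obtain k where k: "peak_at True h (steps (flip v) (1 - n)) k" using osc unfolding oscillating_def by blast
  obtain k' where k': "peak_at True h (steps (\<lambda>j. - flip v j) (1 - n + int k)) k'" using osc unfolding oscillating_def by blast
  define z where "z = - (1 - n + int k + int k')"
  have "- z = 1 - n + int k + int k'" by (simp add: z_def)
  then have "hmin True h (flip v) (- z)" using ex_hmin[OF h k k'] by (simp only:)
  then have "hmin False h v z" by (simp add: hmin_flip)
  then show "\<exists>y. hmin False h v y \<and> y < n" by (intro exI[of _ z]) (auto simp: z_def)
qed

text \<open>This is \<open>hmin_next\<close> for the mirrored path; the flag \<open>True\<close> of
  the search belongs to the mirrored strictness.\<close>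

lemma hmin_prev:
  assumes h: "0 < h" and min: "hmin False h v y" and pk: "peak_at True h (steps (flip v) (- y)) m"
  shows "hmin False h (\<lambda>j. - v j) (y - int m)" "0 < m"
    and "y - int m < j \<Longrightarrow> j < y \<Longrightarrow> \<not> hmin False h v j"
    and "y - int m < j \<Longrightarrow> j < y \<Longrightarrow> \<not> hmin False h (\<lambda>j. - v j) j"
proof -
  have min': "hmin True h (flip v) (- y)" using min by (simp add: hmin_flip)
  note N = hmin_next[OF h min' pk]
  have f: "hmin True h (\<lambda>j. - flip v j) (- j) \<longleftrightarrow> hmin False h (\<lambda>j. - v j) j" for j
    unfolding flip_uminus[symmetric] by (simp add: hmin_flip)
  have e: "- y + int m = - (y - int m)" by simp
  show "hmin False h (\<lambda>j. - v j) (y - int m)" using N(2) unfolding e f .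
  show "0 < m" by (rule N(1))
  show "\<not> hmin False h v j" if "y - int m < j" "j < y"
    using N(3)[of "- j"] that by (simp add: hmin_flip)
  show "\<not> hmin False h (\<lambda>j. - v j) j" if "y - int m < j" "j < y"
    using N(4)[of "- j"] that by (simp add: f)
qed

lemma h_extrema_enum_consecutive:
  fixes h :: real and v :: "int \<Rightarrow> real"
  assumes "\<And>n. \<exists>y. n < y \<and> left_h_extremum h v y" "\<And>n. \<exists>y. y < n \<and> left_h_extremum h v y"
  defines "X \<equiv> h_extrema_enum v h"
  shows "X 0 \<le> 0" "0 < X 1" "left_h_extremum h v (X 0)" "left_h_extremum h v (X 1)"
    and "\<And>y. left_h_extremum h v y \<Longrightarrow> y \<le> X 0 \<or> X 1 \<le> y"
proof -
  let ?E = "{y. left_h_extremum h v y}"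
  have "\<exists>!x :: int \<Rightarrow> int. strict_mono x \<and> range x = ?E \<and> x 0 \<le> 0 \<and> 0 < x 1"
    by (rule ex1_enumeration) (use assms in auto)
  from theI'[OF this] have X: "strict_mono X" "range X = ?E" "X 0 \<le> 0" "0 < X 1"
    unfolding X_def h_extrema_enum_def by auto
  show "X 0 \<le> 0" "0 < X 1" by fact+
  show "left_h_extremum h v (X 0)" "left_h_extremum h v (X 1)" using X(2) by auto
  show "y \<le> X 0 \<or> X 1 \<le> y" if "left_h_extremum h v y" for y
  proof -
    have "y \<in> range X" using that unfolding X(2) by simp
    then obtain k where k: "y = X k" by blast
    have "k \<le> 0 \<or> 1 \<le> k" by linarith
    then show ?thesis using strict_mono_less_eq[OF X(1)] k by auto
  qed
qed

text \<open>The enumeration disappears: a minimum is the chosen one exactly when the neighbouring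
  maximum on the side of the origin lies beyond the origin. For x \<le> 0 this is the next extremum
  x + m > 0. For x > 0 it is the previous one x - m \<le> 0; as it is a maximum at index 0, the
  definition passes on to index 1.\<close>

lemma b_bottom_iff:
  assumes h: "0 < h" and osc: "oscillating h v"
  shows "b_bottom h v = x \<longleftrightarrow> hmin False h v x \<and>
    (if x \<le> 0 then \<exists>m. peak_at False h (steps v x) m \<and> 0 < x + int m
     else \<exists>m. peak_at True h (steps (flip v) (- x)) m \<and> x \<le> int m)"
proof -
  define X where "X = h_extrema_enum v h"
  have "\<exists>y. n < y \<and> left_h_extremum h v y" "\<exists>y. y < n \<and> left_h_extremum h v y" for n
    using oscillating_unbounded[OF h osc, of n] by (auto simp: left_h_extremum_iff)
  note enum = h_extrema_enum_consecutive[OF this, folded X_def]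
  note X = enum(1,2) and ext = enum(3,4) and between = enum(5)
  have b: "b_bottom h v = (if hmin False h v (X 0) then X 0 else X 1)"
    by (simp add: b_bottom_def X_def left_h_minimum_iff)
  have alt: "hmin False h v (X 1)" if "\<not> hmin False h v (X 0)"
  proof -
    have mx: "hmin False h (\<lambda>j. - v j) (X 0)" using that ext by (simp add: left_h_extremum_iff)
    obtain m where m: "peak_at False h (steps (\<lambda>j. - v j) (X 0)) m" using osc unfolding oscillating_def by blast
    note N = hmin_next[OF h mx m]
    have "hmin False h v (X 0 + int m)" using N(2) by simp
    moreover have "X 0 + int m = X 1"
    proof (rule antisym)
      show "X 0 + int m \<le> X 1"
      proof (rule ccontr)
        assume "\<not> X 0 + int m \<le> X 1"
        then show False using N(3,4)[of "X 1"] ext(2) X by (auto simp: left_h_extremum_iff)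
      qed
      show "X 1 \<le> X 0 + int m"
        using between[of "X 0 + int m"] calculation N(1) by (auto simp: left_h_extremum_iff)
    qed
    ultimately show ?thesis by simp
  qed
  show ?thesis
  proof
    assume bx: "b_bottom h v = x"
    show "hmin False h v x \<and> (if x \<le> 0 then \<exists>m. peak_at False h (steps v x) m \<and> 0 < x + int m
     else \<exists>m. peak_at True h (steps (flip v) (- x)) m \<and> x \<le> int m)"
    proof (cases "hmin False h v (X 0)")
      case True
      then have x: "x = X 0" using bx b by simp
      obtain m where m: "peak_at False h (steps v x) m" using osc unfolding oscillating_def by blast
      have "left_h_extremum h v (x + int m)" "0 < m" using hmin_next(1,2)[OF h True[folded x] m] by (auto simp: left_h_extremum_iff)
      then have "X 1 \<le> x + int m" using between[of "x + int m"] x by auto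
      then show ?thesis using True x m X by auto
    next
      case False
      then have x: "x = X 1" using bx b by simp
      have mn: "hmin False h v x" using alt[OF False] x by simp
      obtain m where m: "peak_at True h (steps (flip v) (- x)) m" using osc unfolding oscillating_def by blast
      have "left_h_extremum h v (x - int m)" "0 < m" using hmin_prev(1,2)[OF h mn m] by (auto simp: left_h_extremum_iff)
      then have "x - int m \<le> X 0" using between[of "x - int m"] x by auto
      then show ?thesis using mn x m X by auto
    qed
  next
    assume R: "hmin False h v x \<and> (if x \<le> 0 then \<exists>m. peak_at False h (steps v x) m \<and> 0 < x + int m
     else \<exists>m. peak_at True h (steps (flip v) (- x)) m \<and> x \<le> int m)"
    then have mn: "hmin False h v x" by simp
    then have ex: "left_h_extremum h v x" by (simp add: left_h_extremum_iff)
    show "b_bottom h v = x"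
    proof (cases "x \<le> 0")
      case True
      then obtain m where m: "peak_at False h (steps v x) m" "0 < x + int m" using R by auto
      have "x = X 0"
      proof (rule ccontr)
        assume "x \<noteq> X 0"
        then have "x < X 0" using between[OF ex] True X by auto
        then show False using hmin_next(3,4)[OF h mn m(1), of "X 0"] m(2) X(1) ext(1) by (auto simp: left_h_extremum_iff)
      qed
      then show ?thesis using b mn by simp
    next
      case False
      then obtain m where m: "peak_at True h (steps (flip v) (- x)) m" "x \<le> int m" using R by auto
      note P = hmin_prev[OF h mn m(1)]
      have x1: "x = X 1"
      proof (rule ccontr)
        assume "x \<noteq> X 1"
        then have "X 1 < x" using between[OF ex] False X by auto
        then show False using P(3,4)[of "X 1"] m(2) X(2) ext(2) by (auto simp: left_h_extremum_iff)
      qed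
      have "left_h_extremum h v (x - int m)" using P(1) by (simp add: left_h_extremum_iff)
      then have "x - int m \<le> X 0" using between[of "x - int m"] m(2) X(2) by auto
      moreover have "\<not> x - int m < X 0"
      proof
        assume "x - int m < X 0"
        then show False using P(3,4)[of "X 0"] X x1 ext(1) by (auto simp: left_h_extremum_iff)
      qed
      ultimately have "X 0 = x - int m" by simp
      then have "\<not> hmin False h v (X 0)" using hmin_not_hmax[OF h, of False v "X 0"] P(1) by auto
      then show ?thesis using b x1 by simp
    qed
  qed
qed

section \<open>Limits of the tails\<close>

text \<open>Summation by parts. It is applied to the peak and drawdown times and, on each half-line,
  to the law of the bottom.\<close>

lemma tail_generating_function:
  fixes p W :: "nat \<Rightarrow> real"
  assumes W: "\<And>n. W n = W (Suc n) + p (Suc n)" and tot: "tot = W 0 + p 0"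
    and sm: "summable (\<lambda>n. W n * x ^ n)"
  shows "(\<lambda>n. p n * x ^ n) sums (tot - (1 - x) * (\<Sum>n. W n * x ^ n))"
proof -
  let ?S = "\<Sum>n. W n * x ^ n"
  have S: "(\<lambda>n. W n * x ^ n) sums ?S" using sm by (rule summable_sums)
  then have S1: "(\<lambda>n. W (Suc n) * x ^ Suc n) sums (?S - W 0)"
    by (subst sums_Suc_iff) simp
  have D: "(\<lambda>n. x * (W n * x ^ n) - W (Suc n) * x ^ Suc n) sums (x * ?S - (?S - W 0))"
    by (intro sums_diff sums_mult S S1)
  have T: "x * (W n * x ^ n) - W (Suc n) * x ^ Suc n = p (Suc n) * x ^ Suc n" for n
    using W[of n] by (simp add: algebra_simps)
  have "(\<lambda>n. p n * x ^ n) sums (x * ?S - (?S - W 0) + p 0 * x ^ 0)"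
    by (rule sums_Suc[OF D[unfolded T]])
  then show ?thesis unfolding tot by (simp add: algebra_simps)
qed

lemma (in prob_space) tail_event_split:
  fixes Q :: "nat \<Rightarrow> 'a \<Rightarrow> bool"
  assumes Q: "\<And>k. {s \<in> space M. Q k s} \<in> events" and ex: "\<And>s k k'. Q k s \<Longrightarrow> Q k' s \<Longrightarrow> k = k'"
  shows "prob {s \<in> space M. \<exists>k>n. Q k s} = prob {s \<in> space M. \<exists>k>Suc n. Q k s} + prob {s \<in> space M. Q (Suc n) s}"
    and "prob {s \<in> space M. \<exists>k. Q k s} = prob {s \<in> space M. \<exists>k>0. Q k s} + prob {s \<in> space M. Q 0 s}"
proof -
  let ?T = "\<lambda>n. {s \<in> space M. \<exists>k>n. Q k s}" and ?P = "\<lambda>n. {s \<in> space M. Q n s}"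
  have "?T n = (\<Union>k\<in>{n<..}. ?P k)" for n by auto
  then have ev: "?T n \<in> events" "?P n \<in> events" for n using Q by auto
  have disj: "?T n \<inter> ?P n = {}" for n using ex by blast
  have "(\<exists>m>n. P m) \<longleftrightarrow> (\<exists>m>Suc n. P m) \<or> P (Suc n)" for P
    by (metis Suc_lessD Suc_lessI lessI)
  note this[of "\<lambda>k. Q k s" for s]
  then have eq: "?T n = ?T (Suc n) \<union> ?P (Suc n)"
    by (intro set_eqI) (simp only: Un_iff mem_Collect_eq conj_disj_distribL)
  show "prob (?T n) = prob (?T (Suc n)) + prob (?P (Suc n))"
    unfolding eq by (rule finite_measure_Union[OF ev disj])
  have "(\<exists>k. P k) \<longleftrightarrow> (\<exists>m>0. P m) \<or> P 0" for P :: "nat \<Rightarrow> bool"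
    by (metis gr0I)
  note this[of "\<lambda>k. Q k s" for s]
  then have eq: "{s \<in> space M. \<exists>k. Q k s} = ?T 0 \<union> ?P 0"
    by (intro set_eqI) (simp only: Un_iff mem_Collect_eq conj_disj_distribL)
  show "prob {s \<in> space M. \<exists>k. Q k s} = prob (?T 0) + prob (?P 0)"
    unfolding eq by (rule finite_measure_Union[OF ev disj])
qed

text \<open>Distribution function of masses \<open>p m\<close> placed at \<open>\<xi> m\<close>,
  with a strict inequality. For \<open>\<xi> m\<close> = exp (- m / h^2) and x = exp (- n / h^2) it
  is the mass of all m > n: the decreasing change of variable turns tails into distribution
  functions.\<close>

definition step_cdf :: "(nat \<Rightarrow> real) \<Rightarrow> (nat \<Rightarrow> real) \<Rightarrow> real \<Rightarrow> real" where
  "step_cdf p \<xi> x = (\<Sum>m. p m * indicator {\<xi> m<..} x)"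

context
  fixes p \<xi> :: "nat \<Rightarrow> real"
  assumes p: "\<And>m. 0 \<le> p m" and tot: "p sums 1" and \<xi>: "\<And>m. \<xi> m \<in> {0..1}"
begin

lemma step_cdf_sums: "(\<lambda>m. p m * indicator {\<xi> m<..} x) sums step_cdf p \<xi> x"
  unfolding step_cdf_def
proof (intro summable_sums summable_comparison_test'[OF sums_summable[OF tot]])
  show "norm (p n * indicator {\<xi> n<..} x) \<le> p n" for n
    using p[of n] by (simp add: indicator_def)
qed

lemma step_cdf_mono: "mono_on {0..1} (step_cdf p \<xi>)"
  by (rule mono_onI, rule sums_le[OF _ step_cdf_sums step_cdf_sums])
     (use p in \<open>auto simp: indicator_def\<close>)

lemma step_cdf_range: "step_cdf p \<xi> x \<in> {0..1}"
proof -
  have "0 \<le> step_cdf p \<xi> x"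
    by (rule sums_le[OF _ sums_zero step_cdf_sums]) (use p in auto)
  moreover have "step_cdf p \<xi> x \<le> 1"
    by (rule sums_le[OF _ step_cdf_sums tot]) (use p in \<open>auto simp: indicator_def\<close>)
  ultimately show ?thesis by simp
qed

text \<open>An atom at \<xi> contributes the integral of x^k from \<xi> to 1, so the k-th moment of
  the function encodes the moment k + 1 of the masses. For atoms at exp (- m / h^2) the latter is a
  generating function at exp (- (k + 1) / h^2).\<close>

lemma step_cdf_moment:
  assumes S: "(\<lambda>m. p m * \<xi> m ^ Suc k) sums S"
  shows "integral {0..1} (\<lambda>x. x ^ k * step_cdf p \<xi> x) = (1 - S) / real (Suc k)"
proof -
  define f where "f N x = (\<Sum>m<N. p m * (indicator {\<xi> m<..} x * x ^ k))" for N and x :: real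
  have one: "((\<lambda>x. indicator {\<xi> m<..} x * x ^ k) has_integral ((1 - \<xi> m ^ Suc k) / real (Suc k))) {0..1}" for m
  proof -
    have "((\<lambda>x. x ^ k) has_integral (1 ^ Suc k / real (Suc k) - \<xi> m ^ Suc k / real (Suc k))) {\<xi> m..1}"
    proof (rule fundamental_theorem_of_calculus)
      show "((\<lambda>x. x ^ Suc k / real (Suc k)) has_vector_derivative x ^ k) (at x within {\<xi> m..1})" for x
        using DERIV_cdivide[OF DERIV_pow[of "Suc k" x "{\<xi> m..1}"], of "real (Suc k)"]
        by (simp add: has_real_derivative_iff_has_vector_derivative del: of_nat_Suc power_Suc)
    qed (use \<xi>[of m] in auto)
    then have "((\<lambda>x. if x \<in> {\<xi> m..1} then x ^ k else 0) has_integral ((1 - \<xi> m ^ Suc k) / real (Suc k))) {0..1}"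
      using \<xi>[of m] by (subst has_integral_restrict) (auto simp: diff_divide_distrib)
    then show ?thesis
      by (rule has_integral_spike_finite[of "{\<xi> m}", rotated 2]) (auto simp: indicator_def)
  qed
  have fint: "(f N has_integral (\<Sum>m<N. p m * ((1 - \<xi> m ^ Suc k) / real (Suc k)))) {0..1}" for N
    unfolding f_def[abs_def] by (intro has_integral_sum has_integral_mult_right one) auto
  have lim: "(\<lambda>N. f N x) \<longlonglongrightarrow> x ^ k * step_cdf p \<xi> x" for x
  proof -
    have "(\<lambda>m. x ^ k * (p m * indicator {\<xi> m<..} x)) sums (x ^ k * step_cdf p \<xi> x)"
      by (rule sums_mult[OF step_cdf_sums])
    then show ?thesis by (simp add: sums_def f_def mult_ac)
  qed
  have "(\<lambda>N. integral {0..1} (f N)) \<longlonglongrightarrow> integral {0..1} (\<lambda>x. x ^ k * step_cdf p \<xi> x)"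
  proof (rule dominated_convergence(2))
    show "f N integrable_on {0..1}" for N using fint by blast
    show "(\<lambda>_::real. 1 :: real) integrable_on {0..1}"
      by (intro integrable_continuous_interval continuous_intros)
    show "norm (f N x) \<le> 1" if "x \<in> {0..1}" for N x
    proof -
      have nn: "0 \<le> f N x" unfolding f_def using p that by (intro sum_nonneg mult_nonneg_nonneg) auto
      have "f N x \<le> (\<Sum>m<N. p m)"
        unfolding f_def using p that
        by (intro sum_mono mult_left_le) (auto simp: indicator_def power_le_one)
      also have "\<dots> \<le> 1"
        using sum_le_suminf[OF sums_summable[OF tot], of "{..<N}"] p sums_unique[OF tot] by auto
      finally show ?thesis using nn by simp
    qed
    show "(\<lambda>N. f N x) \<longlonglongrightarrow> x ^ k * step_cdf p \<xi> x" if "x \<in> {0..1}" for x by (rule lim)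
  qed
  moreover have "(\<lambda>N. integral {0..1} (f N)) \<longlonglongrightarrow> (1 - S) / real (Suc k)"
  proof -
    have "(\<lambda>m. (p m - p m * \<xi> m ^ Suc k) / real (Suc k)) sums ((1 - S) / real (Suc k))"
      by (intro sums_divide sums_diff tot S)
    moreover have "(p m - p m * \<xi> m ^ Suc k) / real (Suc k) = p m * ((1 - \<xi> m ^ Suc k) / real (Suc k))" for m
      by (simp add: right_diff_distrib)
    ultimately show ?thesis
      unfolding integral_unique[OF fint] sums_def by simp
  qed
  ultimately show ?thesis by (rule LIMSEQ_unique)
qed

end

context iid_walk
begin

lemma top_gf_pos:
  assumes h: "0 < h"
  shows "0 < walk_gf M Y (top_at w h) 1"
proof -
  note H = hit_loss_bounds[OF h, of 1 w]
  have "0 < 2 * L * hit_loss w h 1" using H(7) sigma_pos by (simp add: less_le_trans[of 0 "\<sigma>\<^sup>2"])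
  then have "0 < hit_loss w h 1" using L_pos by (simp add: zero_less_mult_iff)
  then have "0 < (h + L) * walk_gf M Y (top_at w h) 1" using H(2) by simp
  then show ?thesis using h L_pos by (simp add: zero_less_mult_iff)
qed

lemma hit_gf_less_1:
  assumes h: "0 < h" and x: "0 \<le> x" "x \<le> 1"
  shows "walk_gf M Y (hit_at w h) x < 1"
  using top_gf_pos[OF h, of w] exit_gf_1[OF h, of w]
    walk_gf_mono[OF x exclusive_hit_at(1)[of w h] measurable_hit_at] by linarith

lemma peak_gf_eq:
  assumes h: "0 < h" and x: "0 \<le> x" "x \<le> 1"
  shows "walk_gf M Y (peak_at w h) x = walk_gf M (\<lambda>i s. - Y i s) (top_at w h) 1 / (1 - walk_gf M (\<lambda>i s. - Y i s) (hit_at w h) x)"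
proof -
  interpret N: iid_walk M "\<lambda>i s. - Y i s" L \<sigma> by (rule iid_walk_uminus)
  show ?thesis
    using peak_gf[OF h x, of w] N.hit_gf_less_1[OF h x, of w] by (simp add: field_simps)
qed

lemma first_drawdown_gf_eq:
  assumes h: "0 < h" and x: "0 \<le> x" "x \<le> 1"
  shows "walk_gf M Y (first_drawdown h) x = walk_gf M (\<lambda>i s. - Y i s) (top_at w h) x / (1 - walk_gf M (\<lambda>i s. - Y i s) (hit_at w h) x)"
proof -
  interpret N: iid_walk M "\<lambda>i s. - Y i s" L \<sigma> by (rule iid_walk_uminus)
  show ?thesis
    using first_drawdown_gf[OF h x, of w] N.hit_gf_less_1[OF h x, of w] by (simp add: field_simps)
qed

text \<open>Bottom and top exits exhaust all cases, so at 1 the renewal quotients equal 1. Peaks and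
  drawdowns thus occur almost surely, which later yields the oscillation of the potential.\<close>

lemma total_gf:
  assumes h: "0 < h"
  shows "walk_gf M Y (peak_at w h) 1 = 1" "walk_gf M Y (first_drawdown h) 1 = 1"
    "walk_gf M Y (valley_peak_at w h) 1 = walk_gf M Y (top_at w h) 1"
proof -
  interpret N: iid_walk M "\<lambda>i s. - Y i s" L \<sigma> by (rule iid_walk_uminus)
  have e: "1 - walk_gf M (\<lambda>i s. - Y i s) (hit_at w h) 1 = walk_gf M (\<lambda>i s. - Y i s) (top_at w h) 1" for w
    using N.exit_gf_1[OF h, of w] by simp
  show 1: "walk_gf M Y (peak_at w h) 1 = 1"
    using N.top_gf_pos[OF h, of w] unfolding peak_gf_eq[OF h zero_le_one order_refl] e by simp
  show "walk_gf M Y (first_drawdown h) 1 = 1"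
    using N.top_gf_pos[OF h, of w] unfolding first_drawdown_gf_eq[OF h zero_le_one order_refl, of w] e by simp
  show "walk_gf M Y (valley_peak_at w h) 1 = walk_gf M Y (top_at w h) 1"
    using valley_peak_gf[OF h, of 1 w] 1 by simp
qed

text \<open>\<open>?A\<close> belongs to the climb, \<open>?A'\<close> and \<open>?B'\<close> to the
  negated walk that describes falls. Each is measured in units of the exit probability of its own
  walk; these units cancel, and c / sinh c divided by c cosh c / sinh c is 1 / cosh c.\<close>

lemma gf_laplace:
  fixes lam :: real
  assumes lam: "0 < lam"
  defines "c \<equiv> sqrt (2 * lam) / \<sigma>"
  shows "((\<lambda>h. walk_gf M Y (valley_peak_at w h) (exp (- lam / h\<^sup>2)) / walk_gf M Y (top_at w h) 1) \<longlongrightarrow> 1 / cosh c) at_top"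
    and "((\<lambda>h. walk_gf M Y (first_drawdown h) (exp (- lam / h\<^sup>2))) \<longlongrightarrow> 1 / cosh c) at_top"
proof -
  interpret N: iid_walk M "\<lambda>i s. - Y i s" L \<sigma> by (rule iid_walk_uminus)
  let ?x = "\<lambda>h. exp (- lam / h\<^sup>2)"
  let ?A = "\<lambda>h. walk_gf M Y (top_at w h)" and ?A' = "\<lambda>h. walk_gf M (\<lambda>i s. - Y i s) (top_at w h)"
    and ?B' = "\<lambda>h. walk_gf M (\<lambda>i s. - Y i s) (hit_at w h)"
  have c: "0 < c" using lam sigma_pos by (simp add: c_def)
  have sc: "sinh c > 0" "cosh c > 0" using c by auto
  note E = exit_asymptotics[OF lam, folded c_def] and E' = N.exit_asymptotics[OF lam, folded c_def]
  have nz: "c * cosh c / sinh c \<noteq> 0" using c sc by simp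
  have q: "c / sinh c / (c * cosh c / sinh c) = 1 / cosh c" using c sc by simp
  have x: "0 \<le> ?x h" "?x h \<le> 1" for h using lam by auto
  show "((\<lambda>h. walk_gf M Y (valley_peak_at w h) (?x h) / ?A h 1) \<longlongrightarrow> 1 / cosh c) at_top"
  proof (rule Lim_transform_eventually)
    show "((\<lambda>h. (?A h (?x h) / ?A h 1) / ((1 - ?B' h (?x h)) / ?A' h 1)) \<longlongrightarrow> 1 / cosh c) at_top"
      using tendsto_divide[OF E(1)[of w] E'(2)[of w] nz] unfolding q .
    show "\<forall>\<^sub>F h in at_top. (?A h (?x h) / ?A h 1) / ((1 - ?B' h (?x h)) / ?A' h 1)
        = walk_gf M Y (valley_peak_at w h) (?x h) / ?A h 1"
      using eventually_gt_at_top[of 0]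
    proof eventually_elim
      case (elim h)
      show ?case
        unfolding valley_peak_gf[OF elim x[of h]] peak_gf_eq[OF elim x[of h]] by simp
    qed
  qed
  show "((\<lambda>h. walk_gf M Y (first_drawdown h) (?x h)) \<longlongrightarrow> 1 / cosh c) at_top"
  proof (rule Lim_transform_eventually)
    show "((\<lambda>h. (?A' h (?x h) / ?A' h 1) / ((1 - ?B' h (?x h)) / ?A' h 1)) \<longlongrightarrow> 1 / cosh c) at_top"
      using tendsto_divide[OF E'(1)[of w] E'(2)[of w] nz] unfolding q .
    show "\<forall>\<^sub>F h in at_top. (?A' h (?x h) / ?A' h 1) / ((1 - ?B' h (?x h)) / ?A' h 1)
        = walk_gf M Y (first_drawdown h) (?x h)"
      using eventually_gt_at_top[of 0]
    proof eventually_elim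
      case (elim h)
      show ?case
        unfolding first_drawdown_gf_eq[OF elim x[of h], of w] using N.top_gf_pos[OF elim, of w] by simp
    qed
  qed
qed

definition tail_prob :: "((nat \<Rightarrow> real) \<Rightarrow> nat \<Rightarrow> bool) \<Rightarrow> nat \<Rightarrow> real" where
  "tail_prob Q n = walk_prob M Y (\<lambda>y. \<exists>m>n. Q y m)"

lemma tail_prob_Suc:
  assumes [measurable]: "\<And>k. Measurable.pred seq_space (\<lambda>y. Q y k)" and ex: "exclusive Q"
  shows "tail_prob Q n = tail_prob Q (Suc n) + walk_prob M Y (\<lambda>y. Q y (Suc n))"
    and "walk_prob M Y (\<lambda>y. \<exists>k. Q y k) = tail_prob Q 0 + walk_prob M Y (\<lambda>y. Q y 0)"
proof -
  have ev: "{s \<in> space M. Q (\<lambda>i. Y i s) k} \<in> events" for k by measurable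
  note T = tail_event_split[where Q = "\<lambda>k s. Q (\<lambda>i. Y i s) k", OF ev exclusiveD[OF ex]]
  show "tail_prob Q n = tail_prob Q (Suc n) + walk_prob M Y (\<lambda>y. Q y (Suc n))"
    unfolding tail_prob_def walk_prob_def by (rule T(1))
  show "walk_prob M Y (\<lambda>y. \<exists>k. Q y k) = tail_prob Q 0 + walk_prob M Y (\<lambda>y. Q y 0)"
    unfolding tail_prob_def walk_prob_def by (rule T(2))
qed

lemma tail_prob_gf:
  assumes Q: "\<And>k. Measurable.pred seq_space (\<lambda>y. Q y k)" and ex: "exclusive Q" and x: "0 \<le> x" "x < 1"
  shows "summable (\<lambda>n. tail_prob Q n * x ^ n)"
    and "(1 - x) * (\<Sum>n. tail_prob Q n * x ^ n) = walk_gf M Y Q 1 - walk_gf M Y Q x"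
proof -
  show s: "summable (\<lambda>n. tail_prob Q n * x ^ n)"
  proof (rule summable_comparison_test')
    show "summable (\<lambda>n. x ^ n)" using x by (intro summable_geometric) auto
    show "norm (tail_prob Q n * x ^ n) \<le> x ^ n" for n
      using x walk_prob_range[of "\<lambda>y. \<exists>m>n. Q y m"] by (simp add: tail_prob_def abs_mult mult_left_le_one_le)
  qed
  have "(\<lambda>n. walk_prob M Y (\<lambda>y. Q y n) * x ^ n) sums (walk_prob M Y (\<lambda>y. \<exists>k. Q y k) - (1 - x) * (\<Sum>n. tail_prob Q n * x ^ n))"
    by (rule tail_generating_function[OF tail_prob_Suc[OF Q ex] s])
  then have "walk_gf M Y Q x = walk_prob M Y (\<lambda>y. \<exists>k. Q y k) - (1 - x) * (\<Sum>n. tail_prob Q n * x ^ n)"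
    unfolding walk_gf_def by (rule sums_unique[symmetric])
  then show "(1 - x) * (\<Sum>n. tail_prob Q n * x ^ n) = walk_gf M Y Q 1 - walk_gf M Y Q x"
    using walk_gf_1[OF Q ex] by simp
qed

text \<open>The conditional law of the peak time, given that the climb by h succeeds.\<close>

definition peak_weight :: "bool \<Rightarrow> real \<Rightarrow> nat \<Rightarrow> real" where
  "peak_weight w h m = walk_prob M Y (\<lambda>y. valley_peak_at w h y m) / walk_gf M Y (top_at w h) 1"

lemma peak_weight:
  assumes h: "0 < h"
  shows "0 \<le> peak_weight w h m" "peak_weight w h sums 1"
    "0 \<le> x \<Longrightarrow> x \<le> 1 \<Longrightarrow> (\<lambda>m. peak_weight w h m * x ^ m) sums (walk_gf M Y (valley_peak_at w h) x / walk_gf M Y (top_at w h) 1)"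
proof -
  note A = top_gf_pos[OF h, of w]
  show "0 \<le> peak_weight w h m"
    unfolding peak_weight_def by (intro divide_nonneg_nonneg walk_prob_range less_imp_le[OF A])
  show s: "(\<lambda>m. peak_weight w h m * x ^ m) sums (walk_gf M Y (valley_peak_at w h) x / walk_gf M Y (top_at w h) 1)"
    if "0 \<le> x" "x \<le> 1" for x
  proof -
    have "(\<lambda>m. walk_prob M Y (\<lambda>y. valley_peak_at w h y m) * x ^ m) sums walk_gf M Y (valley_peak_at w h) x"
      by (rule walk_gf_sums[where Q = "valley_peak_at w h", OF measurable_valley_peak_at exclusive_valley_peak_at that])
    then show ?thesis
      unfolding peak_weight_def times_divide_eq_left by (rule sums_divide)
  qed
  show "peak_weight w h sums 1"
    using s[OF zero_le_one order_refl] A by (simp add: total_gf[OF h])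
qed

text \<open>The moments are transforms at the integers k + 1, whose limits \<open>gf_laplace\<close>
  gives and \<open>limit_cdf_moment\<close> recognises. The identity for h \<le> 0 keeps every
  member of the family monotone with values in [0, 1], as the moment theorem demands for all
  h.\<close>

lemma peak_cdf_limit:
  "uniform_limit {0..1} (\<lambda>h x. if 0 < h then step_cdf (peak_weight w h) (\<lambda>m. exp (- real m / h\<^sup>2)) x else x)
     (limit_cdf (\<sigma>\<^sup>2)) at_top"
proof (rule moments_uniform_convergence)
  let ?x = "\<lambda>h m. exp (- real m / h\<^sup>2)"
  have x01: "?x h m \<in> {0..1}" for h :: real and m by simp
  have s2: "0 < \<sigma>\<^sup>2" using sigma_pos by simp
  note S = peak_weight(1,2)
  show "mono_on {0..1} (\<lambda>x. if 0 < h then step_cdf (peak_weight w h) (?x h) x else x)" for h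
  proof (cases "0 < h")
    case True
    then show ?thesis using step_cdf_mono[OF S[OF True], of "?x h"] x01 by simp
  qed (simp add: mono_on_def)
  show "(if 0 < h then step_cdf (peak_weight w h) (?x h) x else x) \<in> {0..1}" if "x \<in> {0..1}" for h x
  proof (cases "0 < h")
    case True
    then show ?thesis using step_cdf_range[OF S[OF True], of "?x h"] x01 by simp
  qed (use that in simp)
  show "continuous_on {0..1} (limit_cdf (\<sigma>\<^sup>2))" "limit_cdf (\<sigma>\<^sup>2) 0 = 0" "limit_cdf (\<sigma>\<^sup>2) 1 = 1"
    using continuous_on_limit_cdf[OF s2] limit_cdf_0[OF s2] limit_cdf_1[OF s2] by auto
  fix k :: nat
  have g: "integral {0..1} (\<lambda>x. x ^ k * limit_cdf (\<sigma>\<^sup>2) x) = (1 - 1 / cosh (sqrt (2 * real (Suc k)) / \<sigma>)) / real (Suc k)"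
    using integral_unique[OF limit_cdf_moment[OF s2, of "Suc k"]] sigma_pos by (simp add: real_sqrt_divide)
  have "((\<lambda>h. (1 - walk_gf M Y (valley_peak_at w h) (exp (- real (Suc k) / h\<^sup>2)) / walk_gf M Y (top_at w h) 1) / real (Suc k))
     \<longlongrightarrow> (1 - 1 / cosh (sqrt (2 * real (Suc k)) / \<sigma>)) / real (Suc k)) at_top"
    by (intro tendsto_divide tendsto_diff tendsto_const gf_laplace(1)) auto
  moreover have "\<forall>\<^sub>F h in at_top. (1 - walk_gf M Y (valley_peak_at w h) (exp (- real (Suc k) / h\<^sup>2)) / walk_gf M Y (top_at w h) 1) / real (Suc k)
     = integral {0..1} (\<lambda>x. x ^ k * (if 0 < h then step_cdf (peak_weight w h) (?x h) x else x))"
    using eventually_gt_at_top[of 0]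
  proof eventually_elim
    case (elim h)
    have "(\<lambda>m. peak_weight w h m * ?x h m ^ Suc k) sums
       (walk_gf M Y (valley_peak_at w h) (exp (- real (Suc k) / h\<^sup>2)) / walk_gf M Y (top_at w h) 1)"
    proof -
      have "?x h m ^ Suc k = exp (- real (Suc k) / h\<^sup>2) ^ m" for m
      proof -
        have "real (Suc k) * (- real m / h\<^sup>2) = real m * (- real (Suc k) / h\<^sup>2)"
          by (simp only: times_divide_eq_right mult_minus_right mult.commute)
        then show ?thesis by (simp only: exp_of_nat_mult[symmetric])
      qed
      moreover have "exp (- real (Suc k) / h\<^sup>2) \<le> 1" by (simp add: divide_nonpos_nonneg)
      ultimately show ?thesis
        using peak_weight(3)[OF elim exp_ge_zero, of "- real (Suc k) / h\<^sup>2" w] by (simp only:)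
    qed
    from step_cdf_moment[OF S[OF elim] x01 this] show ?case using elim by simp
  qed
  ultimately show "((\<lambda>h. integral {0..1} (\<lambda>x. x ^ k * (if 0 < h then step_cdf (peak_weight w h) (?x h) x else x)))
     \<longlongrightarrow> integral {0..1} (\<lambda>x. x ^ k * limit_cdf (\<sigma>\<^sup>2) x)) at_top"
    unfolding g by (rule Lim_transform_eventually)
qed

lemma tail_prob_step_cdf:
  assumes h: "0 < h"
  shows "tail_prob (valley_peak_at w h) n = walk_gf M Y (top_at w h) 1 *
     step_cdf (peak_weight w h) (\<lambda>m. exp (- real m / h\<^sup>2)) (exp (- real n / h\<^sup>2))"
proof -
  note A = top_gf_pos[OF h, of w]
  have x01: "exp (- real m / h\<^sup>2) \<in> {0..1}" for m by simp
  have [measurable]: "Measurable.pred seq_space (\<lambda>y. n < m \<and> valley_peak_at w h y m)" for m by measurable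
  have "(\<lambda>m. walk_prob M Y (\<lambda>y. n < m \<and> valley_peak_at w h y m)) sums walk_prob M Y (\<lambda>y. \<exists>m. n < m \<and> valley_peak_at w h y m)"
  proof (rule walk_prob_sums)
    show "exclusive (\<lambda>y m. n < m \<and> valley_peak_at w h y m)"
      using exclusive_valley_peak_at[of w h] unfolding exclusive_def by blast
  qed measurable
  also have "(\<lambda>m. walk_prob M Y (\<lambda>y. n < m \<and> valley_peak_at w h y m)) =
      (\<lambda>m. walk_gf M Y (top_at w h) 1 * (peak_weight w h m * indicator {exp (- real m / h\<^sup>2)<..} (exp (- real n / h\<^sup>2))))"
  proof
    fix m
    have "exp (- real m / h\<^sup>2) < exp (- real n / h\<^sup>2) \<longleftrightarrow> n < m"
      using h by (simp add: divide_less_cancel)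
    then show "walk_prob M Y (\<lambda>y. n < m \<and> valley_peak_at w h y m) =
      walk_gf M Y (top_at w h) 1 * (peak_weight w h m * indicator {exp (- real m / h\<^sup>2)<..} (exp (- real n / h\<^sup>2)))"
      using A by (cases "n < m") (simp_all add: peak_weight_def indicator_def walk_prob_def)
  qed
  finally have S: "(\<lambda>m. walk_gf M Y (top_at w h) 1 * (peak_weight w h m * indicator {exp (- real m / h\<^sup>2)<..} (exp (- real n / h\<^sup>2))))
     sums walk_prob M Y (\<lambda>y. \<exists>m. n < m \<and> valley_peak_at w h y m)" .
  have "walk_prob M Y (\<lambda>y. \<exists>m. n < m \<and> valley_peak_at w h y m) = walk_gf M Y (top_at w h) 1 *
     step_cdf (peak_weight w h) (\<lambda>m. exp (- real m / h\<^sup>2)) (exp (- real n / h\<^sup>2))"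
    by (rule sums_unique2[OF S sums_mult[OF step_cdf_sums[OF peak_weight(1,2)[OF h] x01]]])
  then show ?thesis by (simp add: tail_prob_def)
qed

end

section \<open>The two sides of the potential\<close>

lemma potential_step: "potential u (x + 1) - potential u x = ln (rho (u (x + 1)))"
proof -
  consider "0 < x" | "x = 0" | "x = - 1" | "x < - 1" by linarith
  then show ?thesis
  proof cases
    case 1
    then have "{1..x + 1} = insert (x + 1) {1..x}" by auto
    then show ?thesis using 1 by (simp add: potential_def)
  next
    case 4
    then have "{x + 1..0} = insert (x + 1) {x + 1 + 1..0}" by auto
    then show ?thesis using 4 by (simp add: potential_def)
  qed (simp_all add: potential_def)
qed

text \<open>A witness \<beta> can be cut back to the first time at which height h is reached, which
  is the exit time from the strip.\<close>

lemma ex_top_at_iff: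
  assumes h: "0 < h"
  shows "(\<exists>\<beta>>y. (\<forall>j. y < j \<and> j \<le> \<beta> \<longrightarrow> \<not> hit w (v y - v j)) \<and> v y + h \<le> v \<beta>) \<longleftrightarrow> (\<exists>k. top_at w h (steps v y) k)"
proof
  assume "\<exists>\<beta>>y. (\<forall>j. y < j \<and> j \<le> \<beta> \<longrightarrow> \<not> hit w (v y - v j)) \<and> v y + h \<le> v \<beta>"
  then obtain \<beta> where b: "y < \<beta>" "\<And>j. y < j \<Longrightarrow> j \<le> \<beta> \<Longrightarrow> \<not> hit w (v y - v j)" "v y + h \<le> v \<beta>" by blast
  define P where "P k \<longleftrightarrow> 1 \<le> k \<and> h \<le> v (y + int k) - v y" for k
  have P: "P (nat (\<beta> - y))" using b by (simp add: P_def)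
  define k where "k = (LEAST k. P k)"
  have k: "P k" "k \<le> nat (\<beta> - y)" unfolding k_def using P by (auto intro: LeastI Least_le)
  have "top_at w h (steps v y) k"
    unfolding top_at_def walk_steps
  proof (intro conjI allI impI)
    fix j assume j: "1 \<le> j \<and> j < k"
    then have "\<not> P j" unfolding k_def using not_less_Least by blast
    then show "v (y + int j) - v y < h" using j by (auto simp: P_def)
    have "\<not> hit w (v y - v (y + int j))" using j k(2) b(1) by (intro b(2)) auto
    then show "\<not> hit w (- (v (y + int j) - v y))" by simp
  qed (use k in \<open>auto simp: P_def\<close>)
  then show "\<exists>k. top_at w h (steps v y) k" ..
next
  assume "\<exists>k. top_at w h (steps v y) k"
  then obtain k where k: "1 \<le> k" "h \<le> v (y + int k) - v y" "\<And>j. 1 \<le> j \<Longrightarrow> j < k \<Longrightarrow> \<not> hit w (- (v (y + int j) - v y))"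
    unfolding top_at_def walk_steps by blast
  have "\<not> hit w (v y - v j)" if "y < j" "j \<le> y + int k" for j
  proof (cases "j = y + int k")
    case True
    then show ?thesis using k(2) h by (auto simp: hit_def)
  next
    case False
    then have "1 \<le> nat (j - y)" "nat (j - y) < k" using that by auto
    from k(3)[OF this] show ?thesis using that by simp
  qed
  then show "\<exists>\<beta>>y. (\<forall>j. y < j \<and> j \<le> \<beta> \<longrightarrow> \<not> hit w (v y - v j)) \<and> v y + h \<le> v \<beta>"
    using k by (intro exI[of _ "y + int k"]) auto
qed

text \<open>Being a minimum splits into one condition on the steps to the right and one on the steps
  to the left; these are independent, which is the origin of the product formula. Mirroring the left
  side negates the flag.\<close>

lemma hmin_iff_top_at:
  assumes h: "0 < h"
  shows "hmin w h v y \<longleftrightarrow> (\<exists>k. top_at w h (steps v y) k) \<and> (\<exists>k. top_at (\<not> w) h (steps (flip v) (- y)) k)"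
proof -
  have "(\<exists>\<alpha><y. (\<forall>j. \<alpha> \<le> j \<and> j < y \<longrightarrow> hit w (v j - v y)) \<and> v y + h \<le> v \<alpha>) \<longleftrightarrow>
    (\<exists>\<beta>>- y. (\<forall>j. - y < j \<and> j \<le> \<beta> \<longrightarrow> \<not> hit (\<not> w) (flip v (- y) - flip v j)) \<and> flip v (- y) + h \<le> flip v \<beta>)"
    (is "?l \<longleftrightarrow> ?r")
  proof
    assume ?l
    then obtain \<alpha> where "\<alpha> < y" "\<And>j. \<alpha> \<le> j \<Longrightarrow> j < y \<Longrightarrow> hit w (v j - v y)" "v y + h \<le> v \<alpha>" by blast
    then show ?r by (intro exI[of _ "- \<alpha>"]) (auto simp: hit_not flip_def)
  next
    assume ?r
    then obtain \<beta> where b: "- y < \<beta>" "\<And>j. - y < j \<Longrightarrow> j \<le> \<beta> \<Longrightarrow> hit w (- (flip v (- y) - flip v j))" "flip v (- y) + h \<le> flip v \<beta>"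
      unfolding hit_not by blast
    have "hit w (v j - v y)" if "- \<beta> \<le> j" "j < y" for j
      using b(2)[of "- j"] that by (simp add: flip_def)
    then show ?l using b by (intro exI[of _ "- \<beta>"]) (auto simp: flip_def)
  qed
  then show ?thesis
    unfolding hmin_def ex_top_at_iff[OF h, symmetric] by blast
qed

text \<open>Only the increments of \<open>V\<close> are prescribed: extrema do not change when a
  constant is added to the path.\<close>

locale potential_walk = prob_space M for M :: "'a measure" +
  fixes X :: "int \<Rightarrow> 'a \<Rightarrow> real" and V :: "'a \<Rightarrow> int \<Rightarrow> real" and L \<sigma> :: real
  assumes X_indep: "indep_vars (\<lambda>_. borel) X UNIV"
    and X_ident: "\<And>i. distr M borel (X i) = distr M borel (X 0)"
    and X_bdd: "\<And>i s. s \<in> space M \<Longrightarrow> \<bar>X i s\<bar> \<le> L"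
    and X_mean: "expectation (X 0) = 0"
    and X_var: "expectation (\<lambda>s. (X 0 s)\<^sup>2) = \<sigma>\<^sup>2"
    and X_sigma: "0 < \<sigma>"
    and V_step: "\<And>s x. V s (x + 1) - V s x = X (x + 1) s"
begin

text \<open>\<open>R x\<close> reads the increments with index above \<open>x\<close> upwards;
  \<open>Lf x\<close> reads those with index at most \<open>x\<close> downwards and with reversed
  sign, as a walker to the left meets them. The two index sets are disjoint.\<close>

definition R :: "int \<Rightarrow> nat \<Rightarrow> 'a \<Rightarrow> real" where
  "R x i s = X (x + 1 + int i) s"

definition Lf :: "int \<Rightarrow> nat \<Rightarrow> 'a \<Rightarrow> real" where
  "Lf x i s = - X (x - int i) s"

lemma X_rv [measurable]: "X i \<in> borel_measurable M"
  using X_indep by (auto simp: indep_vars_def)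

lemma steps_V: "steps (V s) x = (\<lambda>i. R x i s)"
proof
  show "steps (V s) x i = R x i s" for i
    using V_step[of s "x + int i"] by (simp add: steps_def R_def algebra_simps)
qed

lemma steps_flip_V: "steps (flip (V s)) (- x) = (\<lambda>i. Lf x i s)"
proof
  fix i
  have "V s (x - int i) - V s (x - int i - 1) = X (x - int i) s"
    using V_step[of s "x - int i - 1"] by simp
  then show "steps (flip (V s)) (- x) i = Lf x i s"
    by (simp add: steps_def flip_def Lf_def algebra_simps)
qed

lemma steps_uminus: "steps (\<lambda>j. - v j) y = (\<lambda>i. - steps v y i)"
  by (simp add: steps_def fun_eq_iff)

lemma iid_R: "iid_walk M (R x) L \<sigma>" and law_R: "distr M seq_space (\<lambda>s i. R x i s) = distr M seq_space (\<lambda>s i. R 0 i s)"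
proof -
  have inj: "inj (\<lambda>i. x + 1 + int i)" for x by (auto intro: injI)
  note I = iid_law[OF X_indep X_ident inj, folded R_def]
  show "distr M seq_space (\<lambda>s i. R x i s) = distr M seq_space (\<lambda>s i. R 0 i s)"
    using I(1)[of x] I(1)[of 0] by simp
  have e: "expectation (\<lambda>s. f (X i s)) = expectation (\<lambda>s. f (X 0 s))" if [measurable]: "f \<in> borel_measurable borel" for f :: "real \<Rightarrow> real" and i
    using integral_distr[of "X i" M borel f] integral_distr[of "X 0" M borel f] X_ident[of i] by simp
  show "iid_walk M (R x) L \<sigma>"
  proof
    show "indep_vars (\<lambda>_. borel) (R x) UNIV" using I(2)[of x] by (simp add: R_def[abs_def])
    show "distr M borel (R x i) = distr M borel (R x 0)" for i
      using X_ident[of "x + 1 + int i"] X_ident[of "x + 1"] by (simp add: R_def[abs_def])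
    show "expectation (R x 0) = 0" using e[of "\<lambda>t. t" "x + 1"] X_mean by (simp add: R_def[abs_def])
    show "expectation (\<lambda>s. (R x 0 s)\<^sup>2) = \<sigma>\<^sup>2" using e[of "\<lambda>t. t\<^sup>2" "x + 1"] X_var by (simp add: R_def)
  qed (use X_bdd X_sigma in \<open>auto simp: R_def\<close>)
qed

lemma iid_Lf: "iid_walk M (Lf x) L \<sigma>" and law_Lf: "distr M seq_space (\<lambda>s i. Lf x i s) = distr M seq_space (\<lambda>s i. Lf 0 i s)"
proof -
  have inj: "inj (\<lambda>i. x - int i)" for x by (auto intro: injI)
  have ind: "indep_vars (\<lambda>_. borel) (\<lambda>i s. - X i s) UNIV"
    by (rule indep_vars_compose2[OF X_indep]) auto
  have d: "distr M borel (\<lambda>s. - X i s) = distr (distr M borel (X 0)) borel uminus" for i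
    unfolding X_ident[of i, symmetric] by (subst distr_distr) (auto simp: comp_def)
  note I = iid_law[OF ind d inj, folded Lf_def]
  show "distr M seq_space (\<lambda>s i. Lf x i s) = distr M seq_space (\<lambda>s i. Lf 0 i s)"
    using I(1)[of x] I(1)[of 0] by simp
  have e: "expectation (\<lambda>s. f (X i s)) = expectation (\<lambda>s. f (X 0 s))" if [measurable]: "f \<in> borel_measurable borel" for f :: "real \<Rightarrow> real" and i
    using integral_distr[of "X i" M borel f] integral_distr[of "X 0" M borel f] X_ident[of i] by simp
  show "iid_walk M (Lf x) L \<sigma>"
  proof
    show "indep_vars (\<lambda>_. borel) (Lf x) UNIV" using I(2)[of x] by (simp add: Lf_def[abs_def])
    show "distr M borel (Lf x i) = distr M borel (Lf x 0)" for i
      using d[of "x - int i"] d[of x] by (simp add: Lf_def[abs_def])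
    show "expectation (Lf x 0) = 0" using e[of "\<lambda>t. t" x] X_mean by (simp add: Lf_def[abs_def])
    show "expectation (\<lambda>s. (Lf x 0 s)\<^sup>2) = \<sigma>\<^sup>2" using e[of "\<lambda>t. t\<^sup>2" x] X_var by (simp add: Lf_def)
  qed (use X_bdd X_sigma in \<open>auto simp: Lf_def\<close>)
qed

sublocale R0: iid_walk M "R 0" L \<sigma> by (rule iid_R)
sublocale L0: iid_walk M "Lf 0" L \<sigma> by (rule iid_Lf)

lemma measurable_paths [measurable]:
  "(\<lambda>s i. R x i s) \<in> measurable M seq_space" "(\<lambda>s i. Lf x i s) \<in> measurable M seq_space"
  by (rule iid_walk.measurable_path, rule iid_R, rule iid_walk.measurable_path, rule iid_Lf)

lemma walk_prob_distr:
  assumes "Measurable.pred seq_space Q" "(\<lambda>s i. Y i s) \<in> measurable M seq_space"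
  shows "walk_prob M Y Q = measure (distr M seq_space (\<lambda>s i. Y i s)) {y. Q y}"
proof -
  have "{y. Q y} \<in> sets seq_space" using assms(1) by (simp add: pred_def space_PiM)
  then show ?thesis
    using assms(2) by (simp add: measure_distr walk_prob_def vimage_def Int_def conj_commute)
qed

lemma walk_prob_R: "Measurable.pred seq_space Q \<Longrightarrow> walk_prob M (R x) Q = walk_prob M (R 0) Q"
  by (simp add: walk_prob_distr measurable_paths law_R[of x])

lemma walk_prob_Lf: "Measurable.pred seq_space Q \<Longrightarrow> walk_prob M (Lf x) Q = walk_prob M (Lf 0) Q"
  by (simp add: walk_prob_distr measurable_paths law_Lf[of x])

lemma independent_sides:
  assumes Q: "Measurable.pred seq_space Q" and Q': "Measurable.pred seq_space Q'"
  shows "measure M {s \<in> space M. Q (\<lambda>i. R x i s) \<and> Q' (\<lambda>i. Lf x i s)} = walk_prob M (R 0) Q * walk_prob M (Lf 0) Q'"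
proof -
  interpret Rx: iid_walk M "R x" L \<sigma> by (rule iid_R)
  interpret Lx: iid_walk M "Lf x" L \<sigma> by (rule iid_Lf)
  let ?A = "{x + 1..}" and ?B = "{..x}"
  let ?F = "\<lambda>g. indicator {y. Q y} (\<lambda>i. g (x + 1 + int i)) :: real"
  let ?G = "\<lambda>g. indicator {y. Q' y} (\<lambda>i. - g (x - int i)) :: real"
  have [measurable]: "(indicator {y. Q y} :: _ \<Rightarrow> real) \<in> borel_measurable seq_space"
     "(indicator {y. Q' y} :: _ \<Rightarrow> real) \<in> borel_measurable seq_space"
    by (rule R0.indicator_pred_measurable[OF Q] R0.indicator_pred_measurable[OF Q'])+
  have "indep_var (PiM ?A (\<lambda>_. borel)) (\<lambda>s. restrict (\<lambda>i. X i s) ?A) (PiM ?B (\<lambda>_. borel)) (\<lambda>s. restrict (\<lambda>i. X i s) ?B)"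
    by (rule indep_var_restrict[OF X_indep]) auto
  then have "indep_var borel (?F \<circ> (\<lambda>s. restrict (\<lambda>i. X i s) ?A)) borel (?G \<circ> (\<lambda>s. restrict (\<lambda>i. X i s) ?B))"
  proof (rule indep_var_compose)
    have "(\<lambda>g i. g (x + 1 + int i)) \<in> measurable (PiM ?A (\<lambda>_. borel)) seq_space"
      by (intro measurable_PiM_single') (auto intro!: measurable_component_singleton)
    then show "?F \<in> borel_measurable (PiM ?A (\<lambda>_. borel))" by measurable
    have "(\<lambda>g i. - g (x - int i)) \<in> measurable (PiM ?B (\<lambda>_. borel)) seq_space"
      by (intro measurable_PiM_single') (auto intro!: borel_measurable_uminus measurable_component_singleton)
    then show "?G \<in> borel_measurable (PiM ?B (\<lambda>_. borel))" by measurable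
  qed
  moreover have "?F \<circ> (\<lambda>s. restrict (\<lambda>i. X i s) ?A) = (\<lambda>s. indicator {y. Q y} (\<lambda>i. R x i s))"
    by (auto simp: fun_eq_iff R_def)
  moreover have "?G \<circ> (\<lambda>s. restrict (\<lambda>i. X i s) ?B) = (\<lambda>s. indicator {y. Q' y} (\<lambda>i. Lf x i s))"
    by (auto simp: fun_eq_iff Lf_def)
  ultimately have "indep_var borel (\<lambda>s. indicator {y. Q y} (\<lambda>i. R x i s) :: real) borel (\<lambda>s. indicator {y. Q' y} (\<lambda>i. Lf x i s))"
    by simp
  have ms: "(\<lambda>s. indicator {y. Q y} (\<lambda>i. R x i s) :: real) \<in> borel_measurable M"
    "(\<lambda>s. indicator {y. Q' y} (\<lambda>i. Lf x i s) :: real) \<in> borel_measurable M"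
    by measurable
  from \<open>indep_var borel (\<lambda>s. indicator {y. Q y} (\<lambda>i. R x i s)) borel (\<lambda>s. indicator {y. Q' y} (\<lambda>i. Lf x i s))\<close>
  have E: "expectation (\<lambda>s. indicator {y. Q y} (\<lambda>i. R x i s) * indicator {y. Q' y} (\<lambda>i. Lf x i s) :: real)
      = expectation (\<lambda>s. indicator {y. Q y} (\<lambda>i. R x i s)) * expectation (\<lambda>s. indicator {y. Q' y} (\<lambda>i. Lf x i s))"
  proof (rule indep_var_lebesgue_integral)
    show "integrable M (\<lambda>s. indicator {y. Q y} (\<lambda>i. R x i s) :: real)"
      by (rule integrable_const_bound[where B = 1, OF _ ms(1)]) (simp add: indicator_def)
    show "integrable M (\<lambda>s. indicator {y. Q' y} (\<lambda>i. Lf x i s) :: real)"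
      by (rule integrable_const_bound[where B = 1, OF _ ms(2)]) (simp add: indicator_def)
  qed
  have "{s \<in> space M. Q (\<lambda>i. R x i s) \<and> Q' (\<lambda>i. Lf x i s)} \<in> events"
    using Q Q' by measurable
  then have "measure M {s \<in> space M. Q (\<lambda>i. R x i s) \<and> Q' (\<lambda>i. Lf x i s)}
     = expectation (indicator {s \<in> space M. Q (\<lambda>i. R x i s) \<and> Q' (\<lambda>i. Lf x i s)})"
    by simp
  also have "\<dots> = expectation (\<lambda>s. indicator {y. Q y} (\<lambda>i. R x i s) * indicator {y. Q' y} (\<lambda>i. Lf x i s) :: real)"
    by (intro Bochner_Integration.integral_cong) (auto simp: indicator_def)
  also have "\<dots> = walk_prob M (R x) Q * walk_prob M (Lf x) Q'"
    unfolding E Rx.walk_prob_eq_expectation[OF Q] Lx.walk_prob_eq_expectation[OF Q'] ..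
  finally show ?thesis by (simp only: walk_prob_R[OF Q, of x] walk_prob_Lf[OF Q', of x])
qed

lemma AE_ex_peak:
  assumes "iid_walk M Y L \<sigma>" "0 < h"
  shows "AE s in M. \<exists>m. peak_at w h (\<lambda>i. Y i s) m"
proof -
  interpret I: iid_walk M Y L \<sigma> by fact
  have "walk_prob M Y (\<lambda>y. \<exists>m. peak_at w h y m) = 1"
    using I.total_gf(1)[OF assms(2), of w] I.walk_gf_1[OF measurable_peak_at exclusive_peak_at] by simp
  moreover have "{s \<in> space M. \<exists>m. peak_at w h (\<lambda>i. Y i s) m} \<in> events" by measurable
  ultimately show ?thesis
    unfolding walk_prob_def by (simp add: prob_eq_1)
qed

lemma oscillating_V:
  "oscillating h (V s) \<longleftrightarrow> (\<forall>y. (\<exists>m. peak_at False h (\<lambda>i. R y i s) m) \<and> (\<exists>m. peak_at False h (\<lambda>i. - R y i s) m) \<and>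
     (\<exists>m. peak_at True h (\<lambda>i. Lf (- y) i s) m) \<and> (\<exists>m. peak_at True h (\<lambda>i. - Lf (- y) i s) m))"
proof -
  have "steps (flip (V s)) y = (\<lambda>i. Lf (- y) i s)" for y using steps_flip_V[of s "- y"] by simp
  then show ?thesis by (simp add: oscillating_def steps_uminus steps_V)
qed

lemma AE_oscillating:
  assumes h: "0 < h"
  shows "AE s in M. oscillating h (V s)"
proof -
  have "AE s in M. \<exists>m. peak_at False h (\<lambda>i. R y i s) m" "AE s in M. \<exists>m. peak_at False h (\<lambda>i. - R y i s) m"
    "AE s in M. \<exists>m. peak_at True h (\<lambda>i. Lf (- y) i s) m" "AE s in M. \<exists>m. peak_at True h (\<lambda>i. - Lf (- y) i s) m" for y
    by (intro AE_ex_peak iid_R iid_Lf h iid_walk.iid_walk_uminus)+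
  then show ?thesis unfolding oscillating_V AE_all_countable by (intro allI AE_conjI) auto
qed

text \<open>The enumeration-free side of \<open>b_bottom_iff\<close>. Unlike \<open>b_bottom\<close>
  itself it splits into conditions on the two sides at every path.\<close>

definition b_event :: "real \<Rightarrow> int \<Rightarrow> 'a \<Rightarrow> bool" where
  "b_event h x s \<longleftrightarrow> hmin False h (V s) x \<and>
    (if x \<le> 0 then \<exists>m. peak_at False h (steps (V s) x) m \<and> 0 < x + int m
     else \<exists>m. peak_at True h (steps (flip (V s)) (- x)) m \<and> x \<le> int m)"

lemma b_event_nonpos:
  assumes h: "0 < h"
  shows "b_event h (- int n) s \<longleftrightarrow> (\<exists>m>n. valley_peak_at False h (\<lambda>i. R (- int n) i s) m) \<and> (\<exists>k. top_at True h (\<lambda>i. Lf (- int n) i s) k)"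
proof -
  have m: "0 < - int n + int m \<longleftrightarrow> n < m" for m by auto
  have n: "- int n \<le> 0" by simp
  show ?thesis
    unfolding b_event_def hmin_iff_top_at[OF h] steps_V steps_flip_V valley_peak_at_def m if_P[OF n] not_False_eq_True
    by blast
qed

text \<open>Positive sites are numbered n + 1, so that x \<le> m reads n < m and both half-lines
  lead to a tail at the same index n.\<close>

lemma b_event_pos:
  assumes h: "0 < h"
  shows "b_event h (int n + 1) s \<longleftrightarrow> (\<exists>k. top_at False h (\<lambda>i. R (int n + 1) i s) k) \<and> (\<exists>m>n. valley_peak_at True h (\<lambda>i. Lf (int n + 1) i s) m)"
proof -
  have m: "int n + 1 \<le> int m \<longleftrightarrow> n < m" for m by auto
  have n: "\<not> int n + 1 \<le> 0" by simp
  show ?thesis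
    unfolding b_event_def hmin_iff_top_at[OF h] steps_V steps_flip_V valley_peak_at_def m if_not_P[OF n] not_False_eq_True
    by blast
qed

definition prob_b :: "real \<Rightarrow> int \<Rightarrow> real" where
  "prob_b h x = measure M {s \<in> space M. b_event h x s}"

definition top_prob_R :: "real \<Rightarrow> real" where "top_prob_R h = walk_gf M (R 0) (top_at False h) 1"
definition top_prob_L :: "real \<Rightarrow> real" where "top_prob_L h = walk_gf M (Lf 0) (top_at True h) 1"

text \<open>The side away from the origin only has to climb by h; the side towards the origin must
  climb and then have its peak beyond the origin.\<close>

lemma prob_b_nonpos:
  assumes h: "0 < h"
  shows "prob_b h (- int n) = top_prob_L h * R0.tail_prob (valley_peak_at False h) n"
proof -
  have m: "Measurable.pred seq_space (\<lambda>y. \<exists>m>n. valley_peak_at False h y m)" "Measurable.pred seq_space (\<lambda>y. \<exists>k. top_at True h y k)"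
    by measurable
  show ?thesis
    unfolding prob_b_def b_event_nonpos[OF h] independent_sides[OF m] top_prob_L_def R0.tail_prob_def
      L0.walk_gf_1[OF measurable_top_at exclusive_top_at(1)] by (rule mult.commute)
qed

lemma prob_b_pos:
  assumes h: "0 < h"
  shows "prob_b h (int n + 1) = top_prob_R h * L0.tail_prob (valley_peak_at True h) n"
proof -
  have m: "Measurable.pred seq_space (\<lambda>y. \<exists>k. top_at False h y k)" "Measurable.pred seq_space (\<lambda>y. \<exists>m>n. valley_peak_at True h y m)"
    by measurable
  show ?thesis
    unfolding prob_b_def b_event_pos[OF h] independent_sides[OF m] top_prob_R_def L0.tail_prob_def
      R0.walk_gf_1[OF measurable_top_at exclusive_top_at(1)] ..
qed

lemma measurable_b_event [measurable]:
  assumes h: "0 < h"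
  shows "Measurable.pred M (b_event h x)"
proof (cases "x \<le> 0")
  case True
  then obtain n where x: "x = - int n" by (intro that[of "nat (- x)"]) auto
  have "b_event h x = (\<lambda>s. (\<exists>m>n. valley_peak_at False h (\<lambda>i. R (- int n) i s) m) \<and> (\<exists>k. top_at True h (\<lambda>i. Lf (- int n) i s) k))"
    unfolding x by (rule ext) (rule b_event_nonpos[OF h])
  then show ?thesis by simp
next
  case False
  then obtain n where x: "x = int n + 1" by (intro that[of "nat (x - 1)"]) auto
  have "b_event h x = (\<lambda>s. (\<exists>k. top_at False h (\<lambda>i. R (int n + 1) i s) k) \<and> (\<exists>m>n. valley_peak_at True h (\<lambda>i. Lf (int n + 1) i s) m))"
    unfolding x by (rule ext) (rule b_event_pos[OF h])
  then show ?thesis by simp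
qed

end

text \<open>Up to its peak the path contains no drawdown of size h at all, so a search for one
  started at a later time also ends only after the peak.\<close>

lemma first_drawdown_shift_after_peak:
  assumes pk: "peak_at w h y m" and fd: "first_drawdown h (shift j y) l"
  shows "m < j + l"
proof (rule ccontr)
  assume n: "\<not> m < j + l"
  obtain l' where l': "m < l'" "first_drawdown h y l'" using pk unfolding peak_at_def by blast
  obtain i where i: "i < l" "h \<le> walk (shift j y) i - walk (shift j y) l"
    using fd unfolding first_drawdown_def by blast
  have "walk y (j + i) - walk y (j + l) < h"
    using n l'(1) i(1) by (intro first_drawdownD[OF l'(2)]) auto
  then show False using i(2) by (simp add: walk_shift)
qed

lemma sech_quotient_limit: "((\<lambda>c::real. (1 - 1 / cosh c) / c\<^sup>2) \<longlongrightarrow> 1 / 2) (at_right 0)"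
  by real_asymp

section \<open>Normalisation by the total mass\<close>

context potential_walk
begin

lemma measurable_oscillating [measurable]: "Measurable.pred M (\<lambda>s. oscillating h (V s))"
proof -
  have "(\<lambda>s i. - R y i s) \<in> measurable M seq_space" "(\<lambda>s i. - Lf y i s) \<in> measurable M seq_space" for y
    using measurable_compose[OF measurable_paths(1) measurable_uminus_seq]
      measurable_compose[OF measurable_paths(2) measurable_uminus_seq] by auto
  note [measurable] = this
  show ?thesis unfolding oscillating_V by measurable
qed

text \<open>On oscillating paths \<open>b_bottom\<close> agrees with the measurable
  \<open>b_event\<close>, while as values of a function these events are disjoint for different x.
  The conjunction has both properties at every point of the space.\<close>

definition osc_b :: "real \<Rightarrow> int \<Rightarrow> 'a \<Rightarrow> bool" where
  "osc_b h x s \<longleftrightarrow> oscillating h (V s) \<and> b_bottom h (V s) = x"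

lemma osc_b_iff: "0 < h \<Longrightarrow> osc_b h x s \<longleftrightarrow> oscillating h (V s) \<and> b_event h x s"
  unfolding osc_b_def b_event_def using b_bottom_iff[of h "V s" x] by blast

lemma osc_b_events: "0 < h \<Longrightarrow> {s \<in> space M. osc_b h x s} \<in> events"
  using measurable_b_event[of h x] unfolding osc_b_iff by measurable

lemma prob_osc_b:
  assumes h: "0 < h"
  shows "prob {s \<in> space M. osc_b h x s} = prob_b h x"
  unfolding prob_b_def
proof (rule finite_measure_eq_AE)
  show "AE s in M. (s \<in> {s \<in> space M. osc_b h x s}) = (s \<in> {s \<in> space M. b_event h x s})"
    using AE_oscillating[OF h] by eventually_elim (simp add: osc_b_iff[OF h])
  show "{s \<in> space M. osc_b h x s} \<in> events" by (rule osc_b_events[OF h])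
  show "{s \<in> space M. b_event h x s} \<in> events"
    using measurable_b_event[OF h, of x] by measurable
qed

definition neg_tail :: "real \<Rightarrow> nat \<Rightarrow> real" where
  "neg_tail h n = prob {s \<in> space M. \<exists>k>n. osc_b h (- int k) s}"

definition pos_tail :: "real \<Rightarrow> nat \<Rightarrow> real" where
  "pos_tail h n = prob {s \<in> space M. \<exists>k>n. osc_b h (int k + 1) s}"

lemma neg_tail_split:
  assumes h: "0 < h"
  shows "neg_tail h n = neg_tail h (Suc n) + prob_b h (- int (Suc n))"
    and "prob {s \<in> space M. \<exists>k. osc_b h (- int k) s} = neg_tail h 0 + prob_b h (- int 0)"
  unfolding neg_tail_def prob_osc_b[OF h, symmetric]
  by (rule tail_event_split[of "\<lambda>k. osc_b h (- int k)"]; use osc_b_events[OF h] in \<open>auto simp: osc_b_def\<close>)+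

lemma pos_tail_split:
  assumes h: "0 < h"
  shows "pos_tail h n = pos_tail h (Suc n) + prob_b h (int (Suc n) + 1)"
    and "prob {s \<in> space M. \<exists>k. osc_b h (int k + 1) s} = pos_tail h 0 + prob_b h (int 0 + 1)"
  unfolding pos_tail_def prob_osc_b[OF h, symmetric]
  by (rule tail_event_split[of "\<lambda>k. osc_b h (int k + 1)"]; use osc_b_events[OF h] in \<open>auto simp: osc_b_def\<close>)+

lemma prob_halves:
  assumes h: "0 < h"
  shows "prob {s \<in> space M. \<exists>k. osc_b h (- int k) s} + prob {s \<in> space M. \<exists>k. osc_b h (int k + 1) s} = 1"
proof -
  let ?N = "{s \<in> space M. \<exists>k. osc_b h (- int k) s}" and ?P = "{s \<in> space M. \<exists>k. osc_b h (int k + 1) s}"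
  have ev: "?N \<in> events" "?P \<in> events"
  proof -
    have "?N = (\<Union>k. {s \<in> space M. osc_b h (- int k) s})" "?P = (\<Union>k. {s \<in> space M. osc_b h (int k + 1) s})" by auto
    then show "?N \<in> events" "?P \<in> events" using osc_b_events[OF h] by auto
  qed
  have disj: "?N \<inter> ?P = {}" by (auto simp: osc_b_def)
  have cov: "(\<exists>k. osc_b h (- int k) s) \<or> (\<exists>k. osc_b h (int k + 1) s)" if "oscillating h (V s)" for s
  proof (cases "b_bottom h (V s) \<le> 0")
    case True
    then have "b_bottom h (V s) = - int (nat (- b_bottom h (V s)))" by simp
    then show ?thesis using that unfolding osc_b_def by blast
  next
    case False
    then have "b_bottom h (V s) = int (nat (b_bottom h (V s) - 1)) + 1" by simp
    then show ?thesis using that unfolding osc_b_def by blast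
  qed
  from AE_oscillating[OF h] AE_space have "AE s in M. s \<in> ?N \<union> ?P"
    by eventually_elim (use cov in auto)
  then have "prob (?N \<union> ?P) = 1"
    using ev by (subst prob_eq_1) auto
  then show ?thesis using finite_measure_Union[OF ev disj] by simp
qed

text \<open>If the bottom is at - k with k > n, its peak lies to the right of the origin, and a
  drawdown search started at - n ends after that peak, hence after more than n steps. The fixed
  start - n, in place of the random bottom, makes this an event for one walk of known law.\<close>

lemma neg_tail_le:
  assumes h: "0 < h"
  shows "neg_tail h n \<le> R0.tail_prob (first_drawdown h) n"
proof -
  have m: "Measurable.pred seq_space (\<lambda>y. \<exists>l>n. first_drawdown h y l)" by measurable
  have "neg_tail h n \<le> prob {s \<in> space M. \<exists>l>n. first_drawdown h (\<lambda>i. R (- int n) i s) l}"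
    unfolding neg_tail_def
  proof (rule finite_measure_mono)
    show "{s \<in> space M. \<exists>l>n. first_drawdown h (\<lambda>i. R (- int n) i s) l} \<in> events" by measurable
    show "{s \<in> space M. \<exists>k>n. osc_b h (- int k) s} \<subseteq> {s \<in> space M. \<exists>l>n. first_drawdown h (\<lambda>i. R (- int n) i s) l}"
    proof safe
      fix s k assume s: "s \<in> space M" and k: "n < k" "osc_b h (- int k) s"
      have osc: "oscillating h (V s)" using k(2) by (simp add: osc_b_def)
      obtain l where l: "first_drawdown h (\<lambda>i. R (- int n) i s) l"
        using osc unfolding oscillating_V peak_at_def by blast
      have "b_event h (- int k) s" using k(2) osc_b_iff[OF h] by simp
      then obtain m where m: "peak_at False h (\<lambda>i. R (- int k) i s) m" "k < m"
        unfolding b_event_def steps_V by (auto split: if_splits)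
      have "shift (k - n) (\<lambda>i. R (- int k) i s) = (\<lambda>i. R (- int n) i s)"
        using k(1) by (auto simp: shift_def fun_eq_iff R_def of_nat_diff algebra_simps)
      then have "m < k - n + l" using first_drawdown_shift_after_peak[OF m(1), of "k - n" l] l by simp
      then show "\<exists>l>n. first_drawdown h (\<lambda>i. R (- int n) i s) l" using l m(2) k(1) by (intro exI[of _ l]) auto
    qed
  qed
  also have "\<dots> = R0.tail_prob (first_drawdown h) n"
    using walk_prob_R[OF m, of "- int n"] by (simp add: walk_prob_def R0.tail_prob_def)
  finally show ?thesis .
qed

lemma pos_tail_le:
  assumes h: "0 < h"
  shows "pos_tail h n \<le> L0.tail_prob (first_drawdown h) n"
proof -
  have m: "Measurable.pred seq_space (\<lambda>y. \<exists>l>n. first_drawdown h y l)" by measurable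
  have "pos_tail h n \<le> prob {s \<in> space M. \<exists>l>n. first_drawdown h (\<lambda>i. Lf (int n + 1) i s) l}"
    unfolding pos_tail_def
  proof (rule finite_measure_mono)
    show "{s \<in> space M. \<exists>l>n. first_drawdown h (\<lambda>i. Lf (int n + 1) i s) l} \<in> events" by measurable
    show "{s \<in> space M. \<exists>k>n. osc_b h (int k + 1) s} \<subseteq> {s \<in> space M. \<exists>l>n. first_drawdown h (\<lambda>i. Lf (int n + 1) i s) l}"
    proof safe
      fix s k assume s: "s \<in> space M" and k: "n < k" "osc_b h (int k + 1) s"
      have osc: "oscillating h (V s)" using k(2) by (simp add: osc_b_def)
      have "\<exists>m. peak_at True h (\<lambda>i. Lf (- (- (int n + 1))) i s) m" using osc unfolding oscillating_V by blast
      then obtain l where l: "first_drawdown h (\<lambda>i. Lf (int n + 1) i s) l"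
        unfolding peak_at_def minus_minus by blast
      have "b_event h (int k + 1) s" using k(2) osc_b_iff[OF h] by simp
      then obtain m where m: "peak_at True h (\<lambda>i. Lf (int k + 1) i s) m" "k < m"
        unfolding b_event_def steps_flip_V by (auto split: if_splits)
      have "shift (k - n) (\<lambda>i. Lf (int k + 1) i s) = (\<lambda>i. Lf (int n + 1) i s)"
        using k(1) by (auto simp: shift_def fun_eq_iff Lf_def of_nat_diff algebra_simps)
      then have "m < k - n + l" using first_drawdown_shift_after_peak[OF m(1), of "k - n" l] l by simp
      then show "\<exists>l>n. first_drawdown h (\<lambda>i. Lf (int n + 1) i s) l" using l m(2) k(1) by (intro exI[of _ l]) auto
    qed
  qed
  also have "\<dots> = L0.tail_prob (first_drawdown h) n"
    using walk_prob_Lf[OF m, of "int n + 1"] by (simp add: walk_prob_def L0.tail_prob_def)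
  finally show ?thesis .
qed

text \<open>Discounting by x^n removes (1 - x) times the transform of the tails from the total mass.
  Dominating tails \<open>T\<close> bound this loss by their own deficit \<open>d\<close>.\<close>

lemma discounted_mass:
  fixes p W T :: "nat \<Rightarrow> real"
  assumes W: "\<And>n. W n = W (Suc n) + p (Suc n)" and tot: "tot = W 0 + p 0"
    and nn: "\<And>n. 0 \<le> W n" and WT: "\<And>n. W n \<le> T n" and x: "0 \<le> x" "x < 1"
    and T: "summable (\<lambda>n. T n * x ^ n)" "(1 - x) * (\<Sum>n. T n * x ^ n) = d"
    and S: "(\<lambda>n. p n * x ^ n) sums S"
  shows "tot - d \<le> S" "S \<le> tot"
proof -
  have sW: "summable (\<lambda>n. W n * x ^ n)"
  proof (rule summable_comparison_test'[OF T(1)])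
    show "norm (W n * x ^ n) \<le> T n * x ^ n" for n
      using nn[of n] WT[of n] x by (simp add: mult_right_mono)
  qed
  have "S = tot - (1 - x) * (\<Sum>n. W n * x ^ n)"
    using tail_generating_function[OF W tot sW] S sums_unique2 by blast
  moreover have "0 \<le> (\<Sum>n. W n * x ^ n)"
    using nn x by (intro suminf_nonneg sW) auto
  moreover have "(\<Sum>n. W n * x ^ n) \<le> (\<Sum>n. T n * x ^ n)"
    using WT x by (intro suminf_le sW T(1)) (auto intro: mult_right_mono)
  ultimately show "tot - d \<le> S" "S \<le> tot"
    using x T(2) mult_left_mono[of "\<Sum>n. W n * x ^ n" "\<Sum>n. T n * x ^ n" "1 - x"] by auto
qed

definition \<kappa> :: "real \<Rightarrow> real" where "\<kappa> h = h\<^sup>2 * (top_prob_R h * top_prob_L h)"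

lemma top_prob_pos: "0 < h \<Longrightarrow> 0 < top_prob_R h" "0 < h \<Longrightarrow> 0 < top_prob_L h"
  unfolding top_prob_R_def top_prob_L_def by (rule R0.top_gf_pos, assumption, rule L0.top_gf_pos, assumption)

text \<open>The product of the two exit probabilities is never computed: it is determined by the total mass \<open>1\<close>
  of the law of \<open>b_h\<close>. The mass that discounting loses is controlled through the first drawdown time,
  which bounds the distance from the origin to \<open>b_h\<close>.\<close>

lemma kappa_bounds:
  fixes x :: real
  assumes h: "0 < h" and x: "0 \<le> x" "x < 1"
  defines "\<Psi> \<equiv> (2 - walk_gf M (R 0) (valley_peak_at False h) x / top_prob_R h - walk_gf M (Lf 0) (valley_peak_at True h) x / top_prob_L h) / (h\<^sup>2 * (1 - x))"
  shows "\<kappa> h * \<Psi> \<le> 1"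
    and "walk_gf M (R 0) (first_drawdown h) x + walk_gf M (Lf 0) (first_drawdown h) x - 1 \<le> \<kappa> h * \<Psi>"
proof -
  note a = top_prob_pos[OF h]
  let ?vR = "walk_gf M (R 0) (valley_peak_at False h) x" and ?vL = "walk_gf M (Lf 0) (valley_peak_at True h) x"
  note gR = R0.tail_prob_gf[OF measurable_valley_peak_at exclusive_valley_peak_at x, of False h, unfolded R0.total_gf(3)[OF h], folded top_prob_R_def]
  note gL = L0.tail_prob_gf[OF measurable_valley_peak_at exclusive_valley_peak_at x, of True h, unfolded L0.total_gf(3)[OF h], folded top_prob_L_def]
  note dR = R0.tail_prob_gf[OF measurable_first_drawdown exclusive_first_drawdown x, of h, unfolded R0.total_gf(2)[OF h]]
  note dL = L0.tail_prob_gf[OF measurable_first_drawdown exclusive_first_drawdown x, of h, unfolded L0.total_gf(2)[OF h]]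
  have x1: "1 - x \<noteq> 0" using x by simp
  have SR: "(\<lambda>n. prob_b h (- int n) * x ^ n) sums (top_prob_L h * (top_prob_R h - ?vR) / (1 - x))"
  proof -
    have "(\<Sum>n. R0.tail_prob (valley_peak_at False h) n * x ^ n) = (top_prob_R h - ?vR) / (1 - x)"
      using gR(2) x1 by (simp add: eq_divide_eq mult.commute)
    then have "(\<lambda>n. R0.tail_prob (valley_peak_at False h) n * x ^ n) sums ((top_prob_R h - ?vR) / (1 - x))"
      using summable_sums[OF gR(1)] by simp
    from sums_mult[OF this, of "top_prob_L h"] show ?thesis
      by (simp only: prob_b_nonpos[OF h] mult.assoc times_divide_eq_right)
  qed
  have SL: "(\<lambda>n. prob_b h (int n + 1) * x ^ n) sums (top_prob_R h * (top_prob_L h - ?vL) / (1 - x))"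
  proof -
    have "(\<Sum>n. L0.tail_prob (valley_peak_at True h) n * x ^ n) = (top_prob_L h - ?vL) / (1 - x)"
      using gL(2) x1 by (simp add: eq_divide_eq mult.commute)
    then have "(\<lambda>n. L0.tail_prob (valley_peak_at True h) n * x ^ n) sums ((top_prob_L h - ?vL) / (1 - x))"
      using summable_sums[OF gL(1)] by simp
    from sums_mult[OF this, of "top_prob_R h"] show ?thesis
      by (simp only: prob_b_pos[OF h] mult.assoc times_divide_eq_right)
  qed
  \<comment> \<open>The discounted mass of the two half-lines. The product of the exit probabilities
    factors out, and each half-line leaves 1 minus a normalised peak transform, divided by 1 -
    x.\<close>
  have eq: "\<kappa> h * \<Psi> = top_prob_L h * (top_prob_R h - ?vR) / (1 - x) + top_prob_R h * (top_prob_L h - ?vL) / (1 - x)"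
  proof -
    have "\<kappa> h * \<Psi> = top_prob_R h * top_prob_L h * (2 - ?vR / top_prob_R h - ?vL / top_prob_L h) / (1 - x)"
      using h by (simp add: \<Psi>_def \<kappa>_def)
    also have "top_prob_R h * top_prob_L h * (2 - ?vR / top_prob_R h - ?vL / top_prob_L h) = top_prob_L h * (top_prob_R h - ?vR) + top_prob_R h * (top_prob_L h - ?vL)"
      using a by (simp add: field_simps)
    finally show ?thesis by (simp add: add_divide_distrib)
  qed
  note DN = discounted_mass[OF neg_tail_split[OF h] _ neg_tail_le[OF h] x dR SR]
  note DP = discounted_mass[OF pos_tail_split[OF h] _ pos_tail_le[OF h] x dL SL]
  have nn: "0 \<le> neg_tail h n" "0 \<le> pos_tail h n" for n by (simp_all add: neg_tail_def pos_tail_def)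
  show "\<kappa> h * \<Psi> \<le> 1"
    using DN(2)[OF nn(1)] DP(2)[OF nn(2)] prob_halves[OF h] unfolding eq by linarith
  show "walk_gf M (R 0) (first_drawdown h) x + walk_gf M (Lf 0) (first_drawdown h) x - 1 \<le> \<kappa> h * \<Psi>"
    using DN(1)[OF nn(1)] DP(1)[OF nn(2)] prob_halves[OF h] unfolding eq by linarith
qed

text \<open>The discount lam = \<sigma>^2 c^2 / 2 makes all normalised transforms tend to 1 / cosh
  c. Then \<open>\<Psi>\<close> tends to 4 q / \<sigma>^2, and the lower bound of
  \<open>kappa_bounds\<close> tends to 2 / cosh c - 1 = 1 - 2 c^2 q. Division confines \<kappa>, for
  large h, to any neighbourhood of an interval that depends only on c.\<close>

lemma kappa_squeeze:
  assumes c: "0 < c"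
  defines "q \<equiv> (1 - 1 / cosh c) / c\<^sup>2"
  shows "t < (1 - 2 * c\<^sup>2 * q) * \<sigma>\<^sup>2 / (4 * q) \<Longrightarrow> \<forall>\<^sub>F h in at_top. t < \<kappa> h"
    and "\<sigma>\<^sup>2 / (4 * q) < t \<Longrightarrow> \<forall>\<^sub>F h in at_top. \<kappa> h < t"
proof -
  define lam where "lam = \<sigma>\<^sup>2 * c\<^sup>2 / 2"
  have lam: "0 < lam" using c X_sigma by (simp add: lam_def)
  have cl: "sqrt (2 * lam) / \<sigma> = c" using c X_sigma by (simp add: lam_def real_sqrt_mult)
  have q: "0 < q"
  proof -
    have "1 < cosh c" using c cosh_real_nonneg_less_iff[of 0 c] by simp
    then show ?thesis using c by (simp add: q_def)
  qed
  let ?x = "\<lambda>h. exp (- lam / h\<^sup>2)"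
  define \<Psi> where "\<Psi> h = (2 - walk_gf M (R 0) (valley_peak_at False h) (?x h) / top_prob_R h - walk_gf M (Lf 0) (valley_peak_at True h) (?x h) / top_prob_L h) / (h\<^sup>2 * (1 - ?x h))" for h
  define G where "G h = walk_gf M (R 0) (first_drawdown h) (?x h) + walk_gf M (Lf 0) (first_drawdown h) (?x h) - 1" for h
  have hx: "((\<lambda>h. h\<^sup>2 * (1 - ?x h)) \<longlongrightarrow> lam) at_top" by real_asymp
  have "(\<Psi> \<longlongrightarrow> (2 - 1 / cosh c - 1 / cosh c) / lam) at_top"
    unfolding \<Psi>_def top_prob_R_def top_prob_L_def
    using lam by (intro tendsto_divide[OF tendsto_diff[OF tendsto_diff[OF tendsto_const
      R0.gf_laplace(1)[OF lam, of False, unfolded cl]] L0.gf_laplace(1)[OF lam, of True, unfolded cl]] hx]) simp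
  moreover have "(2 - 1 / cosh c - 1 / cosh c) / lam = 4 * q / \<sigma>\<^sup>2"
    using c X_sigma by (simp add: q_def lam_def field_simps)
  ultimately have \<Psi>: "(\<Psi> \<longlongrightarrow> 4 * q / \<sigma>\<^sup>2) at_top" by simp
  have "(G \<longlongrightarrow> 1 / cosh c + 1 / cosh c - 1) at_top"
    unfolding G_def using R0.gf_laplace(2)[OF lam] L0.gf_laplace(2)[OF lam] unfolding cl
    by (intro tendsto_diff tendsto_add tendsto_const)
  moreover have "1 / cosh c + 1 / cosh c - 1 = 1 - 2 * c\<^sup>2 * q" using c by (simp add: q_def)
  ultimately have G: "(G \<longlongrightarrow> 1 - 2 * c\<^sup>2 * q) at_top" by simp
  have pos: "\<forall>\<^sub>F h in at_top. 0 < \<Psi> h"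
    using order_tendstoD(1)[OF \<Psi>, of 0] q X_sigma by simp
  have nz: "4 * q / \<sigma>\<^sup>2 \<noteq> 0" using q X_sigma by simp
  have bounds: "\<forall>\<^sub>F h in at_top. G h \<le> \<kappa> h * \<Psi> h \<and> \<kappa> h * \<Psi> h \<le> 1"
    using eventually_gt_at_top[of 0]
  proof eventually_elim
    case (elim h)
    have "0 \<le> ?x h" "?x h < 1" using lam elim by auto
    from kappa_bounds[OF elim this] show ?case by (simp add: \<Psi>_def G_def)
  qed
  {
    assume "\<sigma>\<^sup>2 / (4 * q) < t"
    moreover have "((\<lambda>h. 1 / \<Psi> h) \<longlongrightarrow> 1 / (4 * q / \<sigma>\<^sup>2)) at_top" by (intro tendsto_divide tendsto_const \<Psi> nz)
    ultimately have "\<forall>\<^sub>F h in at_top. 1 / \<Psi> h < t" by (intro order_tendstoD) auto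
    with bounds pos show "\<forall>\<^sub>F h in at_top. \<kappa> h < t"
    proof eventually_elim
      case (elim h)
      then have "\<kappa> h \<le> 1 / \<Psi> h" by (simp add: pos_le_divide_eq)
      then show ?case using elim by simp
    qed
  }
  {
    assume "t < (1 - 2 * c\<^sup>2 * q) * \<sigma>\<^sup>2 / (4 * q)"
    moreover have "((\<lambda>h. G h / \<Psi> h) \<longlongrightarrow> (1 - 2 * c\<^sup>2 * q) / (4 * q / \<sigma>\<^sup>2)) at_top" by (intro tendsto_divide G \<Psi> nz)
    ultimately have "\<forall>\<^sub>F h in at_top. t < G h / \<Psi> h" by (intro order_tendstoD) auto
    with bounds pos show "\<forall>\<^sub>F h in at_top. t < \<kappa> h"
    proof eventually_elim
      case (elim h)
      then have "G h / \<Psi> h \<le> \<kappa> h" by (simp add: pos_divide_le_eq)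
      then show ?case using elim by simp
    qed
  }
qed

text \<open>First h tends to infinity with c fixed, then c tends to 0: the discount becomes weak
  only after the scaling limit. As q tends to 1/2, both ends of the interval tend to \<sigma>^2 /
  2.\<close>

lemma kappa_limit: "(\<kappa> \<longlongrightarrow> \<sigma>\<^sup>2 / 2) at_top"
proof (rule order_tendstoI)
  let ?q = "\<lambda>c::real. (1 - 1 / cosh c) / c\<^sup>2"
  have c0: "((\<lambda>c::real. c) \<longlongrightarrow> 0) (at_right 0)" by (rule tendsto_ident_at)
  have pos: "\<forall>\<^sub>F c in at_right (0::real). 0 < c" by (rule eventually_at_right_less)
  have hi: "((\<lambda>c. \<sigma>\<^sup>2 / (4 * ?q c)) \<longlongrightarrow> \<sigma>\<^sup>2 / (4 * (1 / 2))) (at_right 0)"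
    by (intro tendsto_divide tendsto_mult tendsto_const sech_quotient_limit) simp
  have lo: "((\<lambda>c. (1 - 2 * c\<^sup>2 * ?q c) * \<sigma>\<^sup>2 / (4 * ?q c)) \<longlongrightarrow> (1 - 2 * 0\<^sup>2 * (1 / 2)) * \<sigma>\<^sup>2 / (4 * (1 / 2))) (at_right 0)"
    by (intro tendsto_divide tendsto_mult tendsto_diff tendsto_power tendsto_const sech_quotient_limit c0) simp
  {
    fix t assume "t < \<sigma>\<^sup>2 / 2"
    then have "\<forall>\<^sub>F c in at_right 0. t < (1 - 2 * c\<^sup>2 * ?q c) * \<sigma>\<^sup>2 / (4 * ?q c)"
      by (intro order_tendstoD(1)[OF lo]) simp
    with pos have "\<forall>\<^sub>F c in at_right 0. 0 < c \<and> t < (1 - 2 * c\<^sup>2 * ?q c) * \<sigma>\<^sup>2 / (4 * ?q c)"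
      by eventually_elim simp
    then obtain c where "0 < c" "t < (1 - 2 * c\<^sup>2 * ?q c) * \<sigma>\<^sup>2 / (4 * ?q c)"
      using eventually_happens'[OF trivial_limit_at_right_real] by blast
    then show "\<forall>\<^sub>F h in at_top. t < \<kappa> h" by (rule kappa_squeeze(1))
  }
  {
    fix t assume "\<sigma>\<^sup>2 / 2 < t"
    then have "\<forall>\<^sub>F c in at_right 0. \<sigma>\<^sup>2 / (4 * ?q c) < t"
      by (intro order_tendstoD(2)[OF hi]) simp
    with pos have "\<forall>\<^sub>F c in at_right 0. 0 < c \<and> \<sigma>\<^sup>2 / (4 * ?q c) < t"
      by eventually_elim simp
    then obtain c where "0 < c" "\<sigma>\<^sup>2 / (4 * ?q c) < t"
      using eventually_happens'[OF trivial_limit_at_right_real] by blast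
    then show "\<forall>\<^sub>F h in at_top. \<kappa> h < t" by (rule kappa_squeeze(2))
  }
qed

text \<open>h^2 times the probability is exactly \<kappa> h times a value of a step function. The
  first factor converges and the second does so uniformly on [0, 1], so all sites, however far away,
  are treated at once.\<close>

lemma prob_b_uniform:
  assumes e: "0 < e"
  shows "\<forall>\<^sub>F h in at_top. \<forall>x. \<bar>h\<^sup>2 * prob_b h x - \<sigma>\<^sup>2 * phi_infty (\<sigma>\<^sup>2 * (real_of_int x / h\<^sup>2))\<bar> < e"
proof -
  have s2: "0 < \<sigma>\<^sup>2" using X_sigma by simp
  let ?g = "limit_cdf (\<sigma>\<^sup>2)"
  let ?R = "\<lambda>h. step_cdf (R0.peak_weight False h) (\<lambda>m. exp (- real m / h\<^sup>2))"
  let ?L = "\<lambda>h. step_cdf (L0.peak_weight True h) (\<lambda>m. exp (- real m / h\<^sup>2))"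
  \<comment> \<open>An error d in \<kappa>, multiplied by a value in [0, 1], and an error 2 d in the
    step function, multiplied by \<sigma>^2 / 2, must stay below e.\<close>
  define d where "d = e / (2 + 2 * \<sigma>\<^sup>2)"
  have d: "0 < d" unfolding d_def using e s2 by (intro divide_pos_pos add_pos_pos) simp_all
  have de: "d + \<sigma>\<^sup>2 / 2 * (d + d) < e"
  proof -
    have "d + \<sigma>\<^sup>2 / 2 * (d + d) = d * (1 + \<sigma>\<^sup>2)" by (simp add: algebra_simps)
    also have "\<dots> < d * (2 + 2 * \<sigma>\<^sup>2)" using d s2 by (intro mult_strict_left_mono) linarith+
    also have "\<dots> = e"
    proof -
      have "2 + 2 * \<sigma>\<^sup>2 \<noteq> 0" using s2 by linarith
      then show ?thesis unfolding d_def by (rule nonzero_divide_eq_eq[THEN iffD1, OF _ refl, symmetric])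
    qed
    finally show ?thesis .
  qed
  have "uniformly_continuous_on {0..1} ?g"
    using continuous_on_limit_cdf[OF s2] compact_uniformly_continuous by blast
  then obtain r where r: "0 < r" "\<And>x y. x \<in> {0..1} \<Longrightarrow> y \<in> {0..1} \<Longrightarrow> \<bar>x - y\<bar> < r \<Longrightarrow> \<bar>?g x - ?g y\<bar> < d"
    using d unfolding uniformly_continuous_on_def dist_real_def by (metis abs_minus_commute)
  have "((\<lambda>h::real. 1 - exp (- 1 / h\<^sup>2)) \<longlongrightarrow> 0) at_top" by real_asymp
  then have sm: "\<forall>\<^sub>F h::real in at_top. 1 - exp (- 1 / h\<^sup>2) < r" using r(1) by (rule order_tendstoD)
  have uR: "\<forall>\<^sub>F h in at_top. \<forall>x\<in>{0..1}. dist (if 0 < h then ?R h x else x) (?g x) < d"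
    by (rule uniform_limitD[OF R0.peak_cdf_limit d])
  have uL: "\<forall>\<^sub>F h in at_top. \<forall>x\<in>{0..1}. dist (if 0 < h then ?L h x else x) (?g x) < d"
    by (rule uniform_limitD[OF L0.peak_cdf_limit d])
  have k: "\<forall>\<^sub>F h in at_top. dist (\<kappa> h) (\<sigma>\<^sup>2 / 2) < d" by (rule tendstoD[OF kappa_limit d])
  from uR uL k sm eventually_gt_at_top[of 0] show ?thesis
  proof eventually_elim
    case (elim h)
    then have h: "0 < h" by simp
    have main: "\<bar>\<kappa> h * u - \<sigma>\<^sup>2 / 2 * v\<bar> < e" if "u \<in> {0..1}" "\<bar>u - v\<bar> < d + d" for u v
    proof -
      have "\<kappa> h * u - \<sigma>\<^sup>2 / 2 * v = (\<kappa> h - \<sigma>\<^sup>2 / 2) * u + \<sigma>\<^sup>2 / 2 * (u - v)"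
        by (simp only: left_diff_distrib right_diff_distrib)
      then have "\<bar>\<kappa> h * u - \<sigma>\<^sup>2 / 2 * v\<bar> \<le> \<bar>(\<kappa> h - \<sigma>\<^sup>2 / 2) * u\<bar> + \<bar>\<sigma>\<^sup>2 / 2 * (u - v)\<bar>" by simp
      also have "\<bar>(\<kappa> h - \<sigma>\<^sup>2 / 2) * u\<bar> \<le> d * 1"
        unfolding abs_mult using elim(3) that(1) d by (intro mult_mono) (auto simp: dist_real_def)
      also have "\<bar>\<sigma>\<^sup>2 / 2 * (u - v)\<bar> \<le> \<sigma>\<^sup>2 / 2 * (d + d)"
        unfolding abs_mult using that(2) s2 by (intro mult_mono) auto
      finally show ?thesis using de by simp
    qed
    show ?case
    proof
      fix x :: int
      have tgt: "\<sigma>\<^sup>2 * phi_infty (\<sigma>\<^sup>2 * (real_of_int x / h\<^sup>2)) = \<sigma>\<^sup>2 / 2 * ?g (exp (- \<bar>real_of_int x / h\<^sup>2\<bar>))"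
        using limit_cdf_exp[OF s2, of "real_of_int x / h\<^sup>2"] by simp
      show "\<bar>h\<^sup>2 * prob_b h x - \<sigma>\<^sup>2 * phi_infty (\<sigma>\<^sup>2 * (real_of_int x / h\<^sup>2))\<bar> < e"
      proof (cases "x \<le> 0")
        case True
        then obtain n where x: "x = - int n" by (intro that[of "nat (- x)"]) auto
        let ?t = "exp (- real n / h\<^sup>2)"
        have t01: "?t \<in> {0..1}" by (simp add: divide_nonpos_nonneg)
        have et: "exp (- \<bar>real_of_int x / h\<^sup>2\<bar>) = ?t" using h by (simp add: x)
        have "h\<^sup>2 * prob_b h x = \<kappa> h * ?R h ?t"
          unfolding x prob_b_nonpos[OF h] R0.tail_prob_step_cdf[OF h] \<kappa>_def top_prob_R_def by simp
        moreover have "?R h ?t \<in> {0..1}"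
          by (rule step_cdf_range[OF R0.peak_weight(1,2)[OF h]]) (simp add: divide_nonpos_nonneg)
        moreover have "\<bar>?R h ?t - ?g ?t\<bar> < d + d"
          using bspec[OF elim(1) t01] h d by (simp add: dist_real_def)
        ultimately show ?thesis unfolding tgt et using main by simp
      next
        case False
        then obtain n where x: "x = int n + 1" by (intro that[of "nat (x - 1)"]) auto
        let ?t = "exp (- real n / h\<^sup>2)" and ?u = "exp (- \<bar>real_of_int x / h\<^sup>2\<bar>)"
        have t01: "?t \<in> {0..1}" by (simp add: divide_nonpos_nonneg)
        have u01: "?u \<in> {0..1}" by simp
        \<comment> \<open>For x = n + 1 the tail has index n, one site short of x. The two arguments
          differ by the factor exp (- 1 / h^2), and uniform continuity of the limit pays for it with
          the second d.\<close>
        have "\<bar>?t - ?u\<bar> < r"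
        proof -
          have ut: "?u = ?t * exp (- 1 / h\<^sup>2)"
            using h by (simp add: x add_divide_distrib diff_divide_distrib flip: exp_add)
          have "?t - ?u = ?t * (1 - exp (- 1 / h\<^sup>2))" unfolding ut by (simp add: right_diff_distrib)
          moreover have "0 \<le> 1 - exp (- 1 / h\<^sup>2)" by simp
          moreover have "?t * (1 - exp (- 1 / h\<^sup>2)) \<le> 1 * (1 - exp (- 1 / h\<^sup>2))"
            using t01 by (intro mult_right_mono) auto
          moreover have "0 \<le> ?t * (1 - exp (- 1 / h\<^sup>2))" by simp
          ultimately show ?thesis using elim(4) by simp
        qed
        then have gg: "\<bar>?g ?t - ?g ?u\<bar> < d" by (intro r(2) t01 u01)
        have "h\<^sup>2 * prob_b h x = \<kappa> h * ?L h ?t"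
          unfolding x prob_b_pos[OF h] L0.tail_prob_step_cdf[OF h] \<kappa>_def top_prob_L_def by simp
        moreover have "?L h ?t \<in> {0..1}"
          by (rule step_cdf_range[OF L0.peak_weight(1,2)[OF h]]) (simp add: divide_nonpos_nonneg)
        moreover have "\<bar>?L h ?t - ?g ?u\<bar> < d + d"
          using bspec[OF elim(2) t01] h d gg by (simp add: dist_real_def)
        ultimately show ?thesis unfolding tgt using main by simp
      qed
    qed
  qed
qed

end

section \<open>The local limit theorem\<close>

lemma strict_mono_int_unbounded:
  fixes f :: "int \<Rightarrow> int"
  assumes f: "strict_mono f"
  shows "\<exists>k. n < f k" "\<exists>k. f k < n"
proof -
  have up: "f 0 + int k \<le> f (int k)" and dn: "f (- int k) \<le> f 0 - int k" for k
  proof (induction k)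
    case (Suc k)
    have "f (int k) < f (int (Suc k))" "f (- int (Suc k)) < f (- int k)"
      by (rule strict_monoD[OF f]; simp)+
    with Suc show "f 0 + int (Suc k) \<le> f (int (Suc k))" "f (- int (Suc k)) \<le> f 0 - int (Suc k)" by auto
  qed auto
  show "\<exists>k. n < f k" using up[of "nat (n - f 0 + 1)"] by (intro exI[of _ "int (nat (n - f 0 + 1))"]) auto
  show "\<exists>k. f k < n" using dn[of "nat (f 0 - n + 1)"] by (intro exI[of _ "- int (nat (f 0 - n + 1))"]) auto
qed

text \<open>The pair of consecutive extrema around the origin is unique, so it can be described by
  quantifiers over sites. These are countable, hence this form is measurable.\<close>

lemma b_bottom_eq_enumerated:
  assumes "\<And>n. \<exists>y. n < y \<and> left_h_extremum h v y" "\<And>n. \<exists>y. y < n \<and> left_h_extremum h v y"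
  shows "b_bottom h v = x \<longleftrightarrow> (\<exists>y z. y \<le> 0 \<and> 0 < z \<and> left_h_extremum h v y \<and> left_h_extremum h v z \<and>
    (\<forall>u. y < u \<and> u < z \<longrightarrow> \<not> left_h_extremum h v u) \<and> x = (if left_h_minimum h v y then y else z))"
proof -
  define X where "X = h_extrema_enum v h"
  note enum = h_extrema_enum_consecutive[OF assms, folded X_def]
  note X = enum(1,2) and ext = enum(3,4) and between = enum(5)
  have b: "b_bottom h v = (if left_h_minimum h v (X 0) then X 0 else X 1)"
    by (simp add: b_bottom_def X_def)
  have uniq: "y = X 0 \<and> z = X 1" if "y \<le> 0" "0 < z" "left_h_extremum h v y" "left_h_extremum h v z"
    "\<forall>u. y < u \<and> u < z \<longrightarrow> \<not> left_h_extremum h v u" for y z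
  proof -
    have "y \<le> X 0" "X 1 \<le> z" using between[OF that(3)] between[OF that(4)] X that(1,2) by linarith+
    moreover have "X 0 \<le> y" "z \<le> X 1"
      using that(5)[rule_format, of "X 0"] that(5)[rule_format, of "X 1"] ext X that(1,2) by linarith+
    ultimately show ?thesis by simp
  qed
  show ?thesis
  proof
    assume "b_bottom h v = x"
    then show "\<exists>y z. y \<le> 0 \<and> 0 < z \<and> left_h_extremum h v y \<and> left_h_extremum h v z \<and>
      (\<forall>u. y < u \<and> u < z \<longrightarrow> \<not> left_h_extremum h v u) \<and> x = (if left_h_minimum h v y then y else z)"
      using X ext between b by (intro exI[of _ "X 0"] exI[of _ "X 1"]) force
  next
    assume "\<exists>y z. y \<le> 0 \<and> 0 < z \<and> left_h_extremum h v y \<and> left_h_extremum h v z \<and>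
      (\<forall>u. y < u \<and> u < z \<longrightarrow> \<not> left_h_extremum h v u) \<and> x = (if left_h_minimum h v y then y else z)"
    then obtain y z where yz: "y \<le> 0" "0 < z" "left_h_extremum h v y" "left_h_extremum h v z"
      "\<forall>u. y < u \<and> u < z \<longrightarrow> \<not> left_h_extremum h v u" and x: "x = (if left_h_minimum h v y then y else z)"
      by blast
    from uniq[OF yz] show "b_bottom h v = x" unfolding b x by simp
  qed
qed

text \<open>On the exceptional paths without an enumeration \<open>h_extrema_enum\<close> is still a constant function,
  which makes \<open>b_bottom\<close> measurable on the whole space.\<close>

lemma b_bottom_not_enumerated:
  fixes h :: real and v :: "int \<Rightarrow> real"
  assumes "\<not> ((\<forall>n. \<exists>y. n < y \<and> left_h_extremum h v y) \<and> (\<forall>n. \<exists>y. y < n \<and> left_h_extremum h v y))"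
  defines "c \<equiv> (THE x :: int \<Rightarrow> int. False)"
  shows "b_bottom h v = (if left_h_minimum h v (c 0) then c 0 else c 1)"
proof -
  \<comment> \<open>The defining predicate equals the constant \<open>False\<close>, so the definite
    description becomes the same term for all such paths.\<close>
  have none: "(strict_mono f \<and> range f = {y. left_h_extremum h v y} \<and> f 0 \<le> 0 \<and> 0 < f 1) = False" for f :: "int \<Rightarrow> int"
  proof
    assume f: "strict_mono f \<and> range f = {y. left_h_extremum h v y} \<and> f 0 \<le> 0 \<and> 0 < f 1"
    then have "left_h_extremum h v (f k)" for k by auto
    moreover have "\<exists>k. n < f k" "\<exists>k. f k < n" for n using f strict_mono_int_unbounded[of f n] by simp_all
    ultimately show False using assms(1) by meson
  qed simp
  have "h_extrema_enum v h = c" unfolding h_extrema_enum_def c_def none ..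
  then show ?thesis by (simp add: b_bottom_def)
qed

text \<open>The measure space need not be complete, so almost sure agreement with a measurable event
  does not suffice; the exceptional paths have to be covered as well.\<close>

lemma measurable_b_bottom:
  assumes [measurable]: "\<And>y. (\<lambda>s. V s y) \<in> borel_measurable M"
  shows "Measurable.pred M (\<lambda>s. b_bottom h (V s) = x)"
proof -
  have hmin: "Measurable.pred M (\<lambda>s. hmin False h (W s) y)"
    if [measurable]: "\<And>y. (\<lambda>s. W s y) \<in> borel_measurable M" for W :: "'a \<Rightarrow> int \<Rightarrow> real" and y
    unfolding hmin_def hit_def if_False by measurable
  have [measurable]: "Measurable.pred M (\<lambda>s. left_h_minimum h (V s) y)" for y
    unfolding left_h_minimum_iff by (rule hmin) measurable
  have "Measurable.pred M (\<lambda>s. hmin False h (\<lambda>j. - V s j) y)" for y by (rule hmin) measurable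
  then have [measurable]: "Measurable.pred M (\<lambda>s. left_h_extremum h (V s) y)" for y
    unfolding left_h_extremum_iff left_h_minimum_iff[symmetric] by measurable
  define c :: "int \<Rightarrow> int" where "c = (THE x. False)"
  define enum where "enum s \<longleftrightarrow> (\<forall>n. \<exists>y. n < y \<and> left_h_extremum h (V s) y) \<and> (\<forall>n. \<exists>y. y < n \<and> left_h_extremum h (V s) y)" for s
  define b where "b s \<longleftrightarrow> (\<exists>y z. y \<le> 0 \<and> 0 < z \<and> left_h_extremum h (V s) y \<and> left_h_extremum h (V s) z \<and>
    (\<forall>u. y < u \<and> u < z \<longrightarrow> \<not> left_h_extremum h (V s) u) \<and> x = (if left_h_minimum h (V s) y then y else z))" for s
  have [measurable]: "Measurable.pred M enum" unfolding enum_def by measurable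
  have [measurable]: "Measurable.pred M b" unfolding b_def by measurable
  have "Measurable.pred M (\<lambda>s. enum s \<and> b s \<or> \<not> enum s \<and> (if left_h_minimum h (V s) (c 0) then c 0 else c 1) = x)"
    by measurable
  moreover have "(\<lambda>s. b_bottom h (V s) = x) =
    (\<lambda>s. enum s \<and> b s \<or> \<not> enum s \<and> (if left_h_minimum h (V s) (c 0) then c 0 else c 1) = x)"
  proof
    fix s
    have "b_bottom h (V s) = x \<longleftrightarrow> b s" if "enum s"
      unfolding b_def by (rule b_bottom_eq_enumerated) (use that in \<open>unfold enum_def, blast\<close>)+
    moreover have "b_bottom h (V s) = (if left_h_minimum h (V s) (c 0) then c 0 else c 1)" if "\<not> enum s"
      unfolding c_def by (rule b_bottom_not_enumerated) (use that in \<open>unfold enum_def\<close>)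
    ultimately show "(b_bottom h (V s) = x) =
      (enum s \<and> b s \<or> \<not> enum s \<and> (if left_h_minimum h (V s) (c 0) then c 0 else c 1) = x)" by metis
  qed
  ultimately show ?thesis by (simp only:)
qed

lemma ln_rho_bound:
  assumes e: "0 < e" "e \<le> t" "t \<le> 1 - e"
  shows "\<bar>ln (rho t)\<bar> \<le> ln ((1 - e) / e)"
proof -
  have "rho t \<le> (1 - e) / e" "e / (1 - e) \<le> rho t"
    unfolding rho_def using e by (intro frac_le; simp)+
  moreover have "0 < e / (1 - e)" using e by simp
  ultimately have "ln (rho t) \<le> ln ((1 - e) / e)" "ln (e / (1 - e)) \<le> ln (rho t)" by simp_all
  moreover have "ln (e / (1 - e)) = - ln ((1 - e) / e)" using e by (simp add: ln_div)
  ultimately show ?thesis by linarith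
qed

text \<open>The eventual bound also provides boundedness of the family, without which the real
  supremum would have no meaningful value.\<close>

lemma SUP_abs_in_smallo:
  fixes f :: "real \<Rightarrow> 'b \<Rightarrow> real"
  assumes "\<And>e. 0 < e \<Longrightarrow> \<forall>\<^sub>F h in at_top. \<forall>x. \<bar>f h x\<bar> \<le> e * norm (g h)"
  shows "(\<lambda>h. SUP x. \<bar>f h x\<bar>) \<in> o[at_top](g)"
proof (rule landau_o.smallI)
  fix e :: real assume "0 < e"
  from assms[OF this] show "\<forall>\<^sub>F h in at_top. norm (SUP x. \<bar>f h x\<bar>) \<le> e * norm (g h)"
  proof eventually_elim
    case (elim h)
    have "bdd_above (range (\<lambda>x. \<bar>f h x\<bar>))" using elim by (intro bdd_aboveI2[of _ _ "e * norm (g h)"]) auto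
    then have "\<bar>f h undefined\<bar> \<le> (SUP x. \<bar>f h x\<bar>)" by (intro cSUP_upper) auto
    moreover have "(SUP x. \<bar>f h x\<bar>) \<le> e * norm (g h)" using elim by (intro cSUP_least) auto
    ultimately show ?case by auto
  qed
qed

theorem theorem1p4:
  fixes M :: "'a measure" and \<omega> :: "int \<Rightarrow> 'a \<Rightarrow> real" and \<sigma> :: real
  assumes "prob_space M"
    and "\<And>x s. s \<in> space M \<Longrightarrow> \<omega> x s \<in> {0<..<1}"
    and "prob_space.indep_vars M (\<lambda>_. borel) \<omega> UNIV"
    and "\<And>x. distr M borel (\<omega> x) = distr M borel (\<omega> 0)"
    and "\<exists>\<epsilon>\<^sub>0\<in>{0<..<1/2}. measure M {s \<in> space M. \<epsilon>\<^sub>0 \<le> \<omega> 0 s \<and> \<omega> 0 s \<le> 1 - \<epsilon>\<^sub>0} = 1"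
    and "(\<integral>s. ln (rho (\<omega> 0 s)) \<partial>M) = 0"
    and "\<sigma> = sqrt (\<integral>s. (ln (rho (\<omega> 0 s)))\<^sup>2 \<partial>M)"
    and "\<sigma> > 0"
  shows "(\<lambda>h. SUP x::int.
            \<bar>measure M {s \<in> space M. b_bottom h (potential (\<lambda>i. \<omega> i s)) = x}
               - \<sigma>\<^sup>2 / h\<^sup>2 * phi_infty (\<sigma>\<^sup>2 * real_of_int x / h\<^sup>2)\<bar>)
         \<in> o[at_top](\<lambda>h::real. 1 / h\<^sup>2)"
proof -
  interpret prob_space M by fact
  have \<omega>_rv [measurable]: "\<omega> i \<in> borel_measurable M" for i
    using assms(3) by (auto simp: indep_vars_def)
  obtain \<epsilon> where \<epsilon>: "0 < \<epsilon>" "\<epsilon> < 1 / 2" and "measure M {s \<in> space M. \<epsilon> \<le> \<omega> 0 s \<and> \<omega> 0 s \<le> 1 - \<epsilon>} = 1"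
    using assms(5) by auto
  then have "AE s in M. s \<in> {s \<in> space M. \<epsilon> \<le> \<omega> 0 s \<and> \<omega> 0 s \<le> 1 - \<epsilon>}"
    by (subst (asm) prob_eq_1) auto
  then have ell0: "AE s in M. \<epsilon> \<le> \<omega> 0 s \<and> \<omega> 0 s \<le> 1 - \<epsilon>" by eventually_elim simp
  have ell: "AE s in M. \<epsilon> \<le> \<omega> i s \<and> \<omega> i s \<le> 1 - \<epsilon>" for i
  proof -
    have "AE t in distr M borel (\<omega> 0). \<epsilon> \<le> t \<and> t \<le> 1 - \<epsilon>" using ell0 by (subst AE_distr_iff) auto
    then have "AE t in distr M borel (\<omega> i). \<epsilon> \<le> t \<and> t \<le> 1 - \<epsilon>" unfolding assms(4)[of i] .
    then show ?thesis by (subst (asm) AE_distr_iff) auto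
  qed
  \<comment> \<open>The ellipticity bound holds only almost surely. Truncation to
    [\<epsilon>, 1 - \<epsilon>] makes the steps bounded everywhere and alters the environment on a
    null set only.\<close>
  define K where "K t = max \<epsilon> (min (1 - \<epsilon>) t)" for t
  define F where "F t = ln (rho (K t))" for t
  have K_id: "K t = t" if "\<epsilon> \<le> t \<and> t \<le> 1 - \<epsilon>" for t using that by (simp add: K_def)
  have F_meas [measurable]: "F \<in> borel_measurable borel" unfolding F_def K_def rho_def by measurable
  define X where "X i s = F (\<omega> i s)" for i s
  define V where "V s = potential (\<lambda>i. K (\<omega> i s))" for s
  have [measurable]: "X i \<in> borel_measurable M" for i unfolding X_def by measurable
  have X0: "AE s in M. X 0 s = ln (rho (\<omega> 0 s))"
    using ell0 by eventually_elim (simp add: X_def F_def K_id)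
  interpret potential_walk M X V "ln ((1 - \<epsilon>) / \<epsilon>)" \<sigma>
  proof
    show "indep_vars (\<lambda>_. borel) X UNIV"
      unfolding X_def[abs_def] by (rule indep_vars_compose2[OF assms(3)]) measurable
    have d: "distr M borel (X i) = distr (distr M borel (\<omega> i)) borel F" for i
      by (subst distr_distr) (auto simp: X_def[abs_def] comp_def)
    show "distr M borel (X i) = distr M borel (X 0)" for i
      unfolding d[of i] d[of 0] assms(4)[of i] ..
    show "\<bar>X i s\<bar> \<le> ln ((1 - \<epsilon>) / \<epsilon>)" for i s
      unfolding X_def F_def using \<epsilon> by (intro ln_rho_bound) (auto simp: K_def)
    have [measurable]: "(\<lambda>s. ln (rho (\<omega> 0 s))) \<in> borel_measurable M" unfolding rho_def by measurable
    have "expectation (X 0) = (\<integral>s. ln (rho (\<omega> 0 s)) \<partial>M)" by (rule integral_cong_AE) (use X0 in auto)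
    then show "expectation (X 0) = 0" using assms(6) by simp
    have "expectation (\<lambda>s. (X 0 s)\<^sup>2) = (\<integral>s. (ln (rho (\<omega> 0 s)))\<^sup>2 \<partial>M)"
      by (rule integral_cong_AE) (use X0 in \<open>auto elim: eventually_mono\<close>)
    moreover have "0 \<le> (\<integral>s. (ln (rho (\<omega> 0 s)))\<^sup>2 \<partial>M)" by simp
    ultimately show "expectation (\<lambda>s. (X 0 s)\<^sup>2) = \<sigma>\<^sup>2" unfolding assms(7) by simp
    show "0 < \<sigma>" by fact
    show "V s (x + 1) - V s x = X (x + 1) s" for s x
      unfolding V_def X_def F_def by (rule potential_step)
  qed
  \<comment> \<open>Outside a null set no site is changed by the truncation and the path oscillates,
    so the event is \<open>b_event\<close>; measurability of both events turns this into equal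
    probabilities.\<close>
  have law: "measure M {s \<in> space M. b_bottom h (potential (\<lambda>i. \<omega> i s)) = x} = prob_b h x" if h: "0 < h" for h x
    unfolding prob_b_def
  proof (rule finite_measure_eq_AE)
    have "AE s in M. \<forall>i. K (\<omega> i s) = \<omega> i s"
      unfolding AE_all_countable by (rule allI, rule eventually_mono[OF ell], rule K_id)
    then show "AE s in M. (s \<in> {s \<in> space M. b_bottom h (potential (\<lambda>i. \<omega> i s)) = x}) = (s \<in> {s \<in> space M. b_event h x s})"
      using AE_oscillating[OF h]
    proof eventually_elim
      case (elim s)
      then have "potential (\<lambda>i. \<omega> i s) = V s" by (simp add: V_def)
      then show ?case using b_bottom_iff[OF h elim(2), of x] by (simp add: b_event_def)
    qed
    have "(\<lambda>s. potential (\<lambda>i. \<omega> i s) y) \<in> borel_measurable M" for y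
      unfolding potential_def rho_def by measurable
    then have "Measurable.pred M (\<lambda>s. b_bottom h (potential (\<lambda>i. \<omega> i s)) = x)" by (rule measurable_b_bottom)
    then show "{s \<in> space M. b_bottom h (potential (\<lambda>i. \<omega> i s)) = x} \<in> events" by simp
    show "{s \<in> space M. b_event h x s} \<in> events"
      using measurable_b_event[OF h, of x] by simp
  qed
  show ?thesis
  proof (rule SUP_abs_in_smallo)
    fix e :: real assume "0 < e"
    from prob_b_uniform[OF this] eventually_gt_at_top[of 0]
    show "\<forall>\<^sub>F h in at_top. \<forall>x. \<bar>measure M {s \<in> space M. b_bottom h (potential (\<lambda>i. \<omega> i s)) = x}
               - \<sigma>\<^sup>2 / h\<^sup>2 * phi_infty (\<sigma>\<^sup>2 * real_of_int x / h\<^sup>2)\<bar> \<le> e * norm (1 / h\<^sup>2)"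
    proof eventually_elim
      case (elim h)
      show ?case
      proof
        fix x
        let ?p = "\<sigma>\<^sup>2 * phi_infty (\<sigma>\<^sup>2 * (real_of_int x / h\<^sup>2))"
        have h2: "0 < h\<^sup>2" using elim(2) by simp
        have "prob_b h x - \<sigma>\<^sup>2 / h\<^sup>2 * phi_infty (\<sigma>\<^sup>2 * real_of_int x / h\<^sup>2) = (h\<^sup>2 * prob_b h x - ?p) / h\<^sup>2"
          using elim(2) by (simp add: diff_divide_distrib)
        moreover have "\<bar>(h\<^sup>2 * prob_b h x - ?p) / h\<^sup>2\<bar> \<le> e / h\<^sup>2"
          unfolding abs_divide using elim(1)[rule_format, of x] h2 by (simp add: divide_right_mono)
        ultimately show "\<bar>measure M {s \<in> space M. b_bottom h (potential (\<lambda>i. \<omega> i s)) = x}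
               - \<sigma>\<^sup>2 / h\<^sup>2 * phi_infty (\<sigma>\<^sup>2 * real_of_int x / h\<^sup>2)\<bar> \<le> e * norm (1 / h\<^sup>2)"
          unfolding law[OF elim(2)] by simp
      qed
    qed
  qed
qed

end
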